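(* Let $a$ and $b$ be relatively prime positive integers, let $i,j,m,n\in\{0,1\}$ with $(i,j)\neq(0,0)$ and $(m,n)\neq(0,0)$, and let $\tau\in\mathcal{D}$. If $ia+mb$ is odd or $ja+nb$ is odd, then $$ \begin{aligned} & \frac{1}{a}\sum_{\substack{\mu,\nu =0 \\ (\mu,\nu) \neq(0,0)}}^{a-1}(-1)^{i\mu +j\nu } f_{m,n}\left(b\frac{\mu \tau +\nu}{a},\tau \right)f_{ia+mb,\,ja+nb}\left(\frac{\mu \tau +\nu}{a},\tau \right) \\ & \quad +\frac{1}{b}\sum_{\substack{\mu,\nu =0 \\ (\mu,\nu) \neq(0,0)}}^{b-1}(-1)^{m\mu +n\nu } f_{i,j}\left(a\frac{\mu \tau +\nu}{b},\tau \right)f_{ia+mb,\,ja+nb}\left(\frac{\mu \tau +\nu}{b},\tau \right) \\ & = -\frac{b}{a}C_{m,n}(\tau )-\frac{a}{b}C_{i,j}(\tau )-\frac{1}{ab}C_{ia+mb,\,ja+nb}(\tau ). \end{aligned} $$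
   Context: Let $\mathfrak{H}=\{\tau\in\mathbb{C}\mid \operatorname{Im}\tau>0\}$ and $\mathcal{D}=\{\tau\in\mathfrak{H} \mid |\operatorname{Re}\tau|\le 1,\ |\tau\pm\frac12|\ge\frac12\}$ (the fundamental domain of $\Gamma(2)$ to which $\tau$ is restricted throughout). Write $q^{x}:=e^{2\pi\sqrt{-1}\,x\tau}$ for real $x$. The Jacobi theta functions are $$\theta_1(z,\tau)=2\sum_{n=0}^\infty(-1)^n q^{\frac12(n+\frac12)^2}\sin((2n+1)\pi z),\qquad \theta_2(z,\tau)=2\sum_{n=0}^\infty q^{\frac12(n+\frac12)^2}\cos((2n+1)\pi z),$$ $$\theta_3(z,\tau)=1+2\sum_{n=1}^\infty q^{\frac12 n^2}\cos(2n\pi z),\qquad \theta_4(z,\tau)=1+2\sum_{n=1}^\infty(-1)^n q^{\frac12 n^2}\cos(2n\pi z).$$ Put $k=k(\tau)=\theta_2(0,\tau)^2/\theta_3(0,\tau)^2$, $\lambda=\lambda(\tau)=k(\tau)^2$ and $K=K(\tau)=\frac{\pi}{2}\theta_3(0,\tau)^2$. The Jacobi elliptic functions are $$\mathrm{sn}(2Kz,k)=\frac{\theta_3(0,\tau)}{\theta_2(0,\tau)}\frac{\theta_1(z,\tau)}{\theta_4(z,\tau)},\quad \mathrm{cn}(2Kz,k)=\frac{\theta_4(0,\tau)}{\theta_2(0,\tau)}\frac{\theta_2(z,\tau)}{\theta_4(z,\tau)},\quad \mathrm{dn}(2Kz,k)=\frac{\theta_4(0,\tau)}{\theta_3(0,\tau)}\frac{\theta_3(z,\tau)}{\theta_4(z,\tau)},$$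 and $\mathrm{cs}=\mathrm{cn}/\mathrm{sn}$, $\mathrm{ds}=\mathrm{dn}/\mathrm{sn}$, $\mathrm{ns}=1/\mathrm{sn}$. Define $$f_{1,0}(z,\tau):=2K\,\mathrm{cs}(2Kz,k),\qquad f_{1,1}(z,\tau):=2K\,\mathrm{ds}(2Kz,k),\qquad f_{0,1}(z,\tau):=2K\,\mathrm{ns}(2Kz,k),$$ $$C_{1,0}(\tau):=\left(-\tfrac13+\tfrac16\lambda\right)(2K)^2,\qquad C_{1,1}(\tau):=\left(\tfrac16-\tfrac13\lambda\right)(2K)^2,\qquad C_{0,1}(\tau):=\left(\tfrac16+\tfrac16\lambda\right)(2K)^2,$$ so that $f_{i,j}(z,\tau)=\frac1z+C_{i,j}(\tau)z+O(z^3)$ as $z\to0$. The indices of $f$ and $C$ are regarded as elements of $\mathbb{Z}/2\mathbb{Z}$ (i.e. reduced mod 2); $f_{0,0}$ and $C_{0,0}$ are not defined. Empty sums (when $a=1$ or $b=1$) are $0$. *)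

theory Defs
  imports "HOL-Complex_Analysis.Complex_Analysis"
begin

definition fund_domain :: "complex set" where
  "fund_domain = {\<tau>. Im \<tau> > 0 \<and> \<bar>Re \<tau>\<bar> \<le> 1 \<and> norm (\<tau> + 1/2) \<ge> 1/2 \<and> norm (\<tau> - 1/2) \<ge> 1/2}"

(* The power q^x of the nome, for a real exponent x. *)
definition qpow :: "complex \<Rightarrow> real \<Rightarrow> complex" where
  "qpow \<tau> x = exp (2 * of_real pi * \<i> * of_real x * \<tau>)"

definition theta1 :: "complex \<Rightarrow> complex \<Rightarrow> complex" where
  "theta1 z \<tau> = 2 * (\<Sum>n. (-1) ^ n * qpow \<tau> (1/2 * (real n + 1/2)\<^sup>2)
                           * sin (of_nat (2 * n + 1) * of_real pi * z))"

definition theta2 :: "complex \<Rightarrow> complex \<Rightarrow> complex" where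
  "theta2 z \<tau> = 2 * (\<Sum>n. qpow \<tau> (1/2 * (real n + 1/2)\<^sup>2)
                           * cos (of_nat (2 * n + 1) * of_real pi * z))"

(* In theta3 and theta4 the sum over n \<ge> 1 is written with Suc n in place of n. *)
definition theta3 :: "complex \<Rightarrow> complex \<Rightarrow> complex" where
  "theta3 z \<tau> = 1 + 2 * (\<Sum>n. qpow \<tau> (1/2 * (real (Suc n))\<^sup>2)
                               * cos (of_nat (2 * Suc n) * of_real pi * z))"

definition theta4 :: "complex \<Rightarrow> complex \<Rightarrow> complex" where
  "theta4 z \<tau> = 1 + 2 * (\<Sum>n. (-1) ^ Suc n * qpow \<tau> (1/2 * (real (Suc n))\<^sup>2)
                               * cos (of_nat (2 * Suc n) * of_real pi * z))"

definition modulus_k :: "complex \<Rightarrow> complex" where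
  "modulus_k \<tau> = (theta2 0 \<tau>)\<^sup>2 / (theta3 0 \<tau>)\<^sup>2"

definition lambda_mod :: "complex \<Rightarrow> complex" where
  "lambda_mod \<tau> = (modulus_k \<tau>)\<^sup>2"

definition period_K :: "complex \<Rightarrow> complex" where
  "period_K \<tau> = of_real pi / 2 * (theta3 0 \<tau>)\<^sup>2"

(* sn2K z \<tau>, cn2K z \<tau>, ... stand for sn(2Kz, k), cn(2Kz, k), ... with K = period_K \<tau>
   and k = modulus_k \<tau>. *)
definition sn2K :: "complex \<Rightarrow> complex \<Rightarrow> complex" where
  "sn2K z \<tau> = theta3 0 \<tau> / theta2 0 \<tau> * (theta1 z \<tau> / theta4 z \<tau>)"

definition cn2K :: "complex \<Rightarrow> complex \<Rightarrow> complex" where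
  "cn2K z \<tau> = theta4 0 \<tau> / theta2 0 \<tau> * (theta2 z \<tau> / theta4 z \<tau>)"

definition dn2K :: "complex \<Rightarrow> complex \<Rightarrow> complex" where
  "dn2K z \<tau> = theta4 0 \<tau> / theta3 0 \<tau> * (theta3 z \<tau> / theta4 z \<tau>)"

(* The quotients cn/sn, dn/sn and 1/sn are quotients of meromorphic functions of z. The common
   poles of sn, cn and dn (the zeros of theta4, i.e. \<tau>/2 modulo the lattice) are removable
   singularities of the quotients. Pointwise HOL division would give 0 there, whereas cs and ds
   do not vanish at these points; hence remove_sings, which takes the limit. *)
definition cs2K :: "complex \<Rightarrow> complex \<Rightarrow> complex" where
  "cs2K z \<tau> = remove_sings (\<lambda>w. cn2K w \<tau> / sn2K w \<tau>) z"

definition ds2K :: "complex \<Rightarrow> complex \<Rightarrow> complex" where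
  "ds2K z \<tau> = remove_sings (\<lambda>w. dn2K w \<tau> / sn2K w \<tau>) z"

definition ns2K :: "complex \<Rightarrow> complex \<Rightarrow> complex" where
  "ns2K z \<tau> = remove_sings (\<lambda>w. 1 / sn2K w \<tau>) z"

(* The indices are read modulo 2; f and C with both indices even are left unspecified. *)
definition f_fun :: "nat \<Rightarrow> nat \<Rightarrow> complex \<Rightarrow> complex \<Rightarrow> complex" where
  "f_fun i j z \<tau> =
     (if odd i \<and> even j then 2 * period_K \<tau> * cs2K z \<tau>
      else if odd i \<and> odd j then 2 * period_K \<tau> * ds2K z \<tau>
      else if even i \<and> odd j then 2 * period_K \<tau> * ns2K z \<tau>
      else undefined)"

definition C_fun :: "nat \<Rightarrow> nat \<Rightarrow> complex \<Rightarrow> complex" where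
  "C_fun i j \<tau> =
     (if odd i \<and> even j then (- 1/3 + 1/6 * lambda_mod \<tau>) * (2 * period_K \<tau>)\<^sup>2
      else if odd i \<and> odd j then (1/6 - 1/3 * lambda_mod \<tau>) * (2 * period_K \<tau>)\<^sup>2
      else if even i \<and> odd j then (1/6 + 1/6 * lambda_mod \<tau>) * (2 * period_K \<tau>)\<^sup>2
      else undefined)"

end

theory Submission
  imports Defs "HOL-Real_Asymp.Real_Asymp"
begin

text \<open>
  The product \<open>F(z) = f_mn(b z) f_ij(a z) f_kl(z)\<close> with \<open>k = i a + m b\<close>, \<open>l = j a + n b\<close> is elliptic for the lattice
  spanned by \<open>1\<close> and \<open>\<tau>\<close>, with simple poles at the nonzero \<open>a\<close>- and \<open>b\<close>-division points and a triple pole at \<open>0\<close>.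
  The residues at the former are the terms of the two sums, and \<open>f(z) = 1/z + C z + O(z^3)\<close> gives the residue at \<open>0\<close>;
  the identity says that all residues add up to zero. Contour integrals are avoided: after subtracting a multiple of
  \<open>f_10 f_11 f_01\<close> (which cancels the triple pole without changing the residue, as \<open>C_10 + C_11 + C_01 = 0\<close>) and
  translates of the logarithmic derivative of \<open>\<theta>_1\<close>, an entire function remains and Liouville's theorem applies.
  The zeros of \<open>\<theta>_1\<close>, the nonvanishing of the theta constants and Jacobi's formula \<open>\<theta>_1' = \<pi> \<theta>_2 \<theta>_3 \<theta>_4\<close> all
  follow from Landen's transformation \<open>\<tau> \<mapsto> 2 \<tau>\<close>, iterated towards the cusp.
\<close>

subsection \<open>The theta series\<close>

text \<open>The signs explain the indices: \<open>f_ij\<close> is multiplied by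
  \<open>(-1)^j\<close> under translation by 1 and by \<open>(-1)^i\<close> under translation by
  \<tau>, so \<open>f_ij(a z) f_mn(b z)\<close> acquires the signs with exponents
  \<open>j a + n b = l\<close> and \<open>i a + m b = k\<close>. These are exactly the signs of
  \<open>f_kl\<close>, which makes the product of all three periodic; the parity hypothesis says
  that such an \<open>f_kl\<close> exists. Coprimality of \<open>a\<close> and \<open>b\<close>
  keeps the two families of division points apart except at 0 and keeps the other two factors finite
  at each nonzero one. The obstacle that shapes the argument: Liouville's theorem is applied to
  functions with \<open>(z - p) E(z)\<close> tending to 0 at every exceptional point, and
  logarithmic derivatives can only cancel simple poles. Hence the triple pole at 0 has to be removed
  separately, with a correction whose residue is known to be 0. Doubling works for the theta
  functions because every needed fact is either transported between \<tau> and
  \<open>2 \<tau>\<close> by an algebraic identity of series or is an invariant of doubling. Towards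
  the cusp only two terms of the series of \<open>theta1\<close> survive, so the limiting statement
  is elementary.\<close>

lemma range_int_Un: "(UNIV :: int set) = range int \<union> range (\<lambda>n. - 1 - int n)"
proof -
  have "x \<in> range int \<union> range (\<lambda>n. - 1 - int n)" for x :: int
  proof (cases "x \<ge> 0")
    case True
    then show ?thesis by (auto intro!: image_eqI[of _ _ "nat x"])
  next
    case False
    then show ?thesis by (auto intro!: image_eqI[of _ _ "nat (- 1 - x)"])
  qed
  then show ?thesis by blast
qed

lemma has_sum_int_split:
  fixes f :: "int \<Rightarrow> 'a :: real_normed_vector"
  assumes "((\<lambda>n. f (int n)) has_sum x) UNIV" "((\<lambda>n. f (- 1 - int n)) has_sum y) UNIV"
  shows "(f has_sum (x + y)) UNIV"
proof -
  have "(f has_sum x) (range int)"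
    using assms(1) by (subst has_sum_reindex) (auto simp: o_def inj_on_def)
  moreover have "(f has_sum y) (range (\<lambda>n. - 1 - int n))"
    using assms(2) by (subst has_sum_reindex) (auto simp: o_def inj_on_def)
  ultimately show ?thesis
    unfolding range_int_Un by (intro has_sum_Un_disjoint) auto
qed

lemma infsum_int_split:
  fixes f :: "int \<Rightarrow> 'a :: banach"
  assumes "(\<lambda>n. norm (f n)) summable_on UNIV"
  shows "summable (\<lambda>n. norm (f (int n)))" "summable (\<lambda>n. norm (f (- 1 - int n)))"
    "infsum f UNIV = (\<Sum>n. f (int n)) + (\<Sum>n. f (- 1 - int n))"
proof -
  have *: "((\<lambda>n. norm (f (h n))) summable_on UNIV)" if "inj h" for h :: "nat \<Rightarrow> int"
  proof -
    have "(\<lambda>n. norm (f n)) summable_on range h"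
      by (rule summable_on_subset_banach[OF assms]) auto
    then show ?thesis
      by (subst (asm) summable_on_reindex) (use that in \<open>auto simp: o_def\<close>)
  qed
  have 1: "(\<lambda>n. norm (f (int n))) summable_on UNIV"
    by (rule *) (auto simp: inj_on_def)
  have 2: "(\<lambda>n. norm (f (- 1 - int n))) summable_on UNIV"
    by (rule *) (auto simp: inj_on_def)
  show s1: "summable (\<lambda>n. norm (f (int n)))" and s2: "summable (\<lambda>n. norm (f (- 1 - int n)))"
    using 1 2 by (simp_all add: summable_on_imp_summable)
  have h1: "((\<lambda>n. f (int n)) has_sum (\<Sum>n. f (int n))) UNIV"
    using s1 by (intro norm_summable_imp_has_sum summable_sums summable_norm_cancel[OF s1])
  have h2: "((\<lambda>n. f (- 1 - int n)) has_sum (\<Sum>n. f (- 1 - int n))) UNIV"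
    using s2 by (intro norm_summable_imp_has_sum summable_sums summable_norm_cancel[OF s2])
  show "infsum f UNIV = (\<Sum>n. f (int n)) + (\<Sum>n. f (- 1 - int n))"
    by (rule infsumI[OF has_sum_int_split[OF h1 h2]])
qed

lemma summable_on_exp_abs: "(\<lambda>n::int. exp (- \<bar>real_of_int n\<bar>)) summable_on UNIV"
proof -
  have e: "exp (- real n) = exp (-1) ^ n" "exp (- (real n + 1)) = exp (-1) * exp (-1) ^ n" for n
    by (simp_all add: exp_of_nat_mult[symmetric] exp_add[symmetric])
  have s: "summable (\<lambda>n. exp (- real n))" "summable (\<lambda>n. exp (- (real n + 1)))"
    unfolding e by (intro summable_geometric summable_mult; simp)+
  have "((\<lambda>n. exp (- \<bar>real_of_int (int n)\<bar>)) has_sum (\<Sum>n. exp (- real n))) UNIV"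
    using s by (intro norm_summable_imp_has_sum) (auto simp: summable_sums)
  moreover have "((\<lambda>n. exp (- \<bar>real_of_int (- 1 - int n)\<bar>)) has_sum (\<Sum>n. exp (- (real n + 1)))) UNIV"
  proof -
    have "(\<lambda>n. exp (- \<bar>real_of_int (- 1 - int n)\<bar>)) = (\<lambda>n. exp (- (real n + 1)))" by (auto simp: abs_if)
    then show ?thesis
      using s by (simp only:, intro norm_summable_imp_has_sum) (auto simp: summable_sums)
  qed
  ultimately show ?thesis
    by (rule has_sum_imp_summable[OF has_sum_int_split])
qed

section \<open>The theta series as a sum over all integers, and its quasi-periodicity\<close>

definition jtheta_term :: "complex \<Rightarrow> complex \<Rightarrow> int \<Rightarrow> complex" where
  "jtheta_term \<tau> u n = exp (of_real pi * \<i> * (of_int n ^ 2 * \<tau> + 2 * of_int n * u))"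

text \<open>This is \<open>theta3\<close>. The other three theta functions are its translates by
  half periods up to exponential factors, so convergence, holomorphy and quasi-periodicity are
  proved once for all four.\<close>

definition jtheta :: "complex \<Rightarrow> complex \<Rightarrow> complex" where
  "jtheta \<tau> u = (\<Sum>\<^sub>\<infinity>n. jtheta_term \<tau> u n)"

lemma norm_jtheta_term: "norm (jtheta_term \<tau> u n) = exp (- pi * (of_int n ^ 2 * Im \<tau> + 2 * of_int n * Im u))"
proof -
  have "Re (of_real pi * \<i> * (of_int n ^ 2 * \<tau> + 2 * of_int n * u)) = - pi * (of_int n ^ 2 * Im \<tau> + 2 * of_int n * Im u)"
    by (simp flip: of_int_power)
  then show ?thesis by (simp only: jtheta_term_def norm_exp_eq_Re)
qed

lemma norm_jtheta_term_le:
  assumes "Im \<tau> > 0" "\<bar>Im u\<bar> \<le> B"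
  shows "norm (jtheta_term \<tau> u n) \<le> exp ((2 * pi * B + 1)\<^sup>2 / (4 * pi * Im \<tau>)) * exp (- \<bar>of_int n\<bar>)"
proof -
  \<comment> \<open>The summand 1 in \<open>d\<close> is reserved for the factor
    \<open>exp (- \<bar>n\<bar>)\<close>: the linear term of the exponent has coefficient at most
    \<open>2 * pi * B = d - 1\<close>. The rest is maximised by completing the square, which gives
    \<open>d^2 / (4 * t)\<close>.\<close>
  define x d t where "x = \<bar>real_of_int n\<bar>" and "d = 2 * pi * B + 1" and "t = pi * Im \<tau>"
  have t: "t > 0" using assms by (simp add: t_def)
  have "- (of_int n * Im u) \<le> \<bar>of_int n * Im u\<bar>" by simp
  also have "\<dots> \<le> x * B"
    unfolding abs_mult x_def using assms(2) by (intro mult_left_mono) auto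
  finally have "pi * (- (of_int n * Im u)) \<le> pi * (x * B)"
    by (rule mult_left_mono) simp
  then have 1: "- pi * (of_int n ^ 2 * Im \<tau> + 2 * of_int n * Im u) \<le> - t * x\<^sup>2 + (d - 1) * x"
    by (simp add: x_def d_def t_def algebra_simps)
  have "0 \<le> (2 * t * x - d)\<^sup>2" by simp
  then have "(4 * t) * (- t * x\<^sup>2 + d * x) \<le> d\<^sup>2"
    by (simp add: power2_eq_square algebra_simps)
  then have 2: "- t * x\<^sup>2 + d * x \<le> d\<^sup>2 / (4 * t)"
    using t by (simp add: pos_le_divide_eq mult.commute)
  have "- pi * (of_int n ^ 2 * Im \<tau> + 2 * of_int n * Im u) \<le> d\<^sup>2 / (4 * t) + - x"
    using 1 2 by (simp add: algebra_simps)
  then show ?thesis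
    unfolding norm_jtheta_term exp_add[symmetric] x_def d_def t_def by (simp add: mult.assoc)
qed

lemma summable_norm_jtheta_term:
  assumes "Im \<tau> > 0"
  shows "(\<lambda>n. norm (jtheta_term \<tau> u n)) summable_on UNIV"
  by (rule summable_on_comparison_test[OF summable_on_cmult_right[OF summable_on_exp_abs]])
     (use norm_jtheta_term_le[OF assms order.refl] in auto)

text \<open>On a closed unit disc the imaginary part stays bounded, so the majorant of the terms
  does not depend on the point and the Weierstrass test gives uniform convergence.\<close>

lemma holomorphic_jtheta [holomorphic_intros]:
  assumes "Im \<tau> > 0" "f holomorphic_on A"
  shows "(\<lambda>z. jtheta \<tau> (f z)) holomorphic_on A"
proof -
  have "jtheta \<tau> field_differentiable at u" for u
  proof -
    define B where "B = \<bar>Im u\<bar> + 1"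
    have "\<bar>Im w\<bar> \<le> B" if "w \<in> cball u 1" for w
    proof -
      have "\<bar>Im (u - w)\<bar> \<le> 1"
        using abs_Im_le_cmod[of "u - w"] that by (simp add: dist_norm)
      then show ?thesis by (simp add: B_def)
    qed
    then have lim: "uniform_limit (cball u 1) (\<lambda>X w. \<Sum>n\<in>X. jtheta_term \<tau> w n)
                 (\<lambda>w. \<Sum>\<^sub>\<infinity>n. jtheta_term \<tau> w n) (finite_subsets_at_top UNIV)"
      using norm_jtheta_term_le[OF assms(1)]
      by (intro Weierstrass_m_test_general[OF _ summable_on_cmult_right[OF summable_on_exp_abs]]) blast
    have "(\<lambda>w. \<Sum>\<^sub>\<infinity>n. jtheta_term \<tau> w n) holomorphic_on ball u 1"
    proof (rule holomorphic_uniform_limit[OF _ lim, THEN conjunct2])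
      show "\<forall>\<^sub>F X in finite_subsets_at_top UNIV. continuous_on (cball u 1) (\<lambda>w. \<Sum>n\<in>X. jtheta_term \<tau> w n) \<and>
              (\<lambda>w. \<Sum>n\<in>X. jtheta_term \<tau> w n) holomorphic_on ball u 1"
        unfolding jtheta_term_def
        by (intro always_eventually allI conjI continuous_intros holomorphic_intros)
    qed auto
    then show ?thesis
      unfolding jtheta_def[symmetric] by (rule holomorphic_on_imp_differentiable_at) auto
  qed
  then have "jtheta \<tau> holomorphic_on UNIV"
    by (simp add: holomorphic_on_def field_differentiable_at_within)
  then have "(jtheta \<tau> \<circ> f) holomorphic_on A"
    by (intro holomorphic_on_compose_gen[OF assms(2)]) auto
  then show ?thesis by (simp add: o_def)
qed

lemma jtheta_plus_1: "jtheta \<tau> (u + 1) = jtheta \<tau> u"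
proof -
  have "jtheta_term \<tau> (u + 1) n = jtheta_term \<tau> u n" for n
  proof -
    have "jtheta_term \<tau> (u + 1) n = jtheta_term \<tau> u n * exp (2 * of_int n * of_real pi * \<i>)"
      unfolding jtheta_term_def exp_add[symmetric] by (simp add: algebra_simps)
    also have "exp (2 * of_int n * of_real pi * \<i>) = 1"
      by (auto simp: exp_eq_1)
    finally show ?thesis by simp
  qed
  then show ?thesis by (simp add: jtheta_def)
qed

lemma jtheta_plus_tau: "jtheta \<tau> (u + \<tau>) = exp (- (of_real pi * \<i> * (\<tau> + 2 * u))) * jtheta \<tau> u"
proof -
  have "jtheta_term \<tau> (u + \<tau>) n = exp (- (of_real pi * \<i> * (\<tau> + 2 * u))) * jtheta_term \<tau> u (n + 1)" for n
    unfolding jtheta_term_def exp_add[symmetric] by (simp add: algebra_simps power2_eq_square)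
  then have "jtheta \<tau> (u + \<tau>) = exp (- (of_real pi * \<i> * (\<tau> + 2 * u))) * (\<Sum>\<^sub>\<infinity>n. jtheta_term \<tau> u (n + 1))"
    by (simp add: jtheta_def infsum_cmult_right')
  also have "(\<Sum>\<^sub>\<infinity>n. jtheta_term \<tau> u (n + 1)) = jtheta \<tau> u"
    unfolding jtheta_def
    by (rule infsum_reindex_bij_witness[where i = "\<lambda>n. n - 1" and j = "\<lambda>n. n + 1"]) auto
  finally show ?thesis .
qed

lemma jtheta_minus: "jtheta \<tau> (- u) = jtheta \<tau> u"
  unfolding jtheta_def
  by (rule infsum_reindex_bij_witness[where i = uminus and j = uminus]) (auto simp: jtheta_term_def)

text \<open>The point \<open>u = (1 + \<tau>) / 2\<close> is congruent to \<open>-u\<close> modulo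
  the periods. Evenness and quasi-periodicity then compare the value with itself, with multiplier
  -1.\<close>

lemma jtheta_zero: "jtheta \<tau> ((1 + \<tau>) / 2) = 0"
proof -
  define u where "u = (1 + \<tau>) / 2"
  have "jtheta \<tau> u = jtheta \<tau> ((- u + 1) + \<tau>)" by (simp add: u_def field_simps)
  also have "\<dots> = exp (- (of_real pi * \<i> * (\<tau> + 2 * (- u + 1)))) * jtheta \<tau> u"
    by (simp only: jtheta_plus_tau jtheta_plus_1 jtheta_minus)
  also have "\<tau> + 2 * (- u + 1) = 1" by (simp add: u_def field_simps)
  also have "exp (- (of_real pi * \<i> * 1)) = -1" by (simp add: exp_minus)
  finally show ?thesis by (simp add: u_def)
qed

section \<open>Products of two theta series\<close>

lemma infsum_product:
  fixes f :: "'a \<Rightarrow> 'c :: {real_normed_field, banach}"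
  assumes "(\<lambda>x. norm (f x)) summable_on A" "(\<lambda>y. norm (g y)) summable_on B"
  shows "(\<lambda>p. f (fst p) * g (snd p)) summable_on (A \<times> B)"
    "infsum f A * infsum g B = (\<Sum>\<^sub>\<infinity>p\<in>A \<times> B. f (fst p) * g (snd p))"
proof -
  have "(\<lambda>p. norm (f (fst p) * g (snd p))) summable_on (A \<times> B)"
  proof (rule Infinite_Sum.abs_summable_on_Sigma_iff[THEN iffD2], intro conjI ballI)
    show "(\<lambda>y. norm (f (fst (x, y)) * g (snd (x, y)))) summable_on B" for x
      using summable_on_cmult_right[OF assms(2)] by (simp add: norm_mult)
    show "(\<lambda>x. norm (\<Sum>\<^sub>\<infinity>y\<in>B. norm (f (fst (x, y)) * g (snd (x, y))))) summable_on A"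
      using summable_on_cmult_left[OF assms(1)]
      by (simp add: norm_mult infsum_cmult_right' infsum_nonneg)
  qed
  then show s: "(\<lambda>p. f (fst p) * g (snd p)) summable_on (A \<times> B)"
    by (rule abs_summable_summable)
  show "infsum f A * infsum g B = (\<Sum>\<^sub>\<infinity>p\<in>A \<times> B. f (fst p) * g (snd p))"
    by (subst infsum_Sigma_banach[OF s, symmetric])
       (simp add: infsum_cmult_right' infsum_cmult_left')
qed

text \<open>Substitute \<open>(m, n) = (r + s, r - s)\<close> or \<open>(r + s + 1, r - s)\<close> according to the parity of \<open>m + n\<close>.\<close>

lemma jtheta_mult:
  assumes "Im \<tau> > 0"
  shows "jtheta \<tau> u * jtheta \<tau> v = jtheta (2 * \<tau>) (u + v) * jtheta (2 * \<tau>) (u - v)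
     + exp (of_real pi * \<i> * (\<tau> + 2 * u)) * (jtheta (2 * \<tau>) (u + v + \<tau>) * jtheta (2 * \<tau>) (u - v + \<tau>))"
proof -
  define g where "g = (\<lambda>p. jtheta_term \<tau> u (fst p) * jtheta_term \<tau> v (snd p))"
  define E where "E = {p :: int \<times> int. even (fst p + snd p)}"
  define D where "D = {p :: int \<times> int. odd (fst p + snd p)}"
  have t2: "Im (2 * \<tau>) > 0" using assms by simp
  have s: "g summable_on UNIV"
    using infsum_product(1)[OF summable_norm_jtheta_term summable_norm_jtheta_term, OF assms assms]
    by (simp add: g_def)
  have "jtheta \<tau> u * jtheta \<tau> v = infsum g UNIV"
    unfolding jtheta_def g_def
    by (subst infsum_product(2)) (use assms summable_norm_jtheta_term in auto)
  also have "UNIV = E \<union> D" by (auto simp: E_def D_def)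
  also have "infsum g (E \<union> D) = infsum g E + infsum g D"
    by (rule infsum_Un_disjoint) (auto intro: summable_on_subset_banach[OF s] simp: E_def D_def)
  also have "infsum g E = (\<Sum>\<^sub>\<infinity>p. jtheta_term (2 * \<tau>) (u + v) (fst p) * jtheta_term (2 * \<tau>) (u - v) (snd p))"
  proof (rule sym, rule infsum_reindex_bij_witness[where i = "\<lambda>p. ((fst p + snd p) div 2, (fst p - snd p) div 2)"
          and j = "\<lambda>p. (fst p + snd p, fst p - snd p)"])
    show "(fst ((fst p + snd p) div 2, (fst p - snd p) div 2) + snd ((fst p + snd p) div 2, (fst p - snd p) div 2),
          fst ((fst p + snd p) div 2, (fst p - snd p) div 2) - snd ((fst p + snd p) div 2, (fst p - snd p) div 2)) = p"
      if "p \<in> E" for p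
      using that unfolding E_def by (cases p) (simp, presburger)
  qed (auto simp: E_def g_def jtheta_term_def exp_add[symmetric] algebra_simps power2_eq_square)
  also have "\<dots> = jtheta (2 * \<tau>) (u + v) * jtheta (2 * \<tau>) (u - v)"
    unfolding jtheta_def by (subst infsum_product(2)) (use summable_norm_jtheta_term[OF t2] in auto)
  also have "infsum g D = (\<Sum>\<^sub>\<infinity>p. exp (of_real pi * \<i> * (\<tau> + 2 * u)) *
       (jtheta_term (2 * \<tau>) (u + v + \<tau>) (fst p) * jtheta_term (2 * \<tau>) (u - v + \<tau>) (snd p)))"
  proof (rule sym, rule infsum_reindex_bij_witness[where i = "\<lambda>p. ((fst p + snd p - 1) div 2, (fst p - snd p - 1) div 2)"
          and j = "\<lambda>p. (fst p + snd p + 1, fst p - snd p)"])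
    show "(fst ((fst p + snd p - 1) div 2, (fst p - snd p - 1) div 2) + snd ((fst p + snd p - 1) div 2, (fst p - snd p - 1) div 2) + 1,
          fst ((fst p + snd p - 1) div 2, (fst p - snd p - 1) div 2) - snd ((fst p + snd p - 1) div 2, (fst p - snd p - 1) div 2)) = p"
      if "p \<in> D" for p
      using that unfolding D_def by (cases p) (simp, presburger)
  qed (auto simp: D_def g_def jtheta_term_def exp_add[symmetric] algebra_simps power2_eq_square)
  also have "\<dots> = exp (of_real pi * \<i> * (\<tau> + 2 * u)) * (jtheta (2 * \<tau>) (u + v + \<tau>) * jtheta (2 * \<tau>) (u - v + \<tau>))"
    unfolding jtheta_def infsum_cmult_right'
    by (subst infsum_product(2)) (use summable_norm_jtheta_term[OF t2] in auto)
  finally show ?thesis .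
qed

section \<open>Comparison with the four Jacobi theta functions\<close>

lemma exp_pi_i_of_nat: "exp (of_real pi * \<i> * of_nat n) = (-1) ^ n"
  by (metis exp_of_nat2_mult exp_pi_i)

text \<open>Two ways to fold the sum over the integers. Pairing \<open>n\<close> with
  \<open>-1 - n\<close> is the symmetry of \<open>(n + 1/2)^2\<close> and produces the series of
  \<open>theta1\<close> and \<open>theta2\<close>; splitting off \<open>n = 0\<close> and pairing
  \<open>n + 1\<close> with \<open>-(n + 1)\<close> produces those of \<open>theta3\<close> and
  \<open>theta4\<close>.\<close>

lemma jtheta_sums:
  assumes "Im \<tau> > 0"
  shows "(\<lambda>n. jtheta_term \<tau> u (int n) + jtheta_term \<tau> u (- 1 - int n)) sums jtheta \<tau> u"
    and "(\<lambda>n. jtheta_term \<tau> u (int (Suc n)) + jtheta_term \<tau> u (- 1 - int n)) sums (jtheta \<tau> u - 1)"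
proof -
  note s = infsum_int_split[OF summable_norm_jtheta_term[OF assms, of u]]
  have s1: "(\<lambda>n. jtheta_term \<tau> u (int n)) sums (\<Sum>n. jtheta_term \<tau> u (int n))"
    and s2: "(\<lambda>n. jtheta_term \<tau> u (- 1 - int n)) sums (\<Sum>n. jtheta_term \<tau> u (- 1 - int n))"
    using s(1,2) by (simp_all add: summable_sums summable_norm_cancel)
  show "(\<lambda>n. jtheta_term \<tau> u (int n) + jtheta_term \<tau> u (- 1 - int n)) sums jtheta \<tau> u"
    unfolding jtheta_def s(3) by (rule sums_add[OF s1 s2])
  have "(\<lambda>n. jtheta_term \<tau> u (int (Suc n))) sums ((\<Sum>n. jtheta_term \<tau> u (int n)) - 1)"
    using s1 by (subst sums_Suc_iff) (simp add: jtheta_term_def)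
  from sums_add[OF this s2]
  show "(\<lambda>n. jtheta_term \<tau> u (int (Suc n)) + jtheta_term \<tau> u (- 1 - int n)) sums (jtheta \<tau> u - 1)"
    unfolding jtheta_def s(3) by (simp add: algebra_simps)
qed

lemma suminf_eq_of_sums_mult:
  fixes c :: "'a :: real_normed_field"
  assumes "(\<lambda>n. c * f n) sums x" "c \<noteq> 0"
  shows "suminf f = x / c"
  using sums_mult[OF assms(1), of "inverse c"] assms(2)
  by (simp add: sums_iff field_simps)

lemma theta3_eq_jtheta:
  assumes "Im \<tau> > 0"
  shows "theta3 z \<tau> = jtheta \<tau> z"
proof -
  have "jtheta_term \<tau> z (int (Suc n)) + jtheta_term \<tau> z (- 1 - int n) =
     2 * (qpow \<tau> (1/2 * (real (Suc n))\<^sup>2) * cos (of_nat (2 * Suc n) * of_real pi * z))" for n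
    by (simp add: jtheta_term_def qpow_def cos_exp_eq exp_add[symmetric] algebra_simps power2_eq_square)
  with jtheta_sums(2)[OF assms, of z]
  have "(\<lambda>n. 2 * (qpow \<tau> (1/2 * (real (Suc n))\<^sup>2) * cos (of_nat (2 * Suc n) * of_real pi * z))) sums (jtheta \<tau> z - 1)"
    by (simp only:)
  then show ?thesis
    unfolding theta3_def by (subst suminf_eq_of_sums_mult) (auto simp: field_simps)
qed

lemma theta4_eq_jtheta:
  assumes "Im \<tau> > 0"
  shows "theta4 z \<tau> = jtheta \<tau> (z + 1/2)"
proof -
  have e: "exp (of_real pi * \<i> * of_nat (Suc n)) = (-1) ^ Suc n"
    "exp (- (of_real pi * \<i> * of_nat (Suc n))) = (-1) ^ Suc n" for n
    by (simp_all only: exp_pi_i_of_nat exp_minus) (simp add: power_inverse [symmetric])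
  have "jtheta_term \<tau> (z + 1/2) (int (Suc n)) + jtheta_term \<tau> (z + 1/2) (- 1 - int n) =
     2 * ((-1) ^ Suc n * qpow \<tau> (1/2 * (real (Suc n))\<^sup>2) * cos (of_nat (2 * Suc n) * of_real pi * z))" for n
  proof -
    have 1: "jtheta_term \<tau> (z + 1/2) (int (Suc n)) = exp (of_real pi * \<i> * of_nat (Suc n)) * jtheta_term \<tau> z (int (Suc n))"
      by (simp add: jtheta_term_def exp_add[symmetric] algebra_simps)
    have 2: "jtheta_term \<tau> (z + 1/2) (- 1 - int n) = exp (- (of_real pi * \<i> * of_nat (Suc n))) * jtheta_term \<tau> z (- 1 - int n)"
      unfolding jtheta_term_def exp_add[symmetric] by (simp add: algebra_simps)
    have 3: "jtheta_term \<tau> z (int (Suc n)) + jtheta_term \<tau> z (- 1 - int n) =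
       2 * (qpow \<tau> (1/2 * (real (Suc n))\<^sup>2) * cos (of_nat (2 * Suc n) * of_real pi * z))"
      by (simp add: jtheta_term_def qpow_def cos_exp_eq exp_add[symmetric] algebra_simps power2_eq_square)
    show ?thesis
      unfolding 1 2 e distrib_left[symmetric] 3 by (simp add: algebra_simps)
  qed
  with jtheta_sums(2)[OF assms, of "z + 1/2"]
  have "(\<lambda>n. 2 * ((-1) ^ Suc n * qpow \<tau> (1/2 * (real (Suc n))\<^sup>2) * cos (of_nat (2 * Suc n) * of_real pi * z)))
     sums (jtheta \<tau> (z + 1/2) - 1)"
    by (simp only:)
  then show ?thesis
    unfolding theta4_def by (subst suminf_eq_of_sums_mult) (auto simp: field_simps)
qed

lemma theta2_eq_jtheta:
  assumes "Im \<tau> > 0"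
  shows "theta2 z \<tau> = exp (of_real pi * \<i> * (\<tau> / 4 + z)) * jtheta \<tau> (z + \<tau> / 2)"
proof -
  have "exp (of_real pi * \<i> * (\<tau> / 4 + z)) * (jtheta_term \<tau> (z + \<tau> / 2) (int n) + jtheta_term \<tau> (z + \<tau> / 2) (- 1 - int n)) =
     2 * (qpow \<tau> (1/2 * (real n + 1/2)\<^sup>2) * cos (of_nat (2 * n + 1) * of_real pi * z))" for n
  proof -
    define \<sigma> where "\<sigma> = \<tau> / 4"
    have \<tau>: "\<tau> = 4 * \<sigma>" by (simp add: \<sigma>_def)
    show ?thesis unfolding \<tau>
      by (simp add: jtheta_term_def qpow_def cos_exp_eq distrib_left exp_add[symmetric])
         (simp add: algebra_simps power2_eq_square)
  qed
  with sums_mult[OF jtheta_sums(1)[OF assms, of "z + \<tau> / 2"], of "exp (of_real pi * \<i> * (\<tau> / 4 + z))"]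
  have "(\<lambda>n. 2 * (qpow \<tau> (1/2 * (real n + 1/2)\<^sup>2) * cos (of_nat (2 * n + 1) * of_real pi * z)))
     sums (exp (of_real pi * \<i> * (\<tau> / 4 + z)) * jtheta \<tau> (z + \<tau> / 2))"
    by (simp only:)
  then show ?thesis
    unfolding theta2_def by (subst suminf_eq_of_sums_mult) auto
qed

text \<open>\<open>theta1\<close> without its exponential factor.\<close>

definition jsigma :: "complex \<Rightarrow> complex \<Rightarrow> complex" where
  "jsigma \<tau> z = jtheta \<tau> (z + (1 + \<tau>) / 2)"

lemma theta1_eq_jsigma:
  assumes "Im \<tau> > 0"
  shows "theta1 z \<tau> = - \<i> * exp (of_real pi * \<i> * (\<tau> / 4 + z)) * jsigma \<tau> z"
proof -
  have e: "exp (of_real pi * \<i> * of_nat n) = (-1) ^ n"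
    "exp (- (of_real pi * \<i> * of_nat n)) = (-1) ^ n" for n
    by (simp_all only: exp_pi_i_of_nat exp_minus) (simp add: power_inverse [symmetric])
  have "exp (of_real pi * \<i> * (\<tau> / 4 + z)) * (jtheta_term \<tau> (z + (1 + \<tau>) / 2) (int n) + jtheta_term \<tau> (z + (1 + \<tau>) / 2) (- 1 - int n)) =
     2 * \<i> * ((-1) ^ n * qpow \<tau> (1/2 * (real n + 1/2)\<^sup>2) * sin (of_nat (2 * n + 1) * of_real pi * z))" for n
  proof -
    define \<sigma> where "\<sigma> = \<tau> / 4"
    have \<tau>: "\<tau> = 4 * \<sigma>" "(1 + 4 * \<sigma>) / 2 = 1/2 + 2 * \<sigma>" by (simp_all add: \<sigma>_def)
    have 1: "exp (of_real pi * \<i> * (\<tau> / 4 + z)) * jtheta_term \<tau> (z + (1 + \<tau>) / 2) (int n) =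
       exp (of_real pi * \<i> * of_nat n) * exp (of_real pi * \<i> * ((of_nat n + 1/2)\<^sup>2 * \<tau> + of_nat (2 * n + 1) * z))"
      unfolding jtheta_term_def exp_add[symmetric] \<tau> by (simp add: algebra_simps power2_eq_square)
    have 2: "exp (of_real pi * \<i> * (\<tau> / 4 + z)) * jtheta_term \<tau> (z + (1 + \<tau>) / 2) (- 1 - int n) =
       exp (- (of_real pi * \<i>)) * exp (- (of_real pi * \<i> * of_nat n)) * exp (of_real pi * \<i> * ((of_nat n + 1/2)\<^sup>2 * \<tau> - of_nat (2 * n + 1) * z))"
      unfolding jtheta_term_def exp_add[symmetric] \<tau> by (simp add: algebra_simps power2_eq_square)
    have 3: "exp (of_real pi * \<i> * ((of_nat n + 1/2)\<^sup>2 * \<tau> + of_nat (2 * n + 1) * z)) -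
        exp (of_real pi * \<i> * ((of_nat n + 1/2)\<^sup>2 * \<tau> - of_nat (2 * n + 1) * z)) =
        2 * \<i> * (qpow \<tau> (1/2 * (real n + 1/2)\<^sup>2) * sin (of_nat (2 * n + 1) * of_real pi * z))"
    proof -
      have s: "2 * \<i> * (E * sin x) = E * exp (\<i> * x) - E * exp (- (\<i> * x))" for E x
        by (simp add: sin_exp_eq field_simps)
      show ?thesis
        unfolding s qpow_def exp_add[symmetric] \<tau> by (simp add: algebra_simps power2_eq_square)
    qed
    have m: "exp (- (of_real pi * \<i>)) = - 1" by (simp add: exp_minus)
    have "c * (x + y) = p * s" if "c * x = p * d" "c * y = - 1 * p * d'" "d - d' = s" for c x y p d d' s :: complex
      using that by (metis (no_types) mult_minus1 mult_minus_left right_diff_distrib distrib_left uminus_add_conv_diff add.commute)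
    from this[OF 1[unfolded e] 2[unfolded e m] 3] show ?thesis
      by (simp only: mult_ac)
  qed
  with sums_mult[OF jtheta_sums(1)[OF assms, of "z + (1 + \<tau>) / 2"], of "exp (of_real pi * \<i> * (\<tau> / 4 + z))"]
  have "(\<lambda>n. 2 * \<i> * ((-1) ^ n * qpow \<tau> (1/2 * (real n + 1/2)\<^sup>2) * sin (of_nat (2 * n + 1) * of_real pi * z)))
     sums (exp (of_real pi * \<i> * (\<tau> / 4 + z)) * jsigma \<tau> z)"
    by (simp only: jsigma_def)
  then have "(\<Sum>n. (-1) ^ n * qpow \<tau> (1/2 * (real n + 1/2)\<^sup>2) * sin (of_nat (2 * n + 1) * of_real pi * z)) =
     exp (of_real pi * \<i> * (\<tau> / 4 + z)) * jsigma \<tau> z / (2 * \<i>)"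
    by (rule suminf_eq_of_sums_mult) simp
  then show ?thesis
    unfolding theta1_def by simp
qed

lemma jsigma_0 [simp]: "jsigma \<tau> 0 = 0"
  using jtheta_zero[of \<tau>] by (simp add: jsigma_def)

text \<open>Classically \<open>theta3 theta4 = theta4^2\<close> at argument 0, with \<tau> on the
  left and \<open>2 \<tau>\<close> on the right. In the product formula for 0 and 1/2 the second
  summand drops out, as \<open>1/2 + \<tau>\<close> is the known zero of
  \<open>jtheta (2 * \<tau>)\<close>.\<close>

lemma jtheta_landen_34:
  assumes "Im \<tau> > 0"
  shows "jtheta \<tau> 0 * jtheta \<tau> (1/2) = jtheta (2 * \<tau>) (1/2) ^ 2"
proof -
  have "jtheta (2 * \<tau>) (1/2 + \<tau>) = 0"
    using jtheta_zero[of "2 * \<tau>"] by (simp add: add_divide_distrib)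
  then show ?thesis
    using jtheta_mult[OF assms, of 0 "1/2"] jtheta_minus[of "2 * \<tau>" "1/2"] by (simp add: power2_eq_square)
qed

text \<open>Classically \<open>theta2^2 = 2 theta2 theta3\<close> at argument 0, again from \<tau>
  to \<open>2 \<tau>\<close>. For \<open>u = v = \<tau> / 2\<close> the two summands of the product
  formula coincide by quasi-periodicity, whence the factor 2.\<close>

lemma jtheta_landen_2:
  assumes "Im \<tau> > 0"
  shows "jtheta \<tau> (\<tau> / 2) ^ 2 = 2 * jtheta (2 * \<tau>) \<tau> * jtheta (2 * \<tau>) 0"
proof -
  have "exp (of_real pi * \<i> * (\<tau> + 2 * (\<tau> / 2))) * jtheta (2 * \<tau>) (\<tau> + \<tau>) = jtheta (2 * \<tau>) 0"
    using jtheta_plus_tau[of "2 * \<tau>" 0] by (simp add: exp_minus flip: mult_2)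
  then show ?thesis
    using jtheta_mult[OF assms, of "\<tau> / 2" "\<tau> / 2"]
    by (simp add: power2_eq_square algebra_simps) 
qed

text \<open>Up to exponential factors, \<open>theta1(z) theta2(z)\<close> for \<tau> is a constant
  times \<open>theta1(2 z)\<close> for \<open>2 \<tau>\<close>. This single identity moves zeros of
  \<open>theta1\<close> towards the cusp and, differentiated at 0, yields the doubling rule for the
  derivative.\<close>

lemma jsigma_landen:
  assumes "Im \<tau> > 0"
  shows "jsigma \<tau> z * jtheta \<tau> (z + \<tau> / 2) = jtheta (2 * \<tau>) (1/2) * jsigma (2 * \<tau>) (2 * z)"
proof -
  have "jtheta (2 * \<tau>) (1/2 + \<tau>) = 0"
    using jtheta_zero[of "2 * \<tau>"] by (simp add: add_divide_distrib)
  moreover have "(z + (1 + \<tau>) / 2) + (z + \<tau> / 2) = 2 * z + (1 + 2 * \<tau>) / 2"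
    "(z + (1 + \<tau>) / 2) - (z + \<tau> / 2) = 1 / 2"
    by (simp_all add: field_simps)
  ultimately show ?thesis
    using jtheta_mult[OF assms, of "z + (1 + \<tau>) / 2" "z + \<tau> / 2"] unfolding jsigma_def by (simp only: mult_zero_left mult_zero_right add_0_right mult.commute)
qed

subsection \<open>Theta constants, zeros and Jacobi's derivative formula\<close>

text \<open>This is \<open>2 s / (1 - s)\<close> with \<open>s = \<bar>q\<bar> powr (1/4)\<close>.\<close>

definition nome_bound :: "complex \<Rightarrow> real" where
  "nome_bound \<tau> = 2 * (exp (- pi * Im \<tau> / 2) / (1 - exp (- pi * Im \<tau> / 2)))"

text \<open>The terms with index 0 and -1 add up to
  \<open>1 - exp (- 2 * of_real pi * \<i> * z)\<close>; all others are dominated by two geometric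
  series. The lower edge of the strip reaches the half periods and the reduced zeros; the upper edge
  leaves room for a circle around 0, as required by a Cauchy estimate.\<close>

lemma norm_jsigma_diff_le:
  assumes "Im \<tau> > 0" "- Im \<tau> / 2 \<le> Im z" "Im z \<le> Im \<tau> / 4"
  shows "norm (jsigma \<tau> z - (1 - exp (- 2 * of_real pi * \<i> * z))) \<le> nome_bound \<tau>"
proof -
  define t y s where "t = Im \<tau>" and "y = Im z" and "s = exp (- pi * Im \<tau> / 2)"
  define T where "T = jtheta_term \<tau> (z + (1 + \<tau>) / 2)"
  have t: "t > 0" "- t / 2 \<le> y" "y \<le> t / 4" using assms by (simp_all add: t_def y_def)
  have s: "0 < s" "s < 1" using assms by (simp_all add: s_def)
  have sn: "s ^ n = exp (- pi * (real n * t / 2))" for n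
    by (simp add: s_def t_def exp_of_nat_mult[symmetric])
  have nT: "norm (T n) = exp (- pi * (of_int n ^ 2 * t + of_int n * t + 2 * of_int n * y))" for n
    by (simp add: T_def norm_jtheta_term t_def y_def algebra_simps)
  \<comment> \<open>The worst case is the lower edge \<open>y = - t / 2\<close>, where the linear
    terms of the exponent cancel and \<open>x^2 * t\<close> remains.\<close>
  have 1: "norm (T (int (Suc n))) \<le> s ^ Suc n" for n
  proof -
    define x where "x = real (Suc n)"
    have x: "x \<ge> 1" by (simp add: x_def)
    have "x * (- t / 2) \<le> x * y" using t x by (intro mult_left_mono) auto
    moreover have "x * t / 2 \<le> x * x * t"
    proof -
      have "x * 1 \<le> x * x" using x by (intro mult_left_mono) auto
      then have "x * t \<le> x * x * t" using t by (intro mult_right_mono) auto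
      moreover have "x * t > 0" using x t by simp
      ultimately show ?thesis by linarith
    qed
    ultimately have "x * t / 2 \<le> x\<^sup>2 * t + x * t + 2 * x * y" by (simp add: power2_eq_square algebra_simps)
    then show ?thesis unfolding nT sn by (simp add: x_def mult_left_mono)
  qed
  \<comment> \<open>The index is \<open>-(x + 1)\<close> with \<open>x = Suc n\<close>, since -1
    belongs to the main term. The worst case is the upper edge \<open>y = t / 4\<close>.\<close>
  have 2: "norm (T (- 1 - int (Suc n))) \<le> s ^ Suc n" for n
  proof -
    define x where "x = real (Suc n)"
    have x: "x \<ge> 1" by (simp add: x_def)
    have "(x + 1) * y \<le> (x + 1) * (t / 4)" using t x by (intro mult_left_mono) auto
    moreover have "x * t / 2 \<le> (x + 1) * x * t - (x + 1) * t / 2"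
    proof -
      have "x * 1 \<le> x * x" using x by (intro mult_left_mono) auto
      then have "1 * t \<le> x * x * t" using t x mult_mono[OF x x] by (intro mult_right_mono) auto
      moreover have "(x + 1) * x * t - (x + 1) * t / 2 = x * t / 2 + (x * x * t - t / 2)"
        by (simp add: field_simps)
      ultimately show ?thesis using t by linarith
    qed
    moreover have "(- 1 - x)\<^sup>2 * t + (- 1 - x) * t + 2 * (- 1 - x) * y = (x + 1) * x * t - 2 * ((x + 1) * y)"
      by (simp add: power2_eq_square algebra_simps)
    moreover have "2 * ((x + 1) * (t / 4)) = (x + 1) * t / 2" by simp
    ultimately have "x * t / 2 \<le> (- 1 - x)\<^sup>2 * t + (- 1 - x) * t + 2 * (- 1 - x) * y"
      by linarith
    then show ?thesis unfolding nT sn by (simp add: x_def mult_left_mono)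
  qed
  note sp = infsum_int_split[OF summable_norm_jtheta_term[OF assms(1), of "z + (1 + \<tau>) / 2"], folded T_def]
  have s1: "summable (\<lambda>n. T (int n))" and s2: "summable (\<lambda>n. T (- 1 - int n))"
    using sp(1,2) by (simp_all add: summable_norm_cancel)
  have "jsigma \<tau> z = (\<Sum>n. T (int n)) + (\<Sum>n. T (- 1 - int n))"
    unfolding jsigma_def jtheta_def T_def[symmetric] by (rule sp(3))
  also have "\<dots> = (T 0 + T (- 1)) + (\<Sum>n. T (int (Suc n))) + (\<Sum>n. T (- 1 - int (Suc n)))"
    by (simp only: suminf_split_head[OF s1] suminf_split_head[OF s2] of_nat_0 diff_zero) simp
  also have "T 0 + T (- 1) = 1 - exp (- 2 * of_real pi * \<i> * z)"
  proof -
    have "of_real pi * \<i> * (of_int (- 1) ^ 2 * \<tau> + 2 * of_int (- 1) * (z + (1 + \<tau>) / 2)) =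
       - 2 * of_real pi * \<i> * z + - (of_real pi * \<i>)"
      by (simp add: field_simps)
    then have "T (- 1) = exp (- 2 * of_real pi * \<i> * z) * exp (- (of_real pi * \<i>))"
      unfolding T_def jtheta_term_def by (simp only: exp_add)
    also have "exp (- (of_real pi * \<i>)) = - 1" by (simp add: exp_minus)
    finally show ?thesis by (simp add: T_def jtheta_term_def)
  qed
  finally have "norm (jsigma \<tau> z - (1 - exp (- 2 * of_real pi * \<i> * z))) =
      norm ((\<Sum>n. T (int (Suc n))) + (\<Sum>n. T (- 1 - int (Suc n))))"
    by (simp only: add.assoc add_diff_cancel_left')
  also have "\<dots> \<le> norm (\<Sum>n. T (int (Suc n))) + norm (\<Sum>n. T (- 1 - int (Suc n)))"
    by (rule norm_triangle_ineq)
  also have "\<dots> \<le> (\<Sum>n. s ^ Suc n) + (\<Sum>n. s ^ Suc n)"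
    using s by (intro add_mono norm_suminf_le 1 2) (auto intro!: summable_mult summable_geometric)
  also have "(\<Sum>n. s ^ Suc n) = s / (1 - s)"
    using s by (simp add: suminf_mult summable_geometric suminf_geometric)
  finally show ?thesis by (simp add: nome_bound_def s_def)
qed

lemma Im_two_power_mult [simp]: "Im (2 ^ N * \<tau>) = 2 ^ N * Im \<tau>"
proof -
  have "2 ^ N * \<tau> = of_real (2 ^ N) * \<tau>" by simp
  then show ?thesis by (simp del: of_real_power)
qed

lemma nome_bound_tendsto_0:
  assumes "Im \<tau> > 0"
  shows "(\<lambda>N. nome_bound (2 ^ N * \<tau>)) \<longlonglongrightarrow> 0"
proof -
  define c where "c = pi * Im \<tau> / 2"
  have c: "c > 0" using assms by (simp add: c_def)
  have "(\<lambda>N. 2 * (exp (- c * 2 ^ N) / (1 - exp (- c * 2 ^ N)))) \<longlonglongrightarrow> 0"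
    using c by real_asymp
  then show ?thesis
    by (simp add: nome_bound_def c_def field_simps)
qed

lemma jsigma_diff_tendsto_0:
  assumes "Im \<tau> > 0" "\<forall>\<^sub>F N in sequentially. - (2 ^ N * Im \<tau>) / 2 \<le> Im (z N) \<and> Im (z N) \<le> 2 ^ N * Im \<tau> / 4"
  shows "(\<lambda>N. jsigma (2 ^ N * \<tau>) (z N) - (1 - exp (- 2 * of_real pi * \<i> * z N))) \<longlonglongrightarrow> 0"
proof (rule Lim_null_comparison[OF _ nome_bound_tendsto_0[OF assms(1)]])
  show "\<forall>\<^sub>F N in sequentially. norm (jsigma (2 ^ N * \<tau>) (z N) - (1 - exp (- 2 * of_real pi * \<i> * z N))) \<le> nome_bound (2 ^ N * \<tau>)"
    using assms(2) by eventually_elim (rule norm_jsigma_diff_le, use assms(1) in auto)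
qed

lemma exp_i_tau_tendsto_0:
  assumes "Im \<tau> > 0"
  shows "(\<lambda>N. exp (of_real pi * \<i> * (2 ^ N * \<tau>))) \<longlonglongrightarrow> 0"
proof (rule tendsto_norm_zero_cancel)
  have "(\<lambda>N. exp (- pi * (2 ^ N * Im \<tau>))) \<longlonglongrightarrow> 0"
    using assms by real_asymp
  moreover have "norm (exp (of_real pi * \<i> * (2 ^ N * \<tau>))) = exp (- pi * (2 ^ N * Im \<tau>))" for N
    by (subst norm_exp_eq_Re) (simp add: mult.assoc del: of_real_power)
  ultimately show "(\<lambda>N. norm (exp (of_real pi * \<i> * (2 ^ N * \<tau>)))) \<longlonglongrightarrow> 0"
    by simp
qed

text \<open>The three constants are values of \<open>jsigma\<close> at the negative half periods,
  which lie in the strip of the estimate; the main term there is \<open>1 + x\<close>,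
  \<open>1 - x\<close> and 2 with \<open>x = exp (of_real pi * \<i> * \<tau>)\<close>. The third
  limit is nonzero because \<open>jtheta \<tau> (\<tau> / 2)\<close> lacks the exponential factor of
  \<open>theta2\<close> that decays at the cusp.\<close>

lemma jtheta_null_tendsto:
  assumes "Im \<tau> > 0"
  shows "(\<lambda>N. jtheta (2 ^ N * \<tau>) 0) \<longlonglongrightarrow> 1"
    and "(\<lambda>N. jtheta (2 ^ N * \<tau>) (1/2)) \<longlonglongrightarrow> 1"
    and "(\<lambda>N. jtheta (2 ^ N * \<tau>) (2 ^ N * \<tau> / 2)) \<longlonglongrightarrow> 2"
proof -
  have e1: "exp (- 2 * of_real pi * \<i> * (- (1 + x) / 2)) = - exp (of_real pi * \<i> * x)" for x
  proof -
    have "- 2 * of_real pi * \<i> * (- (1 + x) / 2) = of_real pi * \<i> + of_real pi * \<i> * x"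
      by (simp add: field_simps)
    then show ?thesis by (simp add: exp_add)
  qed
  have e2: "exp (- 2 * of_real pi * \<i> * (- x / 2)) = exp (of_real pi * \<i> * x)" for x
    by (simp add: mult.assoc)
  have e3: "exp (- 2 * of_real pi * \<i> * (- 1 / 2)) = - 1"
    by (simp add: e2)
  have lim: "f \<longlonglongrightarrow> l" if "(\<lambda>N. f N - (1 - g N)) \<longlonglongrightarrow> 0" "(\<lambda>N. 1 - g N) \<longlonglongrightarrow> l" for f g :: "nat \<Rightarrow> complex" and l
    using tendsto_add[OF that] by simp
  have "(\<lambda>N. jsigma (2 ^ N * \<tau>) (- (1 + 2 ^ N * \<tau>) / 2)) \<longlonglongrightarrow> 1"
  proof (rule lim)
    show "(\<lambda>N. jsigma (2 ^ N * \<tau>) (- (1 + 2 ^ N * \<tau>) / 2) - (1 - (- exp (of_real pi * \<i> * (2 ^ N * \<tau>))))) \<longlonglongrightarrow> 0"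
      using jsigma_diff_tendsto_0[OF assms, of "\<lambda>N. - (1 + 2 ^ N * \<tau>) / 2"] assms unfolding e1 by simp
    show "(\<lambda>N. 1 - (- exp (of_real pi * \<i> * (2 ^ N * \<tau>)))) \<longlonglongrightarrow> 1"
      using tendsto_add[OF tendsto_const[of 1] exp_i_tau_tendsto_0[OF assms]] by simp
  qed
  then show "(\<lambda>N. jtheta (2 ^ N * \<tau>) 0) \<longlonglongrightarrow> 1" by (simp add: jsigma_def flip: add_divide_distrib)
  have "(\<lambda>N. jsigma (2 ^ N * \<tau>) (- (2 ^ N * \<tau>) / 2)) \<longlonglongrightarrow> 1"
  proof (rule lim)
    show "(\<lambda>N. jsigma (2 ^ N * \<tau>) (- (2 ^ N * \<tau>) / 2) - (1 - exp (of_real pi * \<i> * (2 ^ N * \<tau>)))) \<longlonglongrightarrow> 0"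
      using jsigma_diff_tendsto_0[OF assms, of "\<lambda>N. - (2 ^ N * \<tau>) / 2"] assms unfolding e2 by simp
    show "(\<lambda>N. 1 - exp (of_real pi * \<i> * (2 ^ N * \<tau>))) \<longlonglongrightarrow> 1"
      using tendsto_diff[OF tendsto_const[of 1] exp_i_tau_tendsto_0[OF assms]] by simp
  qed
  then show "(\<lambda>N. jtheta (2 ^ N * \<tau>) (1/2)) \<longlonglongrightarrow> 1" by (simp add: jsigma_def add_divide_distrib)
  have "(\<lambda>N. jsigma (2 ^ N * \<tau>) (- 1 / 2)) \<longlonglongrightarrow> 2"
  proof (rule lim)
    show "(\<lambda>N. jsigma (2 ^ N * \<tau>) (- 1 / 2) - (1 - (- 1))) \<longlonglongrightarrow> 0"
      using jsigma_diff_tendsto_0[OF assms, of "\<lambda>_. - 1 / 2"] assms unfolding e3 by simp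
  qed simp
  then show "(\<lambda>N. jtheta (2 ^ N * \<tau>) (2 ^ N * \<tau> / 2)) \<longlonglongrightarrow> 2" by (simp add: jsigma_def add_divide_distrib)
qed

text \<open>The Landen identities hand nonvanishing down from \<open>2 \<tau>\<close> to \<tau>, and
  far enough towards the cusp it holds because the limits 1, 1, 2 are nonzero.\<close>

lemma jtheta_null_nonzero:
  assumes "Im \<tau> > 0"
  shows "jtheta \<tau> 0 \<noteq> 0" "jtheta \<tau> (1/2) \<noteq> 0" "jtheta \<tau> (\<tau> / 2) \<noteq> 0"
proof -
  define P where "P = (\<lambda>\<tau>. jtheta \<tau> 0 \<noteq> 0 \<and> jtheta \<tau> (1/2) \<noteq> 0 \<and> jtheta \<tau> (\<tau> / 2) \<noteq> 0)"
  have step: "P \<tau>" if "Im \<tau> > 0" "P (2 * \<tau>)" for \<tau>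
  proof -
    have "jtheta \<tau> 0 * jtheta \<tau> (1/2) \<noteq> 0" "jtheta \<tau> (\<tau> / 2) ^ 2 \<noteq> 0"
      unfolding jtheta_landen_34[OF that(1)] jtheta_landen_2[OF that(1)] using that(2) by (simp_all add: P_def)
    then show ?thesis by (simp add: P_def)
  qed
  have desc: "P \<tau>" if "Im \<tau> > 0" "P (2 ^ N * \<tau>)" for N \<tau>
    using that
  proof (induction N arbitrary: \<tau>)
    case (Suc N)
    have "P (2 * \<tau>)" by (rule Suc.IH) (use Suc.prems in \<open>simp_all add: mult_ac\<close>)
    with step[OF Suc.prems(1)] show ?case by blast
  qed simp
  have "\<forall>\<^sub>F N in sequentially. P (2 ^ N * \<tau>)"
    using tendsto_imp_eventually_ne[OF jtheta_null_tendsto(1)[OF assms], of 0]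
      tendsto_imp_eventually_ne[OF jtheta_null_tendsto(2)[OF assms], of 0]
      tendsto_imp_eventually_ne[OF jtheta_null_tendsto(3)[OF assms], of 0]
    unfolding P_def by (simp add: eventually_conj)
  then obtain N where "P (2 ^ N * \<tau>)"
    by (auto simp: eventually_sequentially)
  from desc[OF assms this] show "jtheta \<tau> 0 \<noteq> 0" "jtheta \<tau> (1/2) \<noteq> 0" "jtheta \<tau> (\<tau> / 2) \<noteq> 0"
    by (simp_all add: P_def)
qed

lemma jsigma_two_power_zero:
  assumes "Im \<tau> > 0" "jsigma \<tau> z = 0"
  shows "jsigma (2 ^ N * \<tau>) (2 ^ N * z) = 0"
proof (induction N)
  case (Suc N)
  have t: "Im (2 ^ N * \<tau>) > 0" "Im (2 * (2 ^ N * \<tau>)) > 0" using assms by simp_all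
  have "jtheta (2 * (2 ^ N * \<tau>)) (1/2) * jsigma (2 * (2 ^ N * \<tau>)) (2 * (2 ^ N * z)) = 0"
    unfolding jsigma_landen[OF t(1), symmetric] Suc by (rule mult_zero_left)
  then show ?case
    using jtheta_null_nonzero(2)[OF t(2)] by (simp only: mult_eq_0_iff power_Suc mult.assoc) simp
qed (simp add: assms)

text \<open>As soon as \<open>\<bar>1 - w\<bar> < 1\<close>, squaring \<open>w\<close> does not decrease \<open>\<bar>1 - w\<bar>\<close>.\<close>

lemma square_orbit_tendsto_1:
  fixes v :: complex
  assumes "(\<lambda>N. v ^ 2 ^ N) \<longlonglongrightarrow> 1"
  obtains N where "v ^ 2 ^ N = 1"
proof -
  define d where "d = (\<lambda>N. norm (1 - v ^ 2 ^ N))"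
  have d: "d \<longlonglongrightarrow> 0"
    unfolding d_def using tendsto_diff[OF tendsto_const[of 1] assms] by (intro tendsto_norm_zero) simp
  then have "\<forall>\<^sub>F N in sequentially. d N < 1"
    by (rule order_tendstoD) simp
  then obtain N0 where N0: "\<And>N. N \<ge> N0 \<Longrightarrow> d N < 1"
    by (auto simp: eventually_sequentially)
  have mono: "d N \<le> d (Suc N)" if "N \<ge> N0" for N
  proof -
    \<comment> \<open>With \<open>w = v ^ 2 ^ N\<close> this gives
      \<open>norm (1 + w) \<ge> 2 - norm (1 - w) \<ge> 1\<close>, and \<open>1 - w^2\<close> factors
      as \<open>(1 - w) * (1 + w)\<close>. A sequence that is eventually nondecreasing and tends to
      0 from above has to be 0.\<close>
    have "norm (2 :: complex) \<le> norm (1 + v ^ 2 ^ N) + d N"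
      unfolding d_def using norm_triangle_ineq[of "1 + v ^ 2 ^ N" "1 - v ^ 2 ^ N"] by simp
    with N0[OF that] have "norm (1 + v ^ 2 ^ N) \<ge> 1" by simp
    then have "d N * 1 \<le> d N * norm (1 + v ^ 2 ^ N)" by (intro mult_left_mono) (auto simp: d_def)
    also have "d N * norm (1 + v ^ 2 ^ N) = d (Suc N)"
    proof -
      have "(1 - v ^ 2 ^ N) * (1 + v ^ 2 ^ N) = 1 - v ^ 2 ^ Suc N"
        by (simp add: algebra_simps power_add[symmetric] mult_2)
      then show ?thesis by (simp add: d_def norm_mult[symmetric])
    qed
    finally show ?thesis by simp
  qed
  have "d N0 \<le> d N" if "N \<ge> N0" for N
    using that by (induction rule: dec_induct) (auto intro: order.trans mono)
  then have "d N0 \<le> 0"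
    by (intro tendsto_lowerbound[OF d]) (auto simp: eventually_sequentially)
  then have "v ^ 2 ^ N0 = 1" by (simp add: d_def)
  then show ?thesis using that by blast
qed

section \<open>The zeros of \<open>theta1\<close>\<close>

lemma exp_2pi_eq_1_Ints: "exp (- 2 * of_real pi * \<i> * z) = 1 \<Longrightarrow> z \<in> \<int>"
proof -
  assume "exp (- 2 * of_real pi * \<i> * z) = 1"
  then obtain n :: int where n: "- 2 * of_real pi * \<i> * z = of_int (2 * n) * of_real pi * \<i>"
    using exp_eq_1[of "- 2 * of_real pi * \<i> * z"] by (auto simp: complex_eq_iff)
  then have "(2 * of_real pi * \<i>) * z = (2 * of_real pi * \<i>) * of_int (- n)"
    using arg_cong[OF n, of uminus] by (simp add: algebra_simps)
  then have "z = of_int (- n)" by (subst (asm) mult_cancel_left) auto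
  then show ?thesis by (simp only: Ints_of_int)
qed

lemma jsigma_plus_1: "jsigma \<tau> (z + 1) = jsigma \<tau> z"
  using jtheta_plus_1[of \<tau> "z + (1 + \<tau>) / 2"] by (simp add: jsigma_def add_ac)

lemma jsigma_plus_tau: "jsigma \<tau> (z + \<tau>) = - exp (- 2 * of_real pi * \<i> * (\<tau> + z)) * jsigma \<tau> z"
proof -
  have "jsigma \<tau> (z + \<tau>) = exp (- (of_real pi * \<i> * (\<tau> + 2 * (z + (1 + \<tau>) / 2)))) * jsigma \<tau> z"
    using jtheta_plus_tau[of \<tau> "z + (1 + \<tau>) / 2"] by (simp add: jsigma_def add_ac)
  also have "- (of_real pi * \<i> * (\<tau> + 2 * (z + (1 + \<tau>) / 2))) = - 2 * of_real pi * \<i> * (\<tau> + z) + - (of_real pi * \<i>)"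
    by (simp add: field_simps)
  also have "exp \<dots> = - exp (- 2 * of_real pi * \<i> * (\<tau> + z))"
    unfolding exp_add by (simp add: exp_minus)
  finally show ?thesis .
qed

lemma jsigma_minus: "jsigma \<tau> (- z) = - exp (2 * of_real pi * \<i> * z) * jsigma \<tau> z"
proof -
  have "jsigma \<tau> (- z) = jtheta \<tau> (- (- z + (1 + \<tau>) / 2))"
    by (simp only: jsigma_def jtheta_minus)
  also have "- (- z + (1 + \<tau>) / 2) = (z - 1 - \<tau>) + (1 + \<tau>) / 2" by (simp add: field_simps)
  also have "jtheta \<tau> \<dots> = jsigma \<tau> (z - \<tau>)"
    using jsigma_plus_1[of \<tau> "z - 1 - \<tau>"] by (simp add: jsigma_def)
  also have "jsigma \<tau> z = - exp (- 2 * of_real pi * \<i> * z) * jsigma \<tau> (z - \<tau>)"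
    using jsigma_plus_tau[of \<tau> "z - \<tau>"] by simp
  ultimately show ?thesis
    by (simp add: exp_minus)
qed

lemma jsigma_plus_int: "jsigma \<tau> (z + of_int n) = jsigma \<tau> z"
proof (induction n rule: int_induct[of _ 0])
  case (step1 i)
  then show ?case using jsigma_plus_1[of \<tau> "z + of_int i"] by (simp add: add_ac)
next
  case (step2 i)
  then show ?case using jsigma_plus_1[of \<tau> "z + of_int (i - 1)"] by (simp add: add_ac)
qed simp

text \<open>By Landen's transformation a zero \<open>z\<close> for \<open>\<tau>\<close> yields the zero \<open>2 ^ N * z\<close> for \<open>2 ^ N * \<tau>\<close>. As
  \<open>2 ^ N * \<tau>\<close> tends to the cusp, this forces \<open>z\<close> to be a dyadic rational; if it were not an integer, some
  multiple would be \<open>1/2\<close> modulo 1, where the value is the nonzero constant \<open>theta2\<close>.\<close>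

lemma jsigma_zero_in_strip:
  assumes "Im \<tau> > 0" "jsigma \<tau> z = 0" "- Im \<tau> / 2 \<le> Im z" "Im z \<le> 0"
  shows "z \<in> \<int>"
proof -
  define v where "v = exp (- 2 * of_real pi * \<i> * z)"
  have v: "exp (- 2 * of_real pi * \<i> * (2 ^ N * z)) = v ^ 2 ^ N" for N
    unfolding v_def exp_of_nat_mult[symmetric] by (simp add: mult_ac)
  have "(\<lambda>N. jsigma (2 ^ N * \<tau>) (2 ^ N * z) - (1 - exp (- 2 * of_real pi * \<i> * (2 ^ N * z)))) \<longlonglongrightarrow> 0"
  proof (rule jsigma_diff_tendsto_0[OF assms(1)], rule always_eventually, rule allI)
    fix N :: nat
    have "2 ^ N * (- Im \<tau> / 2) \<le> 2 ^ N * Im z"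
      using assms(3) by (rule mult_left_mono) simp
    moreover have "2 ^ N * Im z \<le> 0"
      using assms(4) by (simp add: mult_nonneg_nonpos)
    moreover have "2 ^ N * Im \<tau> > 0" using assms by simp
    ultimately show "- (2 ^ N * Im \<tau>) / 2 \<le> Im (2 ^ N * z) \<and> Im (2 ^ N * z) \<le> 2 ^ N * Im \<tau> / 4"
      unfolding Im_two_power_mult by linarith
  qed
  \<comment> \<open>The values of \<open>jsigma\<close> along the doubled zeros are exactly 0, so
    the estimate becomes a statement about the main term alone.\<close>
  then have "(\<lambda>N. v ^ 2 ^ N - 1) \<longlonglongrightarrow> 0"
    unfolding v jsigma_two_power_zero[OF assms(1,2)] by simp
  then have "(\<lambda>N. v ^ 2 ^ N) \<longlonglongrightarrow> 1" by (simp add: LIM_zero_iff)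
  then obtain N where "v ^ 2 ^ N = 1" by (rule square_orbit_tendsto_1)
  then have ex: "2 ^ N * z \<in> \<int>" by (intro exp_2pi_eq_1_Ints) (simp only: v)
  define M where "M = (LEAST N. 2 ^ N * z \<in> \<int>)"
  have M: "2 ^ M * z \<in> \<int>" unfolding M_def by (rule LeastI[of "\<lambda>N. 2 ^ N * z \<in> \<int>", OF ex])
  show ?thesis
  proof (cases M)
    case 0
    then show ?thesis using M by simp
  next
    case (Suc L)
    define w where "w = 2 ^ L * z"
    have "w \<notin> \<int>"
      unfolding w_def using not_less_Least[of L "\<lambda>N. 2 ^ N * z \<in> \<int>"] Suc by (simp add: M_def)
    from M Suc obtain k :: int where k: "2 * w = of_int k" by (auto simp: w_def mult.assoc elim: Ints_cases)
    have "odd k"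
    proof
      assume "even k"
      then obtain l where "k = 2 * l" by blast
      with k have "w = of_int l" by simp
      with \<open>w \<notin> \<int>\<close> show False by simp
    qed
    then obtain l where "k = 2 * l + 1" by (rule oddE)
    with k have wl: "w = 1/2 + of_int l" by (simp add: field_simps)
    define t where "t = 2 ^ L * \<tau>"
    have t: "Im t > 0" using assms by (simp add: t_def)
    have "jsigma t (1/2) = 0"
      using jsigma_two_power_zero[OF assms(1,2), of L] wl by (simp add: jsigma_plus_int t_def w_def)
    moreover have "jsigma t (1/2) = jtheta t (t / 2)"
      using jtheta_plus_1[of t "t / 2"] by (simp add: jsigma_def add_divide_distrib add_ac)
    ultimately show ?thesis using jtheta_null_nonzero(3)[OF t] by simp
  qed
qed

definition lat :: "complex \<Rightarrow> complex set" where
  "lat \<tau> = {of_int m * \<tau> + of_int n | m n. True}"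

lemma jsigma_shift_zero_iff: "jsigma \<tau> (z + of_int m * \<tau>) = 0 \<longleftrightarrow> jsigma \<tau> z = 0"
proof (induction m rule: int_induct[of _ 0])
  case (step1 i)
  then show ?case using jsigma_plus_tau[of \<tau> "z + of_int i * \<tau>"] by (simp add: algebra_simps)
next
  case (step2 i)
  then show ?case using jsigma_plus_tau[of \<tau> "z + of_int (i - 1) * \<tau>"] by (simp add: algebra_simps)
qed simp

text \<open>Rounding \<open>Im z / Im \<tau>\<close> moves a zero into the strip of height
  \<open>Im \<tau>\<close> around the real axis. The strip lemma covers its lower half; the
  reflection at 0, which preserves zeros, covers the upper half.\<close>

lemma jsigma_eq_0_iff:
  assumes "Im \<tau> > 0"
  shows "jsigma \<tau> z = 0 \<longleftrightarrow> z \<in> lat \<tau>"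
proof
  assume z: "jsigma \<tau> z = 0"
  define m where "m = round (Im z / Im \<tau>)"
  define w where "w = z + of_int (- m) * \<tau>"
  have w: "jsigma \<tau> w = 0" unfolding w_def jsigma_shift_zero_iff by (rule z)
  have "\<bar>of_int m - Im z / Im \<tau>\<bar> \<le> 1/2" unfolding m_def by (rule of_int_round_abs_le)
  then have "\<bar>of_int m - Im z / Im \<tau>\<bar> * Im \<tau> \<le> 1/2 * Im \<tau>" using assms by (intro mult_right_mono) auto
  then have "\<bar>(of_int m - Im z / Im \<tau>) * Im \<tau>\<bar> \<le> 1/2 * Im \<tau>" using assms by (simp add: abs_mult)
  moreover have "Im w = - ((of_int m - Im z / Im \<tau>) * Im \<tau>)" using assms by (simp add: w_def field_simps)
  ultimately have *: "\<bar>Im w\<bar> \<le> Im \<tau> / 2" by simp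
  have "w \<in> \<int>"
  proof (cases "Im w \<le> 0")
    case True
    then show ?thesis using * by (intro jsigma_zero_in_strip[OF assms w]) auto
  next
    case False
    have "- w \<in> \<int>" using * False w by (intro jsigma_zero_in_strip[OF assms]) (auto simp: jsigma_minus)
    then show ?thesis by simp
  qed
  then obtain n where "w = of_int n" by (rule Ints_cases)
  then have "z = of_int m * \<tau> + of_int n" by (simp add: w_def algebra_simps)
  then show "z \<in> lat \<tau>" by (auto simp: lat_def)
next
  assume "z \<in> lat \<tau>"
  then obtain m n where "z = of_int m * \<tau> + of_int n" by (auto simp: lat_def)
  then have "z = (0 + of_int n) + of_int m * \<tau>" by simp
  then show "jsigma \<tau> z = 0" by (simp only: jsigma_shift_zero_iff jsigma_plus_int jsigma_0)
qed

section \<open>Jacobi's derivative formula\<close>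

lemma holomorphic_jsigma [holomorphic_intros]:
  assumes "Im \<tau> > 0" "f holomorphic_on A"
  shows "(\<lambda>z. jsigma \<tau> (f z)) holomorphic_on A"
  unfolding jsigma_def using assms by (intro holomorphic_intros)

lemma field_differentiable_jsigma:
  assumes "Im \<tau> > 0"
  shows "jsigma \<tau> field_differentiable at z"
  using holomorphic_jsigma[OF assms holomorphic_on_ident[of UNIV]]
  by (intro holomorphic_on_imp_differentiable_at[of _ UNIV]) auto

lemma field_differentiable_jtheta:
  assumes "Im \<tau> > 0"
  shows "jtheta \<tau> field_differentiable at z"
  using holomorphic_jtheta[OF assms holomorphic_on_ident[of UNIV]]
  by (intro holomorphic_on_imp_differentiable_at[of _ UNIV]) auto

text \<open>Differentiate Landen's identity for \<open>jsigma\<close> at 0. The derivative of the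
  second factor is multiplied by \<open>jsigma \<tau> 0 = 0\<close>, and the inner function
  \<open>2 * z\<close> contributes the factor 2.\<close>

lemma jsigma_deriv_landen:
  assumes "Im \<tau> > 0"
  shows "deriv (jsigma \<tau>) 0 * jtheta \<tau> (\<tau> / 2) = 2 * jtheta (2 * \<tau>) (1/2) * deriv (jsigma (2 * \<tau>)) 0"
proof -
  have t2: "Im (2 * \<tau>) > 0" using assms by simp
  have "((\<lambda>z. jsigma \<tau> z * jtheta \<tau> (z + \<tau> / 2)) has_field_derivative
        deriv (jsigma \<tau>) 0 * jtheta \<tau> (0 + \<tau> / 2) + deriv (jtheta \<tau>) (0 + \<tau> / 2) * (1 + 0) * jsigma \<tau> 0) (at 0)"
    by (rule DERIV_mult DERIV_chain2 field_differentiable_derivI field_differentiable_jsigma[OF assms]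
        field_differentiable_jtheta[OF assms] DERIV_add DERIV_ident DERIV_const)+
  moreover have "((\<lambda>z. jtheta (2 * \<tau>) (1/2) * jsigma (2 * \<tau>) (2 * z)) has_field_derivative
        jtheta (2 * \<tau>) (1/2) * (deriv (jsigma (2 * \<tau>)) (2 * 0) * (2 * 1))) (at 0)"
    by (intro DERIV_cmult DERIV_chain2 field_differentiable_derivI field_differentiable_jsigma[OF t2] DERIV_ident)
  ultimately show ?thesis
    unfolding jsigma_landen[OF assms] using DERIV_unique by fastforce
qed

lemma jsigma_deriv_tendsto:
  assumes "Im \<tau> > 0"
  shows "(\<lambda>N. deriv (jsigma (2 ^ N * \<tau>)) 0) \<longlonglongrightarrow> 2 * of_real pi * \<i>"
proof -
  define h where "h = (\<lambda>N z. jsigma (2 ^ N * \<tau>) z - (1 - exp (- 2 * of_real pi * \<i> * z)))"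
  have hol: "h N holomorphic_on A" for N A
    unfolding h_def by (intro holomorphic_intros) (use assms in simp)
  have dh: "deriv (h N) 0 = deriv (jsigma (2 ^ N * \<tau>)) 0 - 2 * of_real pi * \<i>" for N
  proof -
    have "(h N has_field_derivative deriv (jsigma (2 ^ N * \<tau>)) 0 - (0 - exp (- 2 * of_real pi * \<i> * 0) * (- 2 * of_real pi * \<i> * 1))) (at 0)"
      unfolding h_def by (rule DERIV_diff DERIV_const DERIV_chain2[OF DERIV_exp] DERIV_cmult DERIV_ident
          field_differentiable_derivI field_differentiable_jsigma | use assms in simp)+
    then show ?thesis by (intro DERIV_imp_deriv) simp
  qed
  \<comment> \<open>From 4 on, the unit circle lies in the strip of the estimate, whose upper edge
    is a quarter of the imaginary part. Cauchy's inequality then compares the derivative with that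
    of \<open>1 - exp (- 2 * of_real pi * \<i> * z)\<close> at 0.\<close>
  have "\<forall>\<^sub>F N :: nat in sequentially. 2 ^ N * Im \<tau> \<ge> 4"
    using assms by real_asymp
  then have "\<forall>\<^sub>F N in sequentially. norm (deriv (h N) 0) \<le> nome_bound (2 ^ N * \<tau>)"
  proof eventually_elim
    case (elim N)
    have "norm ((deriv ^^ 1) (h N) 0) \<le> fact 1 * nome_bound (2 ^ N * \<tau>) / 1 ^ 1"
    proof (rule Cauchy_inequality)
      show "norm (h N x) \<le> nome_bound (2 ^ N * \<tau>)" if "norm (0 - x) = 1" for x
      proof -
        have "\<bar>Im x\<bar> \<le> 1" using abs_Im_le_cmod[of x] that by simp
        then show ?thesis unfolding h_def using elim assms by (intro norm_jsigma_diff_le) auto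
      qed
    qed (use hol holomorphic_on_imp_continuous_on in auto)
    then show ?case by simp
  qed
  then have "(\<lambda>N. deriv (h N) 0) \<longlonglongrightarrow> 0"
    by (rule Lim_null_comparison[OF _ nome_bound_tendsto_0[OF assms]])
  then show ?thesis unfolding dh by (simp add: LIM_zero_iff)
qed

text \<open>The quotient of the two sides is invariant under doubling by the three Landen
  identities, so it equals its limit at the cusp; the constant comes from
  \<open>2 * pi * \<i> / (1 * 1 * 2)\<close>.\<close>

lemma jsigma_deriv_0:
  assumes "Im \<tau> > 0"
  shows "deriv (jsigma \<tau>) 0 = of_real pi * \<i> * jtheta \<tau> 0 * jtheta \<tau> (1/2) * jtheta \<tau> (\<tau> / 2)"
proof -
  define R where "R = (\<lambda>\<tau>. deriv (jsigma \<tau>) 0 / (jtheta \<tau> 0 * jtheta \<tau> (1/2) * jtheta \<tau> (\<tau> / 2)))"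
  have step: "R (2 * \<tau>) = R \<tau>" if t: "Im \<tau> > 0" for \<tau>
  proof -
    have t2: "Im (2 * \<tau>) > 0" using t by simp
    note nz = jtheta_null_nonzero[OF t] jtheta_null_nonzero[OF t2]
    have "R \<tau> = (deriv (jsigma \<tau>) 0 * jtheta \<tau> (\<tau> / 2)) / (jtheta \<tau> 0 * jtheta \<tau> (1/2) * jtheta \<tau> (\<tau> / 2) ^ 2)"
      unfolding R_def using nz by (simp add: divide_simps power2_eq_square)
    also have "\<dots> = R (2 * \<tau>)"
      unfolding jsigma_deriv_landen[OF t] jtheta_landen_34[OF t] jtheta_landen_2[OF t] R_def using nz
      by (simp add: divide_simps power2_eq_square)
    finally show ?thesis by simp
  qed
  have "R (2 ^ N * \<tau>) = R \<tau>" for N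
  proof (induction N)
    case (Suc N)
    then show ?case using step[of "2 ^ N * \<tau>"] assms by (simp add: mult.assoc)
  qed simp
  moreover have "(\<lambda>N. R (2 ^ N * \<tau>)) \<longlonglongrightarrow> (2 * of_real pi * \<i>) / (1 * 1 * 2)"
    unfolding R_def by (intro tendsto_intros jsigma_deriv_tendsto jtheta_null_tendsto assms) auto
  ultimately have "R \<tau> = of_real pi * \<i>"
    by (simp add: LIMSEQ_const_iff)
  then show ?thesis
    unfolding R_def using jtheta_null_nonzero[OF assms] by (simp add: divide_simps)
qed

subsection \<open>Quasi-elliptic functions\<close>

text \<open>Riemann's theorem at each point of a discrete set. The values of \<open>E\<close> on
  \<open>D\<close> are arbitrary results of division by 0, so the extension is taken with
  \<open>remove_sings\<close> instead of \<open>E\<close> itself.\<close>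

lemma entire_extension:
  assumes sparse: "\<And>z. \<forall>\<^sub>F w in at z. w \<notin> D"
    and hol: "E holomorphic_on - D"
    and lim: "\<And>p. p \<in> D \<Longrightarrow> ((\<lambda>z. (z - p) * E z) \<longlongrightarrow> 0) (at p)"
  shows "remove_sings E holomorphic_on UNIV" "\<And>z. z \<notin> D \<Longrightarrow> remove_sings E z = E z"
proof -
  have "closed D"
    unfolding closed_limpt islimpt_iff_eventually using sparse by blast
  then have op: "open (- D)" by auto
  have ana: "E analytic_on {z}" if "z \<notin> D" for z
    using hol op that by (auto simp: analytic_at)
  show "remove_sings E z = E z" if "z \<notin> D" for z
    by (rule remove_sings_at_analytic[OF ana[OF that]])
  have "remove_sings E analytic_on {p}" for p
  proof (cases "p \<in> D")
    case False
    then show ?thesis by (intro remove_sings_analytic_on ana)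
  next
    case True
    obtain r where r: "r > 0" "\<And>w. w \<noteq> p \<Longrightarrow> dist w p < r \<Longrightarrow> w \<notin> D"
      using sparse[of p] by (auto simp: eventually_at)
    have hb: "E holomorphic_on ball p r - {p}"
      by (rule holomorphic_on_subset[OF hol]) (use r(2) in \<open>auto simp: dist_commute\<close>)
    then obtain g where g: "g holomorphic_on ball p r" "\<And>z. z \<in> ball p r - {p} \<Longrightarrow> g z = E z"
      using holomorphic_on_extend_lim[of E "ball p r" p] lim[OF True] r(1) by (auto simp: interior_open)
    have "continuous (at p) g"
      using g(1) r(1) by (meson centre_in_ball continuous_on_eq_continuous_at holomorphic_on_imp_continuous_on open_ball)
    then have "g \<midarrow>p\<rightarrow> g p" by (simp add: isCont_def)
    moreover have "\<forall>\<^sub>F z in at p. g z = E z"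
      unfolding eventually_at using r(1) g(2) by (intro exI[of _ r]) (auto simp: dist_commute)
    ultimately have "E \<midarrow>p\<rightarrow> g p"
      using tendsto_cong by blast
    moreover have "isolated_singularity_at E p"
      unfolding isolated_singularity_at_def using r(1) hb
      by (intro exI[of _ r]) (simp add: analytic_on_open open_delete)
    ultimately show ?thesis by (rule remove_sings_analytic_at[rotated])
  qed
  then show "remove_sings E holomorphic_on UNIV"
    using analytic_imp_holomorphic analytic_on_analytic_at by blast
qed

text \<open>Only the norm is required to be periodic, which admits multipliers of modulus 1. A
  rectangle replaces the period parallelogram: a multiple of \<tau> fixes the imaginary part, after
  which an integer fixes the real part.\<close>

lemma bounded_range_doubly_periodic:
  fixes f :: "complex \<Rightarrow> 'a :: real_normed_vector"
  assumes "Im \<tau> > 0" "continuous_on UNIV f"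
    and per: "\<And>z. norm (f (z + 1)) = norm (f z)" "\<And>z. norm (f (z + \<tau>)) = norm (f z)"
  shows "bounded (range f)"
proof -
  have int: "norm (f (z + of_int k * w)) = norm (f z)" if "\<And>z. norm (f (z + w)) = norm (f z)" for z w k
  proof (induction k rule: int_induct[of _ 0])
    case (step1 i)
    then show ?case using that[of "z + of_int i * w"] by (simp add: algebra_simps)
  next
    case (step2 i)
    then show ?case using that[of "z + of_int (i - 1) * w"] by (simp add: algebra_simps)
  qed simp
  have "compact (f ` cbox 0 (Complex 1 (Im \<tau>)))"
    using assms(2) by (intro compact_continuous_image) (auto intro: continuous_on_subset)
  then obtain B where B: "\<And>z. z \<in> cbox 0 (Complex 1 (Im \<tau>)) \<Longrightarrow> norm (f z) \<le> B"
    by (meson bounded_iff compact_imp_bounded imageI)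
  have "norm (f z) \<le> B" for z
  proof -
    define m where "m = \<lfloor>Im z / Im \<tau>\<rfloor>"
    define w where "w = z + of_int (- m) * \<tau>"
    define n where "n = \<lfloor>Re w\<rfloor>"
    have "of_int m \<le> Im z / Im \<tau>" "Im z / Im \<tau> \<le> of_int m + 1"
      unfolding m_def by linarith+
    then have "0 \<le> Im w" "Im w \<le> Im \<tau>"
      using assms(1) by (auto simp: w_def field_simps)
    moreover have "of_int n \<le> Re w" "Re w \<le> of_int n + 1"
      unfolding n_def by linarith+
    ultimately have "w + of_int (- n) * 1 \<in> cbox 0 (Complex 1 (Im \<tau>))"
      by (simp add: in_cbox_complex_iff)
    then have "norm (f (w + of_int (- n) * 1)) \<le> B" by (rule B)
    then show ?thesis
      unfolding int[OF per(1)] w_def int[OF per(2)] .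
  qed
  then show ?thesis by (auto simp: bounded_iff)
qed

text \<open>The derivative of \<open>g\<close> is bounded, hence constant, so \<open>g\<close> is affine; the first
  multiplier excludes a linear term.\<close>

lemma entire_quasi_periodic_constant:
  assumes "Im \<tau> > 0" "g holomorphic_on UNIV" "s \<in> {1, -1}" "t \<in> {1, -1}"
    and per: "\<And>z. g (z + 1) = s * g z" "\<And>z. g (z + \<tau>) = t * g z + \<kappa>"
  shows "g z = g 0"
proof -
  have diff: "g field_differentiable at z" for z
    using assms(2) by (intro holomorphic_on_imp_differentiable_at[of _ UNIV]) auto
  have shift: "((\<lambda>z. g (z + w)) has_field_derivative deriv g (z + w)) (at z)" for z w
    unfolding DERIV_shift[symmetric] by (rule field_differentiable_derivI[OF diff])
  have d1: "deriv g (z + 1) = s * deriv g z" for z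
    using shift[of 1 z] unfolding per
    by (rule DERIV_unique) (intro DERIV_cmult field_differentiable_derivI diff)
  have d2: "deriv g (z + \<tau>) = t * deriv g z" for z
  proof (rule DERIV_unique)
    show "((\<lambda>z. g (z + \<tau>)) has_field_derivative deriv g (z + \<tau>)) (at z)" by (rule shift)
    show "((\<lambda>z. g (z + \<tau>)) has_field_derivative t * deriv g z) (at z)"
      unfolding per using DERIV_add[OF DERIV_cmult[OF field_differentiable_derivI[OF diff]] DERIV_const] by simp
  qed
  have hd: "deriv g holomorphic_on UNIV"
    using assms(2) by (rule holomorphic_deriv) auto
  have "bounded (range (deriv g))"
    using assms(3,4) holomorphic_on_imp_continuous_on[OF hd]
    by (intro bounded_range_doubly_periodic[OF assms(1)]) (auto simp: d1 d2 norm_mult)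
  then have "deriv g constant_on UNIV"
    by (rule Liouville_theorem[OF hd])
  then obtain \<alpha> where \<alpha>: "\<And>z. deriv g z = \<alpha>" by (auto simp: constant_on_def)
  have lin: "g z = \<alpha> * z + g 0" for z
  proof -
    have "\<exists>c. \<forall>x\<in>UNIV. g x - \<alpha> * x = c"
    proof (rule has_field_derivative_zero_constant)
      show "((\<lambda>x. g x - \<alpha> * x) has_field_derivative 0) (at x within UNIV)" for x
        using DERIV_diff[OF field_differentiable_derivI[OF diff[of x]] DERIV_cmult[OF DERIV_ident, of \<alpha>]]
        by (simp add: \<alpha>)
    qed auto
    then obtain c where "\<And>x. g x - \<alpha> * x = c" by auto
    from this[of 0] this[of z] show ?thesis by (simp add: algebra_simps)
  qed
  have "\<alpha> = 0"
  proof (cases "s = 1")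
    case True
    then show ?thesis using per(1)[of 0] lin[of 1] by simp
  next
    case False
    then have "s = - 1" using assms(3) by simp
    then have "\<alpha> + g 0 * 2 = 0" "\<alpha> * 3 + g 0 * 2 = 0"
      using per(1)[of 0] lin[of 1] per(1)[of 1] lin[of 2] by (simp_all add: algebra_simps)
    then have "(\<alpha> * 3 + g 0 * 2) - (\<alpha> + g 0 * 2) = 0" by (simp only: diff_self)
    then show ?thesis by simp
  qed
  then show ?thesis using lin by simp
qed

lemma eq_off_sparse_imp_eq:
  fixes f g :: "complex \<Rightarrow> complex"
  assumes "\<And>z. \<forall>\<^sub>F w in at z. w \<notin> D" "continuous_on UNIV f" "continuous_on UNIV g"
    and "\<And>z. z \<notin> D \<Longrightarrow> f z = g z"
  shows "f z = g z"
proof -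
  have f: "f \<midarrow>z\<rightarrow> f z" and g: "g \<midarrow>z\<rightarrow> g z"
    using assms(2,3) by (auto simp: continuous_on_eq_continuous_at isCont_def)
  have "\<forall>\<^sub>F w in at z. f w = g w"
    using assms(1)[of z] by eventually_elim (rule assms(4))
  then have "g \<midarrow>z\<rightarrow> f z" using f tendsto_cong by blast
  then show ?thesis using g LIM_unique by blast
qed

text \<open>The equations for \<open>c\<close> carry the information used later: with
  \<open>\<kappa> = 0\<close> a sign -1 forces \<open>c = 0\<close>, and \<open>t = 1\<close> forces
  \<open>\<kappa> = 0\<close>.\<close>

lemma quasi_elliptic_constant:
  assumes "Im \<tau> > 0" "s \<in> {1, -1}" "t \<in> {1, -1}"
    and sparse: "\<And>z. \<forall>\<^sub>F w in at z. w \<notin> D"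
    and inv: "\<And>z. z + 1 \<in> D \<longleftrightarrow> z \<in> D" "\<And>z. z + \<tau> \<in> D \<longleftrightarrow> z \<in> D"
    and hol: "E holomorphic_on - D"
    and per: "\<And>z. z \<notin> D \<Longrightarrow> E (z + 1) = s * E z" "\<And>z. z \<notin> D \<Longrightarrow> E (z + \<tau>) = t * E z + \<kappa>"
    and lim: "\<And>p. p \<in> D \<Longrightarrow> ((\<lambda>z. (z - p) * E z) \<longlongrightarrow> 0) (at p)"
  obtains c where "\<And>z. z \<notin> D \<Longrightarrow> E z = c" "c = s * c" "c = t * c + \<kappa>"
proof -
  define g where "g = remove_sings E"
  have g: "g holomorphic_on UNIV" "\<And>z. z \<notin> D \<Longrightarrow> g z = E z"
    unfolding g_def using entire_extension[OF sparse hol lim] by auto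
  have cont: "continuous_on A (\<lambda>z. g (z + w))" for A w
  proof -
    have "continuous_on UNIV g" using g(1) by (rule holomorphic_on_imp_continuous_on)
    then show ?thesis by (rule continuous_on_compose2) (auto intro!: continuous_intros)
  qed
  have p1: "g (z + 1) = s * g z" for z
    by (rule eq_off_sparse_imp_eq[where D = D and f = "\<lambda>z. g (z + 1)" and g = "\<lambda>z. s * g z"])
       (use sparse cont[of _ 1] cont[of _ 0] in \<open>auto simp: g(2) inv per intro!: continuous_intros\<close>)
  have p2: "g (z + \<tau>) = t * g z + \<kappa>" for z
    by (rule eq_off_sparse_imp_eq[where D = D and f = "\<lambda>z. g (z + \<tau>)" and g = "\<lambda>z. t * g z + \<kappa>"])
       (use sparse cont[of _ \<tau>] cont[of _ 0] in \<open>auto simp: g(2) inv per intro!: continuous_intros\<close>)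
  have c: "g z = g 0" for z
    by (rule entire_quasi_periodic_constant[OF assms(1) g(1) assms(2,3) p1 p2])
  show ?thesis
  proof (rule that[of "g 0"])
    show "E z = g 0" if "z \<notin> D" for z using g(2)[OF that] c[of z] by simp
    show "g 0 = s * g 0" using p1[of 0] c[of "0 + 1"] by simp
    show "g 0 = t * g 0 + \<kappa>" using p2[of 0] c[of "0 + \<tau>"] by simp
  qed
qed

section \<open>The period lattice\<close>

lemma lat_plus_1 [simp]: "z + 1 \<in> lat \<tau> \<longleftrightarrow> z \<in> lat \<tau>"
proof
  assume "z + 1 \<in> lat \<tau>"
  then obtain m n where "z + 1 = of_int m * \<tau> + of_int n" by (auto simp: lat_def)
  then have "z = of_int m * \<tau> + of_int (n - 1)" by (simp add: algebra_simps)
  then show "z \<in> lat \<tau>" unfolding lat_def by blast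
next
  assume "z \<in> lat \<tau>"
  then obtain m n where "z = of_int m * \<tau> + of_int n" by (auto simp: lat_def)
  then have "z + 1 = of_int m * \<tau> + of_int (n + 1)" by (simp add: algebra_simps)
  then show "z + 1 \<in> lat \<tau>" unfolding lat_def by blast
qed

lemma lat_plus_tau [simp]: "z + \<tau> \<in> lat \<tau> \<longleftrightarrow> z \<in> lat \<tau>"
proof
  assume "z + \<tau> \<in> lat \<tau>"
  then obtain m n where "z + \<tau> = of_int m * \<tau> + of_int n" by (auto simp: lat_def)
  then have "z = of_int (m - 1) * \<tau> + of_int n" by (simp add: algebra_simps)
  then show "z \<in> lat \<tau>" unfolding lat_def by blast
next
  assume "z \<in> lat \<tau>"
  then obtain m n where "z = of_int m * \<tau> + of_int n" by (auto simp: lat_def)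
  then have "z + \<tau> = of_int (m + 1) * \<tau> + of_int n" by (simp add: algebra_simps)
  then show "z + \<tau> \<in> lat \<tau>" unfolding lat_def by blast
qed

lemma zero_in_lat [simp]: "0 \<in> lat \<tau>"
  unfolding lat_def by (intro CollectI exI[of _ 0]) simp

text \<open>The lattice is the zero set of \<open>jsigma \<tau>\<close>, so its discreteness is the
  isolation of zeros of a function that does not vanish at -1/2; its value there is
  \<open>jtheta \<tau> (\<tau> / 2)\<close>.\<close>

lemma lat_sparse:
  assumes "Im \<tau> > 0"
  shows "\<forall>\<^sub>F w in at z. w - p \<notin> lat \<tau>"
proof -
  have "jsigma \<tau> (- 1/2) \<noteq> 0"
    using jtheta_null_nonzero(3)[OF assms] by (simp add: jsigma_def add_divide_distrib)
  then have "\<forall>\<^sub>F w in at z. jsigma \<tau> (w - p) \<noteq> 0 \<and> w \<in> UNIV"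
    by (intro non_zero_neighbour_alt[of _ _ _ "p - 1/2"]) (auto intro!: holomorphic_intros assms)
  then show ?thesis by (simp add: jsigma_eq_0_iff[OF assms])
qed

text \<open>By quasi-periodicity it suffices to check the behaviour of \<open>E\<close> at one point of every lattice coset.\<close>

lemma quasi_elliptic_constant_lat:
  assumes \<tau>: "Im \<tau> > 0" and st: "s \<in> {1, -1}" "t \<in> {1, -1}" and "finite S"
    and D: "D = {z. \<exists>p\<in>S. z - p \<in> lat \<tau>}"
    and hol: "E holomorphic_on - D"
    and per: "\<And>z. z \<notin> D \<Longrightarrow> E (z + 1) = s * E z" "\<And>z. z \<notin> D \<Longrightarrow> E (z + \<tau>) = t * E z + \<kappa>"
    and lim: "\<And>p. p \<in> S \<Longrightarrow> ((\<lambda>z. (z - p) * E z) \<longlongrightarrow> 0) (at p)"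
  obtains c where "\<And>z. z \<notin> D \<Longrightarrow> E z = c" "c = s * c" "c = t * c + \<kappa>"
proof -
  define L where "L = (\<lambda>p. ((\<lambda>z. (z - p) * E z) \<longlongrightarrow> 0) (at p))"
  have sparse: "\<forall>\<^sub>F w in at z. w \<notin> D" for z
    unfolding D using assms(4) lat_sparse[OF \<tau>] by (simp add: eventually_ball_finite)
  have inv: "z + 1 \<in> D \<longleftrightarrow> z \<in> D" "z + \<tau> \<in> D \<longleftrightarrow> z \<in> D" for z
    unfolding D using lat_plus_1[of "z - _"] lat_plus_tau[of "z - _"] by (simp_all add: algebra_simps)
  \<comment> \<open>Translation changes \<open>E\<close> by a sign, which is its own inverse, and by
    a constant, which disappears in the limit after multiplication by \<open>z - p\<close>. Hence
    the condition is equivalent at \<open>p\<close> and \<open>p + w\<close>.\<close>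
  have shift: "L (p + w) \<longleftrightarrow> L p"
    if w: "\<And>z. z \<notin> D \<Longrightarrow> E (z + w) = u * E z + c" and u: "u \<in> {1, -1}" for p w u c
  proof -
    have "L (p + w) \<longleftrightarrow> ((\<lambda>z. (z - p) * E (z + w)) \<longlongrightarrow> 0) (at p)"
      unfolding L_def by (subst at_to_0, subst (2) at_to_0) (simp add: filterlim_filtermap add_ac)
    also have "\<dots> \<longleftrightarrow> ((\<lambda>z. u * ((z - p) * E z) + (z - p) * c) \<longlongrightarrow> 0) (at p)"
      by (intro filterlim_cong refl eventually_mono[OF sparse[of p]]) (simp add: w algebra_simps)
    also have "\<dots> \<longleftrightarrow> L p"
    proof -
      have z: "((\<lambda>z. (z - p) * c) \<longlongrightarrow> 0) (at p)" by (auto intro!: tendsto_eq_intros)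
      have uu: "u * (u * x) = x" for x using u by auto
      show ?thesis unfolding L_def
      proof
        assume "((\<lambda>z. u * ((z - p) * E z) + (z - p) * c) \<longlongrightarrow> 0) (at p)"
        from tendsto_mult[OF tendsto_const[of u] tendsto_diff[OF this z]]
        show "((\<lambda>z. (z - p) * E z) \<longlongrightarrow> 0) (at p)" by (simp add: uu)
      next
        assume "((\<lambda>z. (z - p) * E z) \<longlongrightarrow> 0) (at p)"
        from tendsto_add[OF tendsto_mult[OF tendsto_const[of u] this] z]
        show "((\<lambda>z. u * ((z - p) * E z) + (z - p) * c) \<longlongrightarrow> 0) (at p)" by simp
      qed
    qed
    finally show ?thesis .
  qed
  have s1: "L (p + 1) \<longleftrightarrow> L p" for p by (rule shift[of 1 s 0]) (use per st in auto)
  have s2: "L (p + \<tau>) \<longleftrightarrow> L p" for p by (rule shift[of \<tau> t \<kappa>]) (use per st in auto)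
  have int: "L (p + of_int k * w) \<longleftrightarrow> L p" if "\<And>p. L (p + w) \<longleftrightarrow> L p" for p w k
  proof (induction k rule: int_induct[of _ 0])
    case (step1 i)
    then show ?case using that[of "p + of_int i * w"] by (simp add: algebra_simps)
  next
    case (step2 i)
    then show ?case using that[of "p + of_int (i - 1) * w"] by (simp add: algebra_simps)
  qed simp
  have "L q" if "q \<in> D" for q
  proof -
    from that obtain p m n where "p \<in> S" "q - p = of_int m * \<tau> + of_int n"
      unfolding D by (auto simp: lat_def)
    then have "q = (p + of_int n * 1) + of_int m * \<tau>" by (simp add: algebra_simps)
    then have "L q \<longleftrightarrow> L p" by (simp only: int[OF s1] int[OF s2])
    then show ?thesis using lim[OF \<open>p \<in> S\<close>] by (simp add: L_def)
  qed
  then show ?thesis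
    using quasi_elliptic_constant[where E = E and D = D and s = s and t = t and \<kappa> = \<kappa>,
        OF \<tau> st sparse inv hol per] that unfolding L_def by blast
qed

subsection \<open>The functions \<open>f\<close> and their constants \<open>C\<close>\<close>

context
  fixes \<tau> :: complex
  assumes tau: "Im \<tau> > 0"
begin

lemma theta_plus_1:
  "theta1 (z + 1) \<tau> = - theta1 z \<tau>" "theta2 (z + 1) \<tau> = - theta2 z \<tau>"
  "theta3 (z + 1) \<tau> = theta3 z \<tau>" "theta4 (z + 1) \<tau> = theta4 z \<tau>"
proof -
  have e: "exp (of_real pi * \<i> * (\<tau> / 4 + (z + 1))) = - exp (of_real pi * \<i> * (\<tau> / 4 + z))"
    by (simp add: distrib_left exp_add)
  show "theta1 (z + 1) \<tau> = - theta1 z \<tau>"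
    unfolding theta1_eq_jsigma[OF tau] e jsigma_plus_1 by simp
  show "theta2 (z + 1) \<tau> = - theta2 z \<tau>"
    unfolding theta2_eq_jtheta[OF tau] e using jtheta_plus_1[of \<tau> "z + \<tau> / 2"] by (simp add: add_ac)
  show "theta3 (z + 1) \<tau> = theta3 z \<tau>"
    unfolding theta3_eq_jtheta[OF tau] by (rule jtheta_plus_1)
  show "theta4 (z + 1) \<tau> = theta4 z \<tau>"
    unfolding theta4_eq_jtheta[OF tau] using jtheta_plus_1[of \<tau> "z + 1 / 2"] by (simp add: add_ac)
qed

text \<open>All four functions share the factor \<open>M z\<close> and differ only in sign, so
  quotients of theta functions retain just a sign under translation by \<tau>.\<close>

lemma theta_plus_tau:
  defines "M z \<equiv> exp (- (of_real pi * \<i> * (\<tau> + 2 * z)))"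
  shows "theta1 (z + \<tau>) \<tau> = - M z * theta1 z \<tau>" "theta2 (z + \<tau>) \<tau> = M z * theta2 z \<tau>"
    "theta3 (z + \<tau>) \<tau> = M z * theta3 z \<tau>" "theta4 (z + \<tau>) \<tau> = - M z * theta4 z \<tau>"
proof -
  have e1: "exp (of_real pi * \<i> * (\<tau> / 4 + (z + \<tau>))) * exp (- 2 * of_real pi * \<i> * (\<tau> + z)) =
      M z * exp (of_real pi * \<i> * (\<tau> / 4 + z))"
    unfolding M_def exp_add[symmetric] by (simp add: algebra_simps)
  show "theta1 (z + \<tau>) \<tau> = - M z * theta1 z \<tau>"
    unfolding theta1_eq_jsigma[OF tau] jsigma_plus_tau using e1 by (simp add: algebra_simps)
  have e2: "exp (of_real pi * \<i> * (\<tau> / 4 + (z + \<tau>))) * exp (- (of_real pi * \<i> * (\<tau> + 2 * (z + \<tau> / 2)))) =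
      M z * exp (of_real pi * \<i> * (\<tau> / 4 + z))"
    unfolding M_def exp_add[symmetric] by (simp add: algebra_simps)
  have "theta2 (z + \<tau>) \<tau> = exp (of_real pi * \<i> * (\<tau> / 4 + (z + \<tau>))) * jtheta \<tau> ((z + \<tau> / 2) + \<tau>)"
    unfolding theta2_eq_jtheta[OF tau] by (simp add: add_ac)
  also have "\<dots> = M z * theta2 z \<tau>"
    unfolding theta2_eq_jtheta[OF tau] jtheta_plus_tau mult.assoc[symmetric] e2 by simp
  finally show "theta2 (z + \<tau>) \<tau> = M z * theta2 z \<tau>" .
  show "theta3 (z + \<tau>) \<tau> = M z * theta3 z \<tau>"
    unfolding theta3_eq_jtheta[OF tau] jtheta_plus_tau M_def ..
  have "- (of_real pi * \<i> * (\<tau> + 2 * (z + 1/2))) = - (of_real pi * \<i> * (\<tau> + 2 * z)) + - (of_real pi * \<i>)"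
    by (simp add: algebra_simps)
  then have e4: "exp (- (of_real pi * \<i> * (\<tau> + 2 * (z + 1/2)))) = - M z"
    unfolding M_def by (simp only: exp_add) (simp add: exp_minus)
  have "theta4 (z + \<tau>) \<tau> = jtheta \<tau> ((z + 1/2) + \<tau>)"
    unfolding theta4_eq_jtheta[OF tau] by (simp add: add_ac)
  also have "\<dots> = - M z * theta4 z \<tau>"
    unfolding theta4_eq_jtheta[OF tau] jtheta_plus_tau e4 ..
  finally show "theta4 (z + \<tau>) \<tau> = - M z * theta4 z \<tau>" .
qed

lemma theta_minus:
  "theta1 (- z) \<tau> = - theta1 z \<tau>" "theta2 (- z) \<tau> = theta2 z \<tau>"
  "theta3 (- z) \<tau> = theta3 z \<tau>" "theta4 (- z) \<tau> = theta4 z \<tau>"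
proof -
  have e1: "exp (of_real pi * \<i> * (\<tau> / 4 + - z)) * exp (2 * of_real pi * \<i> * z) = exp (of_real pi * \<i> * (\<tau> / 4 + z))"
    unfolding exp_add[symmetric] by (simp add: algebra_simps)
  show "theta1 (- z) \<tau> = - theta1 z \<tau>"
    unfolding theta1_eq_jsigma[OF tau] jsigma_minus using e1 by (simp add: algebra_simps)
  have e2: "exp (of_real pi * \<i> * (\<tau> / 4 + z)) * exp (- (of_real pi * \<i> * (\<tau> + 2 * (z + - \<tau> / 2)))) = exp (of_real pi * \<i> * (\<tau> / 4 + - z))"
    unfolding exp_add[symmetric] by (simp add: algebra_simps)
  have "theta2 z \<tau> = exp (of_real pi * \<i> * (\<tau> / 4 + z)) * jtheta \<tau> ((z + - \<tau> / 2) + \<tau>)"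
    unfolding theta2_eq_jtheta[OF tau] by (simp add: algebra_simps)
  also have "\<dots> = exp (of_real pi * \<i> * (\<tau> / 4 + - z)) * jtheta \<tau> (- (- z + \<tau> / 2))"
    unfolding jtheta_plus_tau mult.assoc[symmetric] e2 by simp
  also have "\<dots> = theta2 (- z) \<tau>"
    unfolding theta2_eq_jtheta[OF tau] jtheta_minus ..
  finally show "theta2 (- z) \<tau> = theta2 z \<tau>" ..
  show "theta3 (- z) \<tau> = theta3 z \<tau>"
    unfolding theta3_eq_jtheta[OF tau] jtheta_minus ..
  show "theta4 (- z) \<tau> = theta4 z \<tau>"
    unfolding theta4_eq_jtheta[OF tau] using jtheta_minus[of \<tau> "- z + 1/2"] jtheta_plus_1[of \<tau> "z - 1/2"]
    by (simp add: algebra_simps)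
qed

lemma theta1_eq_0_iff: "theta1 z \<tau> = 0 \<longleftrightarrow> z \<in> lat \<tau>"
  unfolding theta1_eq_jsigma[OF tau] using jsigma_eq_0_iff[OF tau] by simp

lemma theta_null_nonzero: "theta2 0 \<tau> \<noteq> 0" "theta3 0 \<tau> \<noteq> 0" "theta4 0 \<tau> \<noteq> 0"
  using jtheta_null_nonzero[OF tau] by (simp_all add: theta2_eq_jtheta theta3_eq_jtheta theta4_eq_jtheta tau)

lemma theta_holomorphic:
  "(\<lambda>z. theta1 z \<tau>) holomorphic_on A" "(\<lambda>z. theta2 z \<tau>) holomorphic_on A"
  "(\<lambda>z. theta3 z \<tau>) holomorphic_on A" "(\<lambda>z. theta4 z \<tau>) holomorphic_on A"
  unfolding theta1_eq_jsigma[OF tau] theta2_eq_jtheta[OF tau] theta3_eq_jtheta[OF tau] theta4_eq_jtheta[OF tau]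
  by (intro holomorphic_intros tau; simp)+

text \<open>Jacobi's formula in the classical normalisation: the exponential in front of
  \<open>jsigma\<close> becomes that of \<open>theta2\<close>, and its own derivative is multiplied
  by \<open>jsigma \<tau> 0 = 0\<close>.\<close>

lemma theta1_deriv_0:
  "((\<lambda>z. theta1 z \<tau>) has_field_derivative of_real pi * theta2 0 \<tau> * theta3 0 \<tau> * theta4 0 \<tau>) (at 0)"
proof -
  have "((\<lambda>z. - \<i> * exp (of_real pi * \<i> * (\<tau> / 4 + z)) * jsigma \<tau> z) has_field_derivative
     (- \<i> * (exp (of_real pi * \<i> * (\<tau> / 4 + 0)) * (of_real pi * \<i> * (0 + 1)))) * jsigma \<tau> 0 +
      deriv (jsigma \<tau>) 0 * (- \<i> * exp (of_real pi * \<i> * (\<tau> / 4 + 0)))) (at 0)"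
    by (intro DERIV_mult DERIV_cmult DERIV_chain2[OF DERIV_exp] DERIV_add DERIV_const DERIV_ident
        field_differentiable_derivI field_differentiable_jsigma tau)
  then show ?thesis
    unfolding theta1_eq_jsigma[OF tau] theta2_eq_jtheta[OF tau] theta3_eq_jtheta[OF tau] theta4_eq_jtheta[OF tau] jsigma_deriv_0[OF tau]
    by (simp add: mult_ac)
qed

text \<open>The points 1/2 and \<open>(1 + \<tau>) / 2\<close> are zeros of the numerators of
  \<open>f_10\<close> and \<open>f_11\<close>. The values of \<open>theta1\<close> and
  \<open>theta4\<close> there determine \<open>f_01\<close>; the exponential at the second point
  cancels in their quotient.\<close>

lemma theta_half_periods:
  "theta1 (1/2) \<tau> = theta2 0 \<tau>" "theta2 (1/2) \<tau> = 0" "theta4 (1/2) \<tau> = theta3 0 \<tau>"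
  "theta3 ((1 + \<tau>) / 2) \<tau> = 0"
  "theta1 ((1 + \<tau>) / 2) \<tau> = exp (- (of_real pi * \<i> * \<tau> / 4)) * theta3 0 \<tau>"
  "theta4 ((1 + \<tau>) / 2) \<tau> = exp (- (of_real pi * \<i> * \<tau> / 4)) * theta2 0 \<tau>"
proof -
  have exp_pi_i_half: "exp (of_real pi * \<i> / 2) = \<i>"
    using cis_pi_half by (simp add: cis_conv_exp mult_ac)
  have ex: "exp (of_real pi * \<i> * (\<tau> / 4 + 1/2)) = \<i> * exp (of_real pi * \<i> * (\<tau> / 4 + 0))"
    using exp_pi_i_half by (simp add: distrib_left exp_add)
  show "theta1 (1/2) \<tau> = theta2 0 \<tau>"
    unfolding theta1_eq_jsigma[OF tau] theta2_eq_jtheta[OF tau] ex jsigma_def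
    using jtheta_plus_1[of \<tau> "\<tau> / 2"] by (simp add: add_divide_distrib add_ac)
  show "theta2 (1/2) \<tau> = 0"
    unfolding theta2_eq_jtheta[OF tau] using jtheta_zero[of \<tau>] by (simp add: add_divide_distrib)
  show "theta4 (1/2) \<tau> = theta3 0 \<tau>"
    unfolding theta4_eq_jtheta[OF tau] theta3_eq_jtheta[OF tau] using jtheta_plus_1[of \<tau> 0] by simp
  show "theta3 ((1 + \<tau>) / 2) \<tau> = 0"
    unfolding theta3_eq_jtheta[OF tau] by (rule jtheta_zero)
  have "jtheta \<tau> (1 + \<tau>) = exp (- (of_real pi * \<i> * \<tau>)) * jtheta \<tau> 0"
    using jtheta_plus_tau[of \<tau> "0 + 1"] jtheta_plus_1[of \<tau> 0] jtheta_plus_1[of \<tau> \<tau>] jtheta_plus_tau[of \<tau> 0]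
    by (simp add: add_ac)
  then have "theta1 ((1 + \<tau>) / 2) \<tau> =
     (- \<i> * exp (of_real pi * \<i> * (\<tau> / 4 + (1 + \<tau>) / 2)) * exp (- (of_real pi * \<i> * \<tau>))) * jtheta \<tau> 0"
    unfolding theta1_eq_jsigma[OF tau] jsigma_def by simp
  also have "exp (of_real pi * \<i> * (\<tau> / 4 + (1 + \<tau>) / 2)) = \<i> * exp (of_real pi * \<i> * \<tau> * 3 / 4)"
  proof -
    have "of_real pi * \<i> * (\<tau> / 4 + (1 + \<tau>) / 2) = of_real pi * \<i> / 2 + of_real pi * \<i> * \<tau> * 3 / 4"
      by (simp add: field_simps)
    then show ?thesis by (simp only: exp_add exp_pi_i_half)
  qed
  also have "- \<i> * (\<i> * exp (of_real pi * \<i> * \<tau> * 3 / 4)) * exp (- (of_real pi * \<i> * \<tau>)) =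
      exp (of_real pi * \<i> * \<tau> * 3 / 4) * exp (- (of_real pi * \<i> * \<tau>))" by simp
  also have "\<dots> = exp (- (of_real pi * \<i> * \<tau> / 4))"
    unfolding exp_add[symmetric] by (rule arg_cong[of _ _ exp]) (simp add: field_simps)
  finally show "theta1 ((1 + \<tau>) / 2) \<tau> = exp (- (of_real pi * \<i> * \<tau> / 4)) * theta3 0 \<tau>"
    by (simp add: theta3_eq_jtheta tau)
  have "theta4 ((1 + \<tau>) / 2) \<tau> = jtheta \<tau> (\<tau> / 2)"
    unfolding theta4_eq_jtheta[OF tau] using jtheta_plus_1[of \<tau> "\<tau> / 2"] by (simp add: add_divide_distrib add_ac)
  then show "theta4 ((1 + \<tau>) / 2) \<tau> = exp (- (of_real pi * \<i> * \<tau> / 4)) * theta2 0 \<tau>"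
    unfolding theta2_eq_jtheta[OF tau] mult.assoc[symmetric] exp_add[symmetric] by simp
qed

end

text \<open>The numerators of cs, ds and ns over \<open>theta1\<close>, once the common denominator
  \<open>theta4\<close> has cancelled. For two even indices the value \<open>theta2\<close> is a
  default without meaning.\<close>

definition theta_num :: "nat \<Rightarrow> nat \<Rightarrow> complex \<Rightarrow> complex \<Rightarrow> complex" where
  "theta_num i j z \<tau> = (if even j then theta2 z \<tau> else if odd i then theta3 z \<tau> else theta4 z \<tau>)"

text \<open>\<open>phi i j \<tau>\<close> is the function \<open>f i j\<close> of the paper in terms of theta functions.\<close>

definition phi :: "nat \<Rightarrow> nat \<Rightarrow> complex \<Rightarrow> complex \<Rightarrow> complex" where
  "phi i j \<tau> z = of_real pi * theta2 0 \<tau> * theta3 0 \<tau> * theta4 0 \<tau> / theta_num i j 0 \<tau> * (theta_num i j z \<tau> / theta1 z \<tau>)"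

context
  fixes \<tau> :: complex
  assumes tau: "Im \<tau> > 0"
begin

lemma theta_num_holomorphic: "(\<lambda>z. theta_num i j z \<tau>) holomorphic_on A"
  by (cases "even j"; cases "odd i") (simp_all add: theta_num_def theta_holomorphic[OF tau])

lemma theta_num_0: "theta_num i j 0 \<tau> \<noteq> 0"
  unfolding theta_num_def using theta_null_nonzero[OF tau] by simp

lemma phi_plus_1:
  assumes "odd i \<or> odd j"
  shows "phi i j \<tau> (z + 1) = (-1) ^ j * phi i j \<tau> z"
  unfolding phi_def theta_num_def theta_plus_1[OF tau] by auto

lemma phi_plus_tau:
  assumes "odd i \<or> odd j"
  shows "phi i j \<tau> (z + \<tau>) = (-1) ^ i * phi i j \<tau> z"
  unfolding phi_def theta_num_def theta_plus_tau[OF tau] using assms by auto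

lemma phi_holomorphic: "phi i j \<tau> holomorphic_on - lat \<tau>"
  unfolding phi_def[abs_def]
  by (intro holomorphic_intros theta_num_holomorphic theta_holomorphic[OF tau])
     (auto simp: theta_num_0 theta1_eq_0_iff[OF tau])

lemma lat_closed: "closed (lat \<tau>)"
proof -
  have "\<not> z islimpt lat \<tau>" for z
    using lat_sparse[OF tau, of 0 z] by (simp add: islimpt_iff_eventually)
  then show ?thesis by (simp add: closed_limpt)
qed

lemma phi_analytic: "z \<notin> lat \<tau> \<Longrightarrow> phi i j \<tau> analytic_on {z}"
  using phi_holomorphic lat_closed by (auto simp: analytic_at open_Compl)

text \<open>The quotients of sn, cn and dn agree with \<open>phi\<close> wherever
  \<open>theta4\<close> is nonzero. Its zeros are isolated, because \<open>theta4\<close> does not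
  vanish at 0, and \<open>phi\<close> is analytic off the lattice; so \<open>remove_sings\<close>
  returns the value of \<open>phi\<close> at the zeros of \<open>theta4\<close> as well.\<close>

lemma f_fun_eq_phi:
  assumes "odd i \<or> odd j" "z \<notin> lat \<tau>"
  shows "f_fun i j z \<tau> = phi i j \<tau> z"
proof -
  have "\<forall>\<^sub>F w in at z. theta4 w \<tau> \<noteq> 0 \<and> w \<in> UNIV"
    by (rule non_zero_neighbour_alt[of _ _ _ 0]) (auto simp: theta_holomorphic[OF tau] theta_null_nonzero[OF tau])
  then have ev: "\<forall>\<^sub>F w in at z. theta4 w \<tau> \<noteq> 0" by simp
  define c where "c = 2 * period_K \<tau>"
  have c0: "c \<noteq> 0" unfolding c_def period_K_def using theta_null_nonzero[OF tau] by simp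
  have *: "c * remove_sings g z = phi i j \<tau> z"
    if "\<And>w. theta4 w \<tau> \<noteq> 0 \<Longrightarrow> c * g w = phi i j \<tau> w" for g
  proof -
    have "remove_sings g z = remove_sings (\<lambda>w. phi i j \<tau> w / c) z"
      by (rule remove_sings_cong[OF eventually_mono[OF ev] refl]) (use that c0 in \<open>simp add: field_simps\<close>)
    also have "\<dots> = phi i j \<tau> z / c"
      by (rule remove_sings_at_analytic) (intro analytic_intros phi_analytic assms, use c0 in auto)
    finally show ?thesis using c0 by simp
  qed
  note nz = theta_null_nonzero[OF tau]
  show ?thesis
    using assms(1) nz unfolding f_fun_def c_def[symmetric] cs2K_def ds2K_def ns2K_def
    by (cases "odd i"; cases "odd j"; simp; intro *;
        simp add: c_def period_K_def sn2K_def cn2K_def dn2K_def phi_def theta_num_def power2_eq_square divide_simps)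
qed

lemma holomorphic_factor_out_zero:
  assumes "f holomorphic_on ball 0 r" "f 0 = 0" "r > 0"
  obtains g where "g holomorphic_on ball 0 r" "g 0 = deriv f 0" "\<And>z. z \<in> ball 0 r \<Longrightarrow> f z = z * g z"
proof (rule that)
  let ?g = "\<lambda>z. if z = 0 then deriv f 0 else f z / z"
  show "?g holomorphic_on ball 0 r"
    by (rule pole_theorem_open_0[where g = f and a = 0]) (use assms in auto)
  show "f z = z * ?g z" if "z \<in> ball 0 r" for z
    using assms(2) by simp
qed simp

lemma even_deriv_0:
  fixes f :: "complex \<Rightarrow> complex"
  assumes "f holomorphic_on ball 0 r" "r > 0" "\<And>z. z \<in> ball 0 r \<Longrightarrow> f (- z) = f z"
  shows "deriv f 0 = 0"
proof -
  have d: "(f has_field_derivative deriv f 0) (at 0)"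
    using assms(1,2) by (intro holomorphic_derivI[of f "ball 0 r"]) auto
  have "((\<lambda>z. f (- z)) has_field_derivative deriv f 0 * (- 1)) (at 0)"
    by (rule DERIV_chain2[of f _ uminus]) (use d in \<open>auto intro!: derivative_eq_intros\<close>)
  moreover have "\<forall>\<^sub>F z in nhds 0. f (- z) = f z"
    by (rule eventually_mono[OF eventually_nhds_in_open[of "ball 0 r" 0]]) (use assms(2,3) in auto)
  ultimately have "(f has_field_derivative - deriv f 0) (at 0)"
    by (subst DERIV_cong_ev[OF refl _ refl, where g = "\<lambda>z. f (- z)"]) (auto elim: eventually_mono)
  with d have "deriv f 0 = - deriv f 0" by (rule DERIV_unique)
  then show ?thesis by simp
qed

text \<open>The numerator and \<open>\<lambda>z. theta1 z \<tau> / z\<close> are even, hence the quotient is \<open>1 + z\<^sup>2 v(z)\<close>.\<close>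

lemma phi_expansion:
  obtains v :: "complex \<Rightarrow> complex" and r where "r > 0" "v holomorphic_on ball 0 r"
    "\<And>z. z \<in> ball 0 r - {0} \<Longrightarrow> phi i j \<tau> z = (1 + z ^ 2 * v z) / z"
proof -
  define d where "d = of_real pi * theta2 0 \<tau> * theta3 0 \<tau> * theta4 0 \<tau>"
  have d0: "d \<noteq> 0" unfolding d_def using theta_null_nonzero[OF tau] by simp
  have dt: "deriv (\<lambda>z. theta1 z \<tau>) 0 = d"
    unfolding d_def using theta1_deriv_0[OF tau] by (rule DERIV_imp_deriv)
  have t10: "theta1 0 \<tau> = 0" by (simp add: theta1_eq_0_iff[OF tau])
  obtain T where T: "T holomorphic_on ball 0 1" "T 0 = d" "\<And>z. z \<in> ball 0 1 \<Longrightarrow> theta1 z \<tau> = z * T z"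
    by (rule holomorphic_factor_out_zero[OF theta_holomorphic(1)[OF tau, of "ball 0 1"]]) (use t10 dt in auto)
  have "\<forall>\<^sub>F z in nhds 0. T z \<noteq> 0 \<and> z \<in> ball 0 1"
  proof (intro eventually_conj)
    have "isCont T 0"
      using T(1) by (meson centre_in_ball continuous_on_eq_continuous_at holomorphic_on_imp_continuous_on open_ball zero_less_one)
    then show "\<forall>\<^sub>F z in nhds 0. T z \<noteq> 0"
      using T(2) d0 by (intro tendsto_imp_eventually_ne[where c = d]) (auto simp: continuous_within isCont_def tendsto_at_iff_tendsto_nhds)
    show "\<forall>\<^sub>F z :: complex in nhds 0. z \<in> ball 0 1" by (intro eventually_nhds_in_open) auto
  qed
  then obtain r where r: "r > 0" "\<And>z. z \<in> ball 0 r \<Longrightarrow> T z \<noteq> 0 \<and> z \<in> ball 0 1"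
    by (auto simp: eventually_nhds_metric dist_commute)
  have sub: "ball 0 r \<subseteq> (ball 0 1 :: complex set)" using r(2) by blast
  \<comment> \<open>This is \<open>z * phi i j \<tau> z - 1\<close> near 0. It vanishes at 0 because
    Jacobi's formula gives \<open>T 0 = d\<close>; as it is even, the zero is at least double, and
    two factors \<open>z\<close> can be taken out.\<close>
  define u where "u = (\<lambda>z. d / theta_num i j 0 \<tau> * (theta_num i j z \<tau> / T z) - 1)"
  have u: "u holomorphic_on ball 0 r"
    unfolding u_def using r(2)
    by (intro holomorphic_intros theta_num_holomorphic holomorphic_on_subset[OF T(1) sub]) (auto simp: theta_num_0)
  have u0: "u 0 = 0" unfolding u_def using T(2) d0 theta_num_0 by simp
  have even: "u (- z) = u z" if z: "z \<in> ball 0 r" for z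
  proof (cases "z = 0")
    case False
    have "z * T z = (- z) * - T (- z)"
      using T(3)[of z] T(3)[of "- z"] theta_minus(1)[OF tau, of z] r(2)[OF z] by simp
    then have "T (- z) = T z" using False by simp
    moreover have "theta_num i j (- z) \<tau> = theta_num i j z \<tau>"
      unfolding theta_num_def theta_minus[OF tau] ..
    ultimately show ?thesis by (simp add: u_def)
  qed simp
  obtain u1 where u1: "u1 holomorphic_on ball 0 r" "u1 0 = deriv u 0" "\<And>z. z \<in> ball 0 r \<Longrightarrow> u z = z * u1 z"
    using holomorphic_factor_out_zero[OF u u0 r(1)] by blast
  have u10: "u1 0 = 0" unfolding u1(2) by (rule even_deriv_0[OF u r(1) even])
  obtain v where v: "v holomorphic_on ball 0 r" "\<And>z. z \<in> ball 0 r \<Longrightarrow> u1 z = z * v z"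
    using holomorphic_factor_out_zero[OF u1(1) u10 r(1)] by blast
  show ?thesis
  proof (rule that[OF r(1) v(1)])
    fix z :: complex assume z: "z \<in> ball 0 r - {0}"
    then have "phi i j \<tau> z = (1 + u z) / z"
      using T(3)[of z] r(2)[of z] by (simp add: phi_def u_def d_def)
    then show "phi i j \<tau> z = (1 + z ^ 2 * v z) / z"
      using u1(3)[of z] v(2)[of z] z by (simp add: power2_eq_square mult.assoc)
  qed
qed

lemma deriv_phi_shift:
  assumes "\<And>z. phi i j \<tau> (z + w) = s * phi i j \<tau> z" "z \<notin> lat \<tau>" "z + w \<notin> lat \<tau>"
  shows "deriv (phi i j \<tau>) (z + w) = s * deriv (phi i j \<tau>) z"
proof -
  have d: "(phi i j \<tau> has_field_derivative deriv (phi i j \<tau>) x) (at x)" if "x \<notin> lat \<tau>" for x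
    by (rule holomorphic_derivI[OF phi_holomorphic open_Compl[OF lat_closed]]) (use that in simp)
  have "((\<lambda>z. phi i j \<tau> (z + w)) has_field_derivative deriv (phi i j \<tau>) (z + w)) (at z)"
    unfolding DERIV_shift[symmetric] by (rule d[OF assms(3)])
  moreover have "((\<lambda>z. phi i j \<tau> (z + w)) has_field_derivative s * deriv (phi i j \<tau>) z) (at z)"
    unfolding assms(1) by (rule DERIV_cmult[OF d[OF assms(2)]])
  ultimately show ?thesis by (rule DERIV_unique)
qed

text \<open>A finite limit at 0 excludes poles at all lattice points, so the constant is that limit.
  If one of the signs is -1, the last two equations show that the limit is 0.\<close>

lemma bounded_elliptic_constant:
  assumes "s \<in> {1, -1}" "t \<in> {1, -1}" "E holomorphic_on - lat \<tau>"
    and "\<And>z. z \<notin> lat \<tau> \<Longrightarrow> E (z + 1) = s * E z" "\<And>z. z \<notin> lat \<tau> \<Longrightarrow> E (z + \<tau>) = t * E z"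
    and "E \<midarrow>0\<rightarrow> l"
  shows "\<And>z. z \<notin> lat \<tau> \<Longrightarrow> E z = l" "l = s * l" "l = t * l"
proof -
  have "((\<lambda>z. (z - 0) * E z) \<longlongrightarrow> (0 - 0) * l) (at 0)"
    by (intro tendsto_intros assms)
  then have lim: "((\<lambda>z. (z - p) * E z) \<longlongrightarrow> 0) (at p)" if "p \<in> {0}" for p using that by simp
  have per: "E (z + \<tau>) = t * E z + 0" if "z \<notin> lat \<tau>" for z using assms(5)[OF that] by simp
  obtain c where c: "\<And>z. z \<notin> lat \<tau> \<Longrightarrow> E z = c" "c = s * c" "c = t * c + 0"
    by (rule quasi_elliptic_constant_lat[where E = E and s = s and t = t and \<kappa> = 0 and S = "{0}" and D = "lat \<tau>",
          OF tau assms(1,2) _ _ assms(3,4) per lim]) auto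
  have "\<forall>\<^sub>F z in at 0. E z = c"
    using lat_sparse[OF tau, of 0 0] by (auto elim!: eventually_mono intro: c(1))
  then have "E \<midarrow>0\<rightarrow> c" by (rule tendsto_eventually)
  then have "l = c" using assms(6) LIM_unique by blast
  with c show "\<And>z. z \<notin> lat \<tau> \<Longrightarrow> E z = l" "l = s * l" "l = t * l" by auto
qed

text \<open>The function \<open>f10' + f11 f01\<close> has no poles but a nontrivial multiplier, so it vanishes, which gives
  \<open>C10 + C11 + C01 = 0\<close>. The differences of the constants come from the constant functions \<open>f10\<^sup>2 - f01\<^sup>2\<close> and
  \<open>f11\<^sup>2 - f01\<^sup>2\<close>, evaluated at zeros of \<open>f10\<close> and \<open>f11\<close>.\<close>

lemma phi_constants:
  fixes v10 v11 v01 :: "complex \<Rightarrow> complex"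
  assumes r: "r > 0"
    and v: "v10 holomorphic_on ball 0 r" "v11 holomorphic_on ball 0 r" "v01 holomorphic_on ball 0 r"
    and e10: "\<And>z. z \<in> ball 0 r - {0} \<Longrightarrow> phi 1 0 \<tau> z = (1 + z ^ 2 * v10 z) / z"
    and e11: "\<And>z. z \<in> ball 0 r - {0} \<Longrightarrow> phi 1 1 \<tau> z = (1 + z ^ 2 * v11 z) / z"
    and e01: "\<And>z. z \<in> ball 0 r - {0} \<Longrightarrow> phi 0 1 \<tau> z = (1 + z ^ 2 * v01 z) / z"
  shows "v10 0 = C_fun 1 0 \<tau>" "v11 0 = C_fun 1 1 \<tau>" "v01 0 = C_fun 0 1 \<tau>"
proof -
  have lim: "f \<midarrow>0\<rightarrow> f 0" if "f holomorphic_on ball 0 r" for f :: "complex \<Rightarrow> complex"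
    using that r by (metis centre_in_ball continuous_on_eq_continuous_at holomorphic_on_imp_continuous_on isCont_def open_ball)
  have near: "\<forall>\<^sub>F z :: complex in at 0. z \<in> ball 0 r - {0}"
    using r by (intro eventually_at_in_open) auto
  note lims = lim[OF v(1)] lim[OF v(2)] lim[OF v(3)]
  \<comment> \<open>The derivative contributes \<open>- 1 / z^2\<close> and the product
    \<open>1 / z^2\<close>, so the poles cancel and the sum of the three coefficients is left. Both
    summands have multiplier 1 under translation by 1 and -1 under \<tau>.\<close>
  have "(\<lambda>z. deriv (phi 1 0 \<tau>) z + phi 1 1 \<tau> z * phi 0 1 \<tau> z) \<midarrow>0\<rightarrow> v10 0 + v11 0 + v01 0"
  proof (rule Lim_transform_eventually)
    have "(\<lambda>z. v10 z + z * deriv v10 z + v11 z + v01 z + z ^ 2 * (v11 z * v01 z)) \<midarrow>0\<rightarrow>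
        v10 0 + 0 * deriv v10 0 + v11 0 + v01 0 + 0 ^ 2 * (v11 0 * v01 0)"
      by (intro tendsto_intros lims lim holomorphic_deriv v open_ball)
    then show "(\<lambda>z. v10 z + z * deriv v10 z + v11 z + v01 z + z ^ 2 * (v11 z * v01 z)) \<midarrow>0\<rightarrow> v10 0 + v11 0 + v01 0"
      by simp
    show "\<forall>\<^sub>F z in at 0. v10 z + z * deriv v10 z + v11 z + v01 z + z ^ 2 * (v11 z * v01 z) =
        deriv (phi 1 0 \<tau>) z + phi 1 1 \<tau> z * phi 0 1 \<tau> z"
      using near
    proof eventually_elim
      case (elim z)
      then have z: "z \<noteq> 0" "z \<in> ball 0 r" by auto
      have "((\<lambda>z. inverse z + z * v10 z) has_field_derivative - (inverse z ^ Suc (Suc 0)) + (1 * v10 z + deriv v10 z * z)) (at z)"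
        by (intro DERIV_add DERIV_inverse DERIV_mult DERIV_ident holomorphic_derivI[OF v(1) open_ball] z)
      then have "(phi 1 0 \<tau> has_field_derivative - (inverse z ^ Suc (Suc 0)) + (1 * v10 z + deriv v10 z * z)) (at z)"
        by (rule has_field_derivative_transform_within_open[where S = "ball 0 r - {0}"])
           (use elim in \<open>auto simp: e10[unfolded One_nat_def] field_simps power2_eq_square open_delete\<close>)
      then have "deriv (phi 1 0 \<tau>) z = - (inverse z ^ Suc (Suc 0)) + (1 * v10 z + deriv v10 z * z)"
        by (rule DERIV_imp_deriv)
      then show ?case
        using z(1) unfolding e11[OF elim] e01[OF elim] by (simp add: field_simps power2_eq_square)
    qed
  qed
  then have "v10 0 + v11 0 + v01 0 = - 1 * (v10 0 + v11 0 + v01 0)"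
  proof (rule bounded_elliptic_constant(3)[rotated 5])
    show "(\<lambda>z. deriv (phi 1 0 \<tau>) z + phi 1 1 \<tau> z * phi 0 1 \<tau> z) holomorphic_on - lat \<tau>"
      by (intro holomorphic_intros phi_holomorphic open_Compl lat_closed)
    show "deriv (phi 1 0 \<tau>) (z + 1) + phi 1 1 \<tau> (z + 1) * phi 0 1 \<tau> (z + 1) =
        1 * (deriv (phi 1 0 \<tau>) z + phi 1 1 \<tau> z * phi 0 1 \<tau> z)" if "z \<notin> lat \<tau>" for z
      using deriv_phi_shift[of 1 0 1 1 z] phi_plus_1[of 1 0] that by (simp add: phi_plus_1)
    show "deriv (phi 1 0 \<tau>) (z + \<tau>) + phi 1 1 \<tau> (z + \<tau>) * phi 0 1 \<tau> (z + \<tau>) =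
        - 1 * (deriv (phi 1 0 \<tau>) z + phi 1 1 \<tau> z * phi 0 1 \<tau> z)" if "z \<notin> lat \<tau>" for z
      using deriv_phi_shift[of 1 0 \<tau> "- 1" z] phi_plus_tau[of 1 0] that by (simp add: phi_plus_tau)
  qed auto
  moreover have "x = 0" if "x = - 1 * x" for x :: complex
  proof -
    have "x + x = 0" using that by (metis add.right_inverse mult_minus1)
    then show ?thesis by (simp flip: mult_2)
  qed
  ultimately have sum: "v10 0 + v11 0 + v01 0 = 0" by blast
  have diff: "phi i j \<tau> z ^ 2 - phi 0 1 \<tau> z ^ 2 = 2 * (w 0 - v01 0)"
    if w: "w holomorphic_on ball 0 r" "\<And>z. z \<in> ball 0 r - {0} \<Longrightarrow> phi i j \<tau> z = (1 + z ^ 2 * w z) / z"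
      and ij: "odd i \<or> odd j" and z: "z \<notin> lat \<tau>" for i j w z
  proof (rule bounded_elliptic_constant(1)[where s = 1 and t = 1, OF _ _ _ _ _ _ z])
    show "(\<lambda>z. phi i j \<tau> z ^ 2 - phi 0 1 \<tau> z ^ 2) holomorphic_on - lat \<tau>"
      by (intro holomorphic_intros phi_holomorphic)
    show "phi i j \<tau> (z + 1) ^ 2 - phi 0 1 \<tau> (z + 1) ^ 2 = 1 * (phi i j \<tau> z ^ 2 - phi 0 1 \<tau> z ^ 2)" for z
    proof -
      have "phi 0 1 \<tau> (z + 1) = - phi 0 1 \<tau> z" using phi_plus_1[of 0 1 z] by simp
      then show ?thesis
        by (simp only: phi_plus_1[OF ij]) (simp add: power_mult_distrib flip: power_mult)
    qed
    show "phi i j \<tau> (z + \<tau>) ^ 2 - phi 0 1 \<tau> (z + \<tau>) ^ 2 = 1 * (phi i j \<tau> z ^ 2 - phi 0 1 \<tau> z ^ 2)" for z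
    proof -
      have "phi 0 1 \<tau> (z + \<tau>) = phi 0 1 \<tau> z" using phi_plus_tau[of 0 1 z] by simp
      then show ?thesis
        by (simp only: phi_plus_tau[OF ij]) (simp add: power_mult_distrib flip: power_mult)
    qed
    have "(\<lambda>z. 2 * (w z - v01 z) + z ^ 2 * (w z ^ 2 - v01 z ^ 2)) \<midarrow>0\<rightarrow> 2 * (w 0 - v01 0) + 0 ^ 2 * (w 0 ^ 2 - v01 0 ^ 2)"
      by (intro tendsto_intros lims lim w)
    then have "(\<lambda>z. 2 * (w z - v01 z) + z ^ 2 * (w z ^ 2 - v01 z ^ 2)) \<midarrow>0\<rightarrow> 2 * (w 0 - v01 0)" by simp
    then show "(\<lambda>z. phi i j \<tau> z ^ 2 - phi 0 1 \<tau> z ^ 2) \<midarrow>0\<rightarrow> 2 * (w 0 - v01 0)"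
    proof (rule Lim_transform_eventually)
      show "\<forall>\<^sub>F z in at 0. 2 * (w z - v01 z) + z ^ 2 * (w z ^ 2 - v01 z ^ 2) = phi i j \<tau> z ^ 2 - phi 0 1 \<tau> z ^ 2"
        using near by eventually_elim (subst w(2), simp, subst e01, simp, simp add: field_simps power2_eq_square)
    qed
  qed auto
  note nz = theta_null_nonzero[OF tau]
  have h1: "1/2 \<notin> lat \<tau>" "(1 + \<tau>) / 2 \<notin> lat \<tau>"
    unfolding theta1_eq_0_iff[OF tau, symmetric] theta_half_periods[OF tau] using nz by simp_all
  \<comment> \<open>At 1/2, \<open>f_10\<close> vanishes and \<open>f_01\<close> equals
    \<open>pi * theta3^2\<close>, that is \<open>2 K\<close>. At \<open>(1 + \<tau>) / 2\<close>,
    \<open>f_11\<close> vanishes and \<open>f_01\<close> equals \<open>pi * theta2^2\<close>, whose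
    square is \<lambda> times that of \<open>2 K\<close>.\<close>
  have d1: "- ((of_real pi * theta3 0 \<tau> ^ 2) ^ 2) = 2 * (v10 0 - v01 0)"
    using diff[OF v(1) e10 _ h1(1)] nz
    by (simp add: phi_def theta_num_def theta_half_periods[OF tau] field_simps power2_eq_square)
  have d2: "- ((of_real pi * theta2 0 \<tau> ^ 2) ^ 2) = 2 * (v11 0 - v01 0)"
    using diff[OF v(2) e11 _ h1(2)] nz
    by (simp add: phi_def theta_num_def theta_half_periods[OF tau] field_simps power2_eq_square)
  define X where "X = (2 * period_K \<tau>) ^ 2"
  have X: "(of_real pi * theta3 0 \<tau> ^ 2) ^ 2 = X" "(of_real pi * theta2 0 \<tau> ^ 2) ^ 2 = lambda_mod \<tau> * X"
    unfolding X_def period_K_def lambda_mod_def modulus_k_def using nz by (simp_all add: field_simps)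
  define Y where "Y = lambda_mod \<tau> * X"
  have "- X = 2 * (v10 0 - v01 0)" "- Y = 2 * (v11 0 - v01 0)"
    using d1 d2 unfolding X Y_def by auto
  then have 1: "v10 0 = v01 0 - X / 2" "v11 0 = v01 0 - Y / 2"
    by (simp_all add: field_simps)
  with sum have "v01 0 * 3 = X / 2 + Y / 2" by (simp add: algebra_simps)
  then have 3: "v01 0 = X / 6 + Y / 6" by (simp add: field_simps)
  show "v10 0 = C_fun 1 0 \<tau>" "v11 0 = C_fun 1 1 \<tau>" "v01 0 = C_fun 0 1 \<tau>"
    unfolding 1 3 C_fun_def X_def[symmetric] Y_def by (simp_all add: field_simps)
qed

lemma phi_parity_cong:
  "odd i = odd i' \<Longrightarrow> odd j = odd j' \<Longrightarrow> phi i j = phi i' j'"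
  "odd i = odd i' \<Longrightarrow> odd j = odd j' \<Longrightarrow> C_fun i j = C_fun i' j'"
  by (auto simp: fun_eq_iff phi_def theta_num_def C_fun_def)

lemma phi_laurent:
  assumes "odd i \<or> odd j"
  obtains v :: "complex \<Rightarrow> complex" and r where "r > 0" "v holomorphic_on ball 0 r" "v 0 = C_fun i j \<tau>"
    "\<And>z. z \<in> ball 0 r - {0} \<Longrightarrow> phi i j \<tau> z = (1 + z ^ 2 * v z) / z"
proof -
  obtain v10 r10 where 1: "r10 > 0" "v10 holomorphic_on ball 0 r10"
    "\<And>z. z \<in> ball 0 r10 - {0} \<Longrightarrow> phi 1 0 \<tau> z = (1 + z ^ 2 * v10 z) / z"
    using phi_expansion by metis
  obtain v11 r11 where 2: "r11 > 0" "v11 holomorphic_on ball 0 r11"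
    "\<And>z. z \<in> ball 0 r11 - {0} \<Longrightarrow> phi 1 1 \<tau> z = (1 + z ^ 2 * v11 z) / z"
    using phi_expansion by metis
  obtain v01 r01 where 3: "r01 > 0" "v01 holomorphic_on ball 0 r01"
    "\<And>z. z \<in> ball 0 r01 - {0} \<Longrightarrow> phi 0 1 \<tau> z = (1 + z ^ 2 * v01 z) / z"
    using phi_expansion by metis
  \<comment> \<open>A common radius, because the coefficients are determined from all three
    expansions together.\<close>
  define r where "r = min r10 (min r11 r01)"
  have r: "r > 0" using 1 2 3 by (simp add: r_def)
  have hol: "v10 holomorphic_on ball 0 r" "v11 holomorphic_on ball 0 r" "v01 holomorphic_on ball 0 r"
    by (rule holomorphic_on_subset[OF 1(2)] holomorphic_on_subset[OF 2(2)] holomorphic_on_subset[OF 3(2)], auto simp: r_def)+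
  have ex: "\<And>z. z \<in> ball 0 r - {0} \<Longrightarrow> phi 1 0 \<tau> z = (1 + z ^ 2 * v10 z) / z"
    "\<And>z. z \<in> ball 0 r - {0} \<Longrightarrow> phi 1 1 \<tau> z = (1 + z ^ 2 * v11 z) / z"
    "\<And>z. z \<in> ball 0 r - {0} \<Longrightarrow> phi 0 1 \<tau> z = (1 + z ^ 2 * v01 z) / z"
    using 1(3) 2(3) 3(3) by (auto simp: r_def)
  note C = phi_constants[OF r hol ex]
  consider "odd i = odd (1::nat)" "odd j = odd (0::nat)" | "odd i = odd (1::nat)" "odd j = odd (1::nat)"
    | "odd i = odd (0::nat)" "odd j = odd (1::nat)"
    using assms by auto
  then show ?thesis
  proof cases
    case 1
    show ?thesis
      by (rule that[OF r hol(1)]) (use C(1) ex(1) in \<open>simp_all only: phi_parity_cong[OF 1]\<close>)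
  next
    case 2
    show ?thesis
      by (rule that[OF r hol(2)]) (use C(2) ex(2) in \<open>simp_all only: phi_parity_cong[OF 2]\<close>)
  next
    case 3
    show ?thesis
      by (rule that[OF r hol(3)]) (use C(3) ex(3) in \<open>simp_all only: phi_parity_cong[OF 3]\<close>)
  qed
qed

end

subsection \<open>Residues and the reciprocity law\<close>

text \<open>The analogue of Weierstrass's zeta function, equal to the logarithmic derivative of
  \<open>theta1\<close> up to the additive constant \<open>pi * \<i>\<close>. It is strictly
  1-periodic; its whole period defect, \<open>- 2 * pi * \<i>\<close>, occurs under translation by
  \<tau>.\<close>

definition zeta :: "complex \<Rightarrow> complex \<Rightarrow> complex" where
  "zeta \<tau> z = deriv (jsigma \<tau>) z / jsigma \<tau> z"

lemma lat_int_iff: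
  assumes "Im \<tau> > 0"
  shows "of_int M * \<tau> + of_int N = 0 \<longleftrightarrow> M = 0 \<and> N = 0"
  using assms by (auto simp: complex_eq_iff)

context
  fixes \<tau> :: complex
  assumes tau: "Im \<tau> > 0"
begin

lemma zeta_holomorphic: "zeta \<tau> holomorphic_on - lat \<tau>"
  unfolding zeta_def[abs_def]
  by (intro holomorphic_intros holomorphic_on_subset[OF holomorphic_deriv[OF holomorphic_jsigma[OF tau holomorphic_on_ident[of UNIV]]]] tau)
     (auto simp: jsigma_eq_0_iff[OF tau])

lemma deriv_jsigma: "(jsigma \<tau> has_field_derivative deriv (jsigma \<tau>) z) (at z)"
  by (intro field_differentiable_derivI field_differentiable_jsigma tau)

lemma zeta_plus_1: "zeta \<tau> (z + 1) = zeta \<tau> z"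
proof -
  have "((\<lambda>z. jsigma \<tau> (z + 1)) has_field_derivative deriv (jsigma \<tau>) (z + 1)) (at z)"
    unfolding DERIV_shift[symmetric] by (rule deriv_jsigma)
  then have "deriv (jsigma \<tau>) (z + 1) = deriv (jsigma \<tau>) z"
    unfolding jsigma_plus_1 using deriv_jsigma DERIV_unique by blast
  then show ?thesis by (simp add: zeta_def jsigma_plus_1)
qed

lemma zeta_plus_tau:
  assumes "z \<notin> lat \<tau>"
  shows "zeta \<tau> (z + \<tau>) = zeta \<tau> z - 2 * of_real pi * \<i>"
proof -
  define M where "M = - exp (- 2 * of_real pi * \<i> * (\<tau> + z))"
  have "((\<lambda>z. jsigma \<tau> (z + \<tau>)) has_field_derivative deriv (jsigma \<tau>) (z + \<tau>)) (at z)"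
    unfolding DERIV_shift[symmetric] by (rule deriv_jsigma)
  moreover have "((\<lambda>z. - exp (- 2 * of_real pi * \<i> * (\<tau> + z)) * jsigma \<tau> z) has_field_derivative
      - (exp (- 2 * of_real pi * \<i> * (\<tau> + z)) * (- 2 * of_real pi * \<i> * (0 + 1))) * jsigma \<tau> z + deriv (jsigma \<tau>) z * M) (at z)"
    unfolding M_def by (intro DERIV_mult DERIV_minus DERIV_chain2[OF DERIV_exp] DERIV_cmult DERIV_add DERIV_const DERIV_ident deriv_jsigma)
  ultimately have "deriv (jsigma \<tau>) (z + \<tau>) = M * (deriv (jsigma \<tau>) z - 2 * of_real pi * \<i> * jsigma \<tau> z)"
    unfolding jsigma_plus_tau by (subst DERIV_unique) (auto simp: M_def algebra_simps)
  moreover have "M \<noteq> 0" "jsigma \<tau> z \<noteq> 0" using assms by (simp_all add: M_def jsigma_eq_0_iff[OF tau])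
  moreover have "jsigma \<tau> (z + \<tau>) = M * jsigma \<tau> z" by (simp add: jsigma_plus_tau M_def)
  ultimately show ?thesis by (simp add: zeta_def field_simps)
qed

lemma zeta_pole: "(\<lambda>z. z * zeta \<tau> z) \<midarrow>0\<rightarrow> 1"
proof -
  have d0: "deriv (jsigma \<tau>) 0 \<noteq> 0"
    unfolding jsigma_deriv_0[OF tau] using jtheta_null_nonzero[OF tau] by simp
  have "(\<lambda>z. jsigma \<tau> z / z) \<midarrow>0\<rightarrow> deriv (jsigma \<tau>) 0"
    using deriv_jsigma[of 0] by (simp add: DERIV_def)
  moreover have "deriv (jsigma \<tau>) \<midarrow>0\<rightarrow> deriv (jsigma \<tau>) 0"
  proof -
    have "deriv (jsigma \<tau>) holomorphic_on UNIV"
      by (intro holomorphic_deriv holomorphic_jsigma tau holomorphic_on_ident) simp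
    then show ?thesis
      using holomorphic_on_imp_continuous_on continuous_on_eq_continuous_at isCont_def by blast
  qed
  ultimately have "(\<lambda>z. deriv (jsigma \<tau>) z / (jsigma \<tau> z / z)) \<midarrow>0\<rightarrow> deriv (jsigma \<tau>) 0 / deriv (jsigma \<tau>) 0"
    using d0 by (intro tendsto_divide)
  then show ?thesis using d0 by (simp add: zeta_def mult.commute)
qed

text \<open>Subtracting \<open>\<Sum> r zeta (z - p)\<close> from \<open>F\<close> removes all poles and leaves a function that changes by
  \<open>2 \<pi> \<i> \<Sum> r\<close> under translation by \<open>\<tau>\<close>.\<close>

lemma sum_residues_eq_0:
  fixes p r :: "'i \<Rightarrow> complex"
  assumes fin: "finite I"
    and D: "D = {z. \<exists>x\<in>I. z - p x \<in> lat \<tau>}"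
    and inj: "\<And>x y. x \<in> I \<Longrightarrow> y \<in> I \<Longrightarrow> p x - p y \<in> lat \<tau> \<Longrightarrow> x = y"
    and hol: "F holomorphic_on - D"
    and per: "\<And>z. F (z + 1) = F z" "\<And>z. F (z + \<tau>) = F z"
    and lim: "\<And>x. x \<in> I \<Longrightarrow> ((\<lambda>z. (z - p x) * F z) \<longlongrightarrow> r x) (at (p x))"
  shows "(\<Sum>x\<in>I. r x) = 0"
proof -
  define E where "E = (\<lambda>z. F z - (\<Sum>x\<in>I. r x * zeta \<tau> (z - p x)))"
  have zh: "(\<lambda>z. zeta \<tau> (z - q)) holomorphic_on {z. z - q \<notin> lat \<tau>}" for q
    by (rule holomorphic_on_compose_gen[OF _ zeta_holomorphic, unfolded o_def]) (auto intro!: holomorphic_intros)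
  have h1: "E holomorphic_on - D"
    unfolding E_def by (intro holomorphic_intros hol holomorphic_on_subset[OF zh]) (auto simp: D)
  have h2: "E (z + 1) = 1 * E z" for z
  proof -
    have "zeta \<tau> (z + 1 - q) = zeta \<tau> (z - q)" for q
      using zeta_plus_1[of "z - q"] by (simp add: algebra_simps)
    then show ?thesis by (simp add: E_def per)
  qed
  have h3: "E (z + \<tau>) = 1 * E z + 2 * of_real pi * \<i> * (\<Sum>x\<in>I. r x)" if z: "z \<notin> D" for z
  proof -
    have "(\<Sum>x\<in>I. r x * zeta \<tau> (z + \<tau> - p x)) = (\<Sum>x\<in>I. r x * zeta \<tau> (z - p x) - 2 * of_real pi * \<i> * r x)"
    proof (rule sum.cong[OF refl])
      fix x assume "x \<in> I"
      then have "z - p x \<notin> lat \<tau>" using z by (auto simp: D)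
      from zeta_plus_tau[OF this] have "zeta \<tau> (z + \<tau> - p x) = zeta \<tau> (z - p x) - 2 * of_real pi * \<i>"
        by (simp add: diff_add_eq)
      then show "r x * zeta \<tau> (z + \<tau> - p x) = r x * zeta \<tau> (z - p x) - 2 * of_real pi * \<i> * r x"
        by (simp only: right_diff_distrib mult_ac)
    qed
    then show ?thesis by (simp add: E_def per sum_subtractf sum_distrib_left)
  qed
  have h4: "((\<lambda>z. (z - q) * E z) \<longlongrightarrow> 0) (at q)" if "q \<in> p ` I" for q
  proof -
    from that obtain x where x: "x \<in> I" "q = p x" by blast
    have z1: "((\<lambda>z. (z - q) * zeta \<tau> (z - p x)) \<longlongrightarrow> 1) (at q)"
      using zeta_pole unfolding x(2) by (subst at_to_0) (simp add: filterlim_filtermap)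
    \<comment> \<open>By injectivity modulo the lattice only the summand of \<open>x\<close> has a
      pole at \<open>q\<close>; the others are continuous there and contribute 0 to the
      limit.\<close>
    have z2: "((\<lambda>z. (z - q) * zeta \<tau> (z - p y)) \<longlongrightarrow> (q - q) * zeta \<tau> (q - p y)) (at q)" if y: "y \<in> I - {x}" for y
    proof -
      have "q - p y \<notin> lat \<tau>" using inj[of x y] x y by auto
      moreover have "open (- lat \<tau>)" using lat_closed[OF tau] by auto
      ultimately have "isCont (zeta \<tau>) (q - p y)"
        using zeta_holomorphic by (meson ComplI continuous_on_eq_continuous_at holomorphic_on_imp_continuous_on)
      then show ?thesis
        by (intro tendsto_intros isCont_tendsto_compose[of _ "zeta \<tau>"])
    qed
    have "((\<lambda>z. (z - q) * F z - (r x * ((z - q) * zeta \<tau> (z - p x)) + (\<Sum>y\<in>I - {x}. r y * ((z - q) * zeta \<tau> (z - p y)))))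
        \<longlongrightarrow> r x - (r x * 1 + (\<Sum>y\<in>I - {x}. r y * ((q - q) * zeta \<tau> (q - p y))))) (at q)"
      by (rule tendsto_diff[OF lim[OF x(1), folded x(2)] tendsto_add[OF tendsto_mult[OF tendsto_const z1]
            tendsto_sum[OF tendsto_mult[OF tendsto_const z2]]]])
    moreover have "(z - q) * E z = (z - q) * F z - (r x * ((z - q) * zeta \<tau> (z - p x)) + (\<Sum>y\<in>I - {x}. r y * ((z - q) * zeta \<tau> (z - p y))))" for z
      unfolding E_def sum.remove[OF fin x(1)] by (simp add: x(2) algebra_simps sum_distrib_left)
    ultimately show ?thesis by simp
  qed
  have D': "D = {z. \<exists>q\<in>p ` I. z - q \<in> lat \<tau>}" by (simp add: D)
  obtain c where "c = 1 * c + 2 * of_real pi * \<i> * (\<Sum>x\<in>I. r x)"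
    by (rule quasi_elliptic_constant_lat[where E = E and D = D and s = 1 and t = 1
          and \<kappa> = "2 * of_real pi * \<i> * (\<Sum>x\<in>I. r x)" and S = "p ` I",
          OF tau _ _ finite_imageI[OF fin] D' h1 h2 h3 h4]) auto
  then show ?thesis by simp
qed

section \<open>Local behaviour of the product at its poles\<close>

lemma phi_plus_lat:
  assumes "odd i \<or> odd j"
  shows "phi i j \<tau> (z + (of_nat m * \<tau> + of_nat n)) = (-1) ^ (i * m + j * n) * phi i j \<tau> z"
proof -
  have n: "phi i j \<tau> (w + of_nat n) = (-1) ^ (j * n) * phi i j \<tau> w" for w
    by (induction n) (use phi_plus_1[OF tau assms] in \<open>simp_all add: add.assoc[symmetric] power_add add.commute[of 1]\<close>)
  have m: "phi i j \<tau> (w + of_nat m * \<tau>) = (-1) ^ (i * m) * phi i j \<tau> w" for w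
  proof (induction m)
    case (Suc m)
    then show ?case
      using phi_plus_tau[OF tau assms, of "w + of_nat m * \<tau>"] by (simp add: algebra_simps power_add)
  qed simp
  show ?thesis
    using n[of "z + of_nat m * \<tau>"] m[of z] by (simp add: add.assoc power_add)
qed

lemma phi_simple_pole:
  assumes "odd i \<or> odd j"
  shows "(\<lambda>z. z * phi i j \<tau> z) \<midarrow>0\<rightarrow> 1"
proof -
  obtain v r where v: "r > 0" "v holomorphic_on ball 0 r"
    "\<And>z. z \<in> ball 0 r - {0} \<Longrightarrow> phi i j \<tau> z = (1 + z ^ 2 * v z) / z"
    using phi_laurent[OF tau assms] by metis
  have "v \<midarrow>0\<rightarrow> v 0"
    using v(1,2) by (metis centre_in_ball continuous_on_eq_continuous_at holomorphic_on_imp_continuous_on isCont_def open_ball)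
  then have "(\<lambda>z. 1 + z ^ 2 * v z) \<midarrow>0\<rightarrow> 1 + 0 ^ 2 * v 0" by (intro tendsto_intros)
  then have "(\<lambda>z. 1 + z ^ 2 * v z) \<midarrow>0\<rightarrow> 1" by simp
  moreover have "\<forall>\<^sub>F z in at 0. 1 + z ^ 2 * v z = z * phi i j \<tau> z"
    using eventually_at_in_open[of "ball 0 r" 0] v(1) by (auto elim!: eventually_mono simp: v(3))
  ultimately show ?thesis by (rule Lim_transform_eventually)
qed

text \<open>The source of the signs and of the factors \<open>1 / a\<close> and \<open>1 / b\<close>
  in the identity: \<open>a * p\<close> is the lattice point \<open>m * \<tau> + n\<close>, so the
  sign is the multiplier of that translation, and rescaling the argument divides the residue by
  \<open>a\<close>.\<close>

lemma phi_scaled_pole: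
  fixes a i j m n :: nat
  assumes "odd i \<or> odd j" "a > 0"
  defines "p \<equiv> (of_nat m * \<tau> + of_nat n) / of_nat a"
  shows "((\<lambda>z. (z - p) * phi i j \<tau> (of_nat a * z)) \<longlongrightarrow> (-1) ^ (i * m + j * n) / of_nat a) (at p)"
proof -
  have "((\<lambda>z. of_nat a * z) \<longlongrightarrow> 0) (at 0 :: complex filter)" by (auto intro!: tendsto_eq_intros)
  moreover have "\<forall>\<^sub>F z :: complex in at 0. of_nat a * z \<noteq> 0"
    using assms(2) by (auto simp: eventually_at_filter)
  ultimately have "filterlim (\<lambda>z. of_nat a * z) (at (0 :: complex)) (at 0)"
    by (simp add: filterlim_at)
  from filterlim_compose[OF phi_simple_pole[OF assms(1)] this]
  have "((\<lambda>z. of_nat a * z * phi i j \<tau> (of_nat a * z)) \<longlongrightarrow> 1) (at 0)" .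
  from tendsto_mult[OF tendsto_const[of "(-1) ^ (i * m + j * n) / of_nat a"] this]
  have "((\<lambda>z. z * ((-1) ^ (i * m + j * n) * phi i j \<tau> (of_nat a * z))) \<longlongrightarrow> (-1) ^ (i * m + j * n) / of_nat a) (at 0)"
    using assms(2) by (simp add: field_simps)
  moreover have shift: "of_nat a * (z + p) = of_nat a * z + (of_nat m * \<tau> + of_nat n)" for z
  proof -
    have "of_nat a * p = of_nat m * \<tau> + of_nat n" using assms(2) by (simp add: p_def)
    then show ?thesis by (simp only: distrib_left)
  qed
  have "(\<lambda>z. z * ((-1) ^ (i * m + j * n) * phi i j \<tau> (of_nat a * z))) = (\<lambda>z. z * phi i j \<tau> (of_nat a * (z + p)))"
    by (simp only: shift phi_plus_lat[OF assms(1)])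
  ultimately have "((\<lambda>z. z * phi i j \<tau> (of_nat a * (z + p))) \<longlongrightarrow> (-1) ^ (i * m + j * n) / of_nat a) (at 0)"
    by (simp only:)
  then show ?thesis by (subst at_to_0) (simp add: filterlim_filtermap)
qed

lemma isCont_phi:
  assumes "z \<notin> lat \<tau>"
  shows "isCont (phi i j \<tau>) z"
  using phi_analytic[OF tau assms] by (rule analytic_at_imp_isCont)

text \<open>If \<open>b\<close> times the point were a lattice point, \<open>a\<close> would divide
  \<open>b * \<mu>\<close> and \<open>b * \<nu>\<close>, hence \<mu> and \<nu> by coprimality. The
  case \<open>b = 1\<close> says that the point itself is not in the lattice, so both remaining
  factors of the product are finite there.\<close>

lemma division_point_notin_lat:
  assumes "a > 0" "coprime a b" "\<mu> < a" "\<nu> < a" "(\<mu>, \<nu>) \<noteq> (0, 0)"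
  shows "of_nat b * ((of_nat \<mu> * \<tau> + of_nat \<nu>) / of_nat a) \<notin> lat \<tau>"
proof
  assume "of_nat b * ((of_nat \<mu> * \<tau> + of_nat \<nu>) / of_nat a) \<in> lat \<tau>"
  then obtain k l :: int where "of_nat b * ((of_nat \<mu> * \<tau> + of_nat \<nu>) / of_nat a) = of_int k * \<tau> + of_int l"
    by (auto simp: lat_def)
  then have "of_int (int b * int \<mu> - int a * k) * \<tau> + of_int (int b * int \<nu> - int a * l) = 0"
    using assms(1) by (simp add: field_simps)
  then have "int b * int \<mu> = int a * k" "int b * int \<nu> = int a * l"
    using lat_int_iff[OF tau, THEN iffD1] by fastforce+
  then have "int a dvd int (b * \<mu>)" "int a dvd int (b * \<nu>)"
    by simp_all
  then have "a dvd b * \<mu>" "a dvd b * \<nu>"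
    unfolding int_dvd_int_iff by auto
  then have "a dvd \<mu>" "a dvd \<nu>"
    using assms(2) by (simp_all add: coprime_dvd_mult_right_iff)
  then show False
    using assms(3-5) by (auto dest: nat_dvd_not_less)
qed

text \<open>Only the first factor has a pole at \<open>p\<close>. The function \<open>g\<close>
  stands for the correction of the triple pole, which is continuous off the lattice. Exchanging the
  roles of \<open>(a, i, j)\<close> and \<open>(b, m, n)\<close> gives the other family of
  points.\<close>

lemma product_residue_at_division_point:
  fixes a b i j m n k l \<mu> \<nu> :: nat
  assumes "a > 0" "coprime a b" "\<mu> < a" "\<nu> < a" "(\<mu>, \<nu>) \<noteq> (0, 0)" "odd i \<or> odd j"
    and g: "\<And>z. z \<notin> lat \<tau> \<Longrightarrow> isCont g z"
  defines "p \<equiv> (of_nat \<mu> * \<tau> + of_nat \<nu>) / of_nat a"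
  shows "((\<lambda>z. (z - p) * (phi i j \<tau> (of_nat a * z) * phi m n \<tau> (of_nat b * z) * phi k l \<tau> z - g z)) \<longlongrightarrow>
     1 / of_nat a * ((-1) ^ (i * \<mu> + j * \<nu>) * phi m n \<tau> (of_nat b * p) * phi k l \<tau> p)) (at p)"
proof -
  have bp: "of_nat b * p \<notin> lat \<tau>"
    unfolding p_def by (rule division_point_notin_lat[OF assms(1-5)])
  have p: "p \<notin> lat \<tau>"
    using division_point_notin_lat[of a 1 \<mu> \<nu>] assms(1,3,4,5) by (simp add: p_def)
  have "((\<lambda>z. ((z - p) * phi i j \<tau> (of_nat a * z)) * (phi m n \<tau> (of_nat b * z) * phi k l \<tau> z) - (z - p) * g z) \<longlongrightarrow>
     ((-1) ^ (i * \<mu> + j * \<nu>) / of_nat a) * (phi m n \<tau> (of_nat b * p) * phi k l \<tau> p) - (p - p) * g p) (at p)"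
    by (intro tendsto_intros phi_scaled_pole[OF assms(6,1), of \<mu> \<nu>, folded p_def]
        isCont_tendsto_compose[OF isCont_phi[OF bp]] isCont_phi[OF p, unfolded isCont_def] g[OF p, unfolded isCont_def])
  then show ?thesis by (simp add: algebra_simps)
qed

lemma C_fun_sum: "C_fun 1 0 \<tau> + C_fun 1 1 \<tau> + C_fun 0 1 \<tau> = 0"
  by (simp add: C_fun_def field_simps)

text \<open>The product starts with \<open>1 / (a * b * z^3)\<close>, which fixes the coefficient of
  the correction. Substituting \<open>a * z\<close> into an expansion multiplies its coefficient by
  \<open>a^2\<close>, and division by \<open>a * b\<close> leaves \<open>a / b\<close>; likewise
  \<open>b / a\<close> for the second factor.\<close>

lemma product_residue_at_0:
  fixes a b i j m n k l :: nat
  assumes "a > 0" "b > 0" "odd i \<or> odd j" "odd m \<or> odd n" "odd k \<or> odd l"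
  shows "((\<lambda>z. z * (phi i j \<tau> (of_nat a * z) * phi m n \<tau> (of_nat b * z) * phi k l \<tau> z
       - 1 / (of_nat a * of_nat b) * (phi 1 0 \<tau> z * phi 1 1 \<tau> z * phi 0 1 \<tau> z))) \<longlongrightarrow>
     of_nat b / of_nat a * C_fun m n \<tau> + of_nat a / of_nat b * C_fun i j \<tau> + 1 / (of_nat a * of_nat b) * C_fun k l \<tau>) (at 0)"
proof -
  have exp: "\<exists>w. w \<midarrow>0\<rightarrow> of_nat c ^ 2 * C_fun i j \<tau> \<and>
      (\<forall>\<^sub>F z in at 0. phi i j \<tau> (of_nat c * z) = (1 + z ^ 2 * w z) / (of_nat c * z))"
    if c: "c > 0" and ij: "odd i \<or> odd j" for c i j :: nat
  proof -
    obtain v r where v: "r > 0" "v holomorphic_on ball 0 r" "v 0 = C_fun i j \<tau>"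
      "\<And>z. z \<in> ball 0 r - {0} \<Longrightarrow> phi i j \<tau> z = (1 + z ^ 2 * v z) / z"
      using phi_laurent[OF tau ij] by metis
    have "isCont v 0"
      using v(1,2) by (metis centre_in_ball continuous_on_eq_continuous_at holomorphic_on_imp_continuous_on open_ball)
    moreover have "((\<lambda>z. of_nat c * z) \<longlongrightarrow> 0) (at 0 :: complex filter)" by (auto intro!: tendsto_eq_intros)
    ultimately have "(\<lambda>z. v (of_nat c * z)) \<midarrow>0\<rightarrow> v 0"
      using isCont_tendsto_compose by blast
    then have "(\<lambda>z. of_nat c ^ 2 * v (of_nat c * z)) \<midarrow>0\<rightarrow> of_nat c ^ 2 * C_fun i j \<tau>"
      unfolding v(3) by (intro tendsto_intros)
    moreover have "\<forall>\<^sub>F z in at 0. phi i j \<tau> (of_nat c * z) = (1 + z ^ 2 * (of_nat c ^ 2 * v (of_nat c * z))) / (of_nat c * z)"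
    proof -
      have "\<forall>\<^sub>F z :: complex in at 0. z \<in> ball 0 (r / of_nat c) - {0}"
        using v(1) c by (intro eventually_at_in_open) auto
      then show ?thesis
      proof eventually_elim
        case (elim z)
        then have "of_nat c * z \<in> ball 0 r - {0}" using c by (auto simp: norm_mult field_simps)
        then show ?case using v(4)[of "of_nat c * z"] by (simp add: power_mult_distrib mult_ac)
      qed
    qed
    ultimately show ?thesis by blast
  qed
  obtain A where A: "A \<midarrow>0\<rightarrow> of_nat a ^ 2 * C_fun i j \<tau>" "\<forall>\<^sub>F z in at 0. phi i j \<tau> (of_nat a * z) = (1 + z ^ 2 * A z) / (of_nat a * z)"
    using exp[OF assms(1,3)] by blast
  obtain B where B: "B \<midarrow>0\<rightarrow> of_nat b ^ 2 * C_fun m n \<tau>" "\<forall>\<^sub>F z in at 0. phi m n \<tau> (of_nat b * z) = (1 + z ^ 2 * B z) / (of_nat b * z)"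
    using exp[OF assms(2,4)] by blast
  have exp1: "\<exists>w. w \<midarrow>0\<rightarrow> C_fun i j \<tau> \<and> (\<forall>\<^sub>F z in at 0. phi i j \<tau> z = (1 + z ^ 2 * w z) / z)"
    if "odd i \<or> odd j" for i j
    using exp[of 1, OF _ that] by simp
  obtain C where C: "C \<midarrow>0\<rightarrow> C_fun k l \<tau>" "\<forall>\<^sub>F z in at 0. phi k l \<tau> z = (1 + z ^ 2 * C z) / z"
    using exp1[OF assms(5)] by blast
  obtain X where X: "X \<midarrow>0\<rightarrow> C_fun 1 0 \<tau>" "\<forall>\<^sub>F z in at 0. phi 1 0 \<tau> z = (1 + z ^ 2 * X z) / z"
    using exp1[of 1 0] by auto
  obtain Y where Y: "Y \<midarrow>0\<rightarrow> C_fun 1 1 \<tau>" "\<forall>\<^sub>F z in at 0. phi 1 1 \<tau> z = (1 + z ^ 2 * Y z) / z"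
    using exp1[of 1 1] by auto
  obtain Z where Z: "Z \<midarrow>0\<rightarrow> C_fun 0 1 \<tau>" "\<forall>\<^sub>F z in at 0. phi 0 1 \<tau> z = (1 + z ^ 2 * Z z) / z"
    using exp1[of 0 1] by auto
  \<comment> \<open>The three numerators multiply to \<open>1 + z^2 * q\<close>, with
    \<open>q\<close> tending to the sum of their coefficients. The leading 1 is common to the
    product and the correction and cancels.\<close>
  define q where "q = (\<lambda>z u v w :: complex. u + v + w + z ^ 2 * (u * v + u * w + v * w) + z ^ 4 * (u * v * w))"
  have q: "(1 + z ^ 2 * u) * (1 + z ^ 2 * v) * (1 + z ^ 2 * w) = 1 + z ^ 2 * q z u v w" for z u v w
    by (simp add: q_def algebra_simps power2_eq_square power4_eq_xxxx)
  have q0: "(\<lambda>z. q z (f z) (g z) (h z)) \<midarrow>0\<rightarrow> x + y + z" if "f \<midarrow>0\<rightarrow> x" "g \<midarrow>0\<rightarrow> y" "h \<midarrow>0\<rightarrow> z" for f g h x y z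
  proof -
    have "(\<lambda>z. q z (f z) (g z) (h z)) \<midarrow>0\<rightarrow> q 0 x y z"
      unfolding q_def by (intro tendsto_intros that)
    then show ?thesis by (simp add: q_def)
  qed
  have "(\<lambda>z. 1 / (of_nat a * of_nat b) * (q z (A z) (B z) (C z) - q z (X z) (Y z) (Z z))) \<midarrow>0\<rightarrow>
     1 / (of_nat a * of_nat b) * ((of_nat a ^ 2 * C_fun i j \<tau> + of_nat b ^ 2 * C_fun m n \<tau> + C_fun k l \<tau>) -
        (C_fun 1 0 \<tau> + C_fun 1 1 \<tau> + C_fun 0 1 \<tau>))"
    by (intro tendsto_intros q0 A B C X Y Z)
  also have "1 / (of_nat a * of_nat b) * ((of_nat a ^ 2 * C_fun i j \<tau> + of_nat b ^ 2 * C_fun m n \<tau> + C_fun k l \<tau>) -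
        (C_fun 1 0 \<tau> + C_fun 1 1 \<tau> + C_fun 0 1 \<tau>)) =
     of_nat b / of_nat a * C_fun m n \<tau> + of_nat a / of_nat b * C_fun i j \<tau> + 1 / (of_nat a * of_nat b) * C_fun k l \<tau>"
    unfolding C_fun_sum using assms(1,2) by (simp add: field_simps power2_eq_square)
  finally show ?thesis
  proof (rule Lim_transform_eventually)
    show "\<forall>\<^sub>F z in at 0. 1 / (of_nat a * of_nat b) * (q z (A z) (B z) (C z) - q z (X z) (Y z) (Z z)) =
       z * (phi i j \<tau> (of_nat a * z) * phi m n \<tau> (of_nat b * z) * phi k l \<tau> z
       - 1 / (of_nat a * of_nat b) * (phi 1 0 \<tau> z * phi 1 1 \<tau> z * phi 0 1 \<tau> z))"
      using A(2) B(2) C(2) X(2) Y(2) Z(2) eventually_neq_at_within[of 0]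
    proof eventually_elim
      case (elim z)
      have e1: "phi i j \<tau> (of_nat a * z) * phi m n \<tau> (of_nat b * z) * phi k l \<tau> z =
          ((1 + z ^ 2 * A z) * (1 + z ^ 2 * B z) * (1 + z ^ 2 * C z)) / (of_nat a * of_nat b * z ^ 3)"
        unfolding elim(1-3) by (simp add: power3_eq_cube)
      have e2: "phi 1 0 \<tau> z * phi 1 1 \<tau> z * phi 0 1 \<tau> z =
          ((1 + z ^ 2 * X z) * (1 + z ^ 2 * Y z) * (1 + z ^ 2 * Z z)) / z ^ 3"
        unfolding elim(4-6) by (simp add: power3_eq_cube)
      show ?case
        unfolding e1 e2 q using elim(7) assms(1,2) by (simp add: field_simps power2_eq_square power3_eq_cube)
    qed
  qed
qed

lemma phi_reciprocity:
  fixes a b i j m n :: nat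
  assumes "a > 0" "b > 0" "coprime a b" "odd i \<or> odd j" "odd m \<or> odd n"
    and kl: "odd k \<or> odd l" "k = i * a + m * b" "l = j * a + n * b"
  shows "1 / of_nat a * (\<Sum>(\<mu>, \<nu>) \<in> {0..<a} \<times> {0..<a} - {(0, 0)}. (-1) ^ (i * \<mu> + j * \<nu>)
        * phi m n \<tau> (of_nat b * ((of_nat \<mu> * \<tau> + of_nat \<nu>) / of_nat a)) * phi k l \<tau> ((of_nat \<mu> * \<tau> + of_nat \<nu>) / of_nat a))
     + 1 / of_nat b * (\<Sum>(\<mu>, \<nu>) \<in> {0..<b} \<times> {0..<b} - {(0, 0)}. (-1) ^ (m * \<mu> + n * \<nu>)
        * phi i j \<tau> (of_nat a * ((of_nat \<mu> * \<tau> + of_nat \<nu>) / of_nat b)) * phi k l \<tau> ((of_nat \<mu> * \<tau> + of_nat \<nu>) / of_nat b))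
     = - (of_nat b / of_nat a) * C_fun m n \<tau> - of_nat a / of_nat b * C_fun i j \<tau> - 1 / (of_nat a * of_nat b) * C_fun k l \<tau>"
proof -
  define pt where "pt = (\<lambda>c x. (of_nat (fst x) * \<tau> + of_nat (snd x)) / of_nat c :: complex)"
  define rA where "rA = (\<lambda>x. 1 / of_nat a * ((-1) ^ (i * fst x + j * snd x) * phi m n \<tau> (of_nat b * pt a x) * phi k l \<tau> (pt a x)))"
  define rB where "rB = (\<lambda>x. 1 / of_nat b * ((-1) ^ (m * fst x + n * snd x) * phi i j \<tau> (of_nat a * pt b x) * phi k l \<tau> (pt b x)))"
  define r0 where "r0 = of_nat b / of_nat a * C_fun m n \<tau> + of_nat a / of_nat b * C_fun i j \<tau> + 1 / (of_nat a * of_nat b) * C_fun k l \<tau>"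
  define A where "A = {0..<a} \<times> {0..<a}"
  \<comment> \<open>The origin is a division point for both \<open>a\<close> and \<open>b\<close>.
    It is counted once, through \<open>A\<close>, where \<open>r\<close> assigns it the special
    residue \<open>r0\<close>.\<close>
  define B where "B = {0..<b} \<times> {0..<b} - {(0, 0)}"
  define p where "p = case_sum (pt a) (pt b)"
  define r where "r = case_sum (\<lambda>x. if x = (0, 0) then r0 else rA x) rB"
  define D where "D = {z. \<exists>x\<in>A <+> B. z - p x \<in> lat \<tau>}"
  define g where "g = (\<lambda>z. 1 / (of_nat a * of_nat b) * (phi 1 0 \<tau> z * phi 1 1 \<tau> z * phi 0 1 \<tau> z))"
  define F where "F = (\<lambda>z. phi i j \<tau> (of_nat a * z) * phi m n \<tau> (of_nat b * z) * phi k l \<tau> z - g z)"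
  have zero_A: "(0, 0) \<in> A" using assms(1) by (simp add: A_def)
  have "(\<Sum>x\<in>A <+> B. r x) = 0"
  proof (rule sum_residues_eq_0[where p = p and F = F and D = D])
    show "finite (A <+> B)" by (simp add: A_def B_def)
    show "D = {z. \<exists>x\<in>A <+> B. z - p x \<in> lat \<tau>}" by (rule D_def)
  next
    fix x y assume xy: "x \<in> A <+> B" "y \<in> A <+> B" "p x - p y \<in> lat \<tau>"
    \<comment> \<open>Clear denominators and compare the coefficients of \<tau> and 1, which are
      independent over the integers.\<close>
    have diff: "\<exists>k l :: int. int d * int \<mu> - int c * int \<mu>' = int c * int d * k \<and> int d * int \<nu> - int c * int \<nu>' = int c * int d * l"
      if "pt c (\<mu>, \<nu>) - pt d (\<mu>', \<nu>') \<in> lat \<tau>" "c > 0" "d > 0" for c d \<mu> \<nu> \<mu>' \<nu>'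
    proof -
      from that(1) obtain k l :: int where "pt c (\<mu>, \<nu>) - pt d (\<mu>', \<nu>') = of_int k * \<tau> + of_int l"
        by (auto simp: lat_def)
      then have "of_int (int d * int \<mu> - int c * int \<mu>' - int c * int d * k) * \<tau> +
          of_int (int d * int \<nu> - int c * int \<nu>' - int c * int d * l) = 0"
        using that(2,3) by (simp add: pt_def field_simps)
      then have "int d * int \<mu> - int c * int \<mu>' - int c * int d * k = 0 \<and> int d * int \<nu> - int c * int \<nu>' - int c * int d * l = 0"
        by (subst (asm) lat_int_iff[OF tau])
      then show ?thesis by (intro exI[of _ k] exI[of _ l]) simp
    qed
    have same: "u = v" if "pt c u - pt c v \<in> lat \<tau>" "c > 0" "u \<in> {0..<c} \<times> {0..<c}" "v \<in> {0..<c} \<times> {0..<c}" for c u v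
    proof -
      obtain \<mu> \<nu> \<mu>' \<nu>' where uv: "u = (\<mu>, \<nu>)" "v = (\<mu>', \<nu>')" by (cases u, cases v)
      from diff[OF that(1)[unfolded uv] that(2,2)] obtain k l :: int
        where "int c * (int \<mu> - int \<mu>') = int c * (int c * k)" "int c * (int \<nu> - int \<nu>') = int c * (int c * l)"
        by (auto simp: algebra_simps)
      then have "int \<mu> - int \<mu>' = int c * k" "int \<nu> - int \<nu>' = int c * l"
        using that(2) by simp_all
      then have "int c dvd int \<mu> - int \<mu>'" "int c dvd int \<nu> - int \<nu>'" by simp_all
      moreover have "x = y" if "int c dvd int x - int y" "x < c" "y < c" for x y
        using dvd_imp_le_int[OF _ that(1)] that(2,3) by fastforce
      ultimately show ?thesis using that(3,4) by (auto simp: uv)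
    qed
    \<comment> \<open>A coincidence makes \<open>b\<close> divide \<open>a * \<mu>'\<close> and
      \<open>a * \<nu>'\<close>. By coprimality it divides both coordinates of \<open>v\<close>,
      which are below \<open>b\<close> and not both 0.\<close>
    have mixed: False if "pt a u - pt b v \<in> lat \<tau>" "u \<in> A" "v \<in> B" for u v
    proof -
      obtain \<mu> \<nu> \<mu>' \<nu>' where uv: "u = (\<mu>, \<nu>)" "v = (\<mu>', \<nu>')" by (cases u, cases v)
      from diff[OF that(1)[unfolded uv] assms(1,2)] obtain k l :: int
        where "int b * int \<mu> - int a * int \<mu>' = int a * int b * k" "int b * int \<nu> - int a * int \<nu>' = int a * int b * l"
        by blast
      then have "int (a * \<mu>') = int b * (int \<mu> - int a * k)" "int (a * \<nu>') = int b * (int \<nu> - int a * l)"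
        by (simp_all add: algebra_simps)
      then have "int b dvd int (a * \<mu>')" "int b dvd int (a * \<nu>')"
        by (simp_all only: dvd_triv_left)
      then have "b dvd a * \<mu>'" "b dvd a * \<nu>'" unfolding int_dvd_int_iff .
      then have "b dvd \<mu>'" "b dvd \<nu>'"
        using assms(3) by (simp_all add: coprime_dvd_mult_right_iff coprime_commute)
      then show False using that(3) by (auto simp: B_def uv dest: nat_dvd_not_less)
    qed
    have mixed': False if "pt b v - pt a u \<in> lat \<tau>" "u \<in> A" "v \<in> B" for u v
    proof (rule mixed[OF _ that(2,3)])
      from that(1) obtain k l where "pt b v - pt a u = of_int k * \<tau> + of_int l" by (auto simp: lat_def)
      then have "pt a u - pt b v = of_int (- k) * \<tau> + of_int (- l)" by (simp add: algebra_simps)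
      then show "pt a u - pt b v \<in> lat \<tau>" unfolding lat_def by blast
    qed
    show "x = y"
    proof (cases x)
      case x: (Inl u)
      then have u: "u \<in> A" using xy(1) by auto
      show ?thesis
      proof (cases y)
        case y: (Inl v)
        then have "v \<in> A" using xy(2) by auto
        with u show ?thesis using same[of a u v] xy(3) assms(1) by (simp add: x y p_def A_def)
      next
        case y: (Inr v)
        then have "v \<in> B" using xy(2) by auto
        with u show ?thesis using mixed[of u v] xy(3) by (simp add: x y p_def)
      qed
    next
      case x: (Inr u)
      then have u: "u \<in> B" using xy(1) by auto
      show ?thesis
      proof (cases y)
        case y: (Inl v)
        then have "v \<in> A" using xy(2) by auto
        with u show ?thesis using mixed'[of u v] xy(3) by (simp add: x y p_def)
      next
        case y: (Inr v)
        then have "v \<in> B" using xy(2) by auto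
        with u show ?thesis using same[of b u v] xy(3) assms(2) by (simp add: x y p_def B_def)
      qed
    qed
  next
    \<comment> \<open>Division with remainder by \<open>c\<close> in both lattice coordinates of
      \<open>c * z\<close> picks the representative; the quotients form the lattice vector.\<close>
    have cover: "\<exists>x\<in>{0..<c} \<times> {0..<c}. z - pt c x \<in> lat \<tau>" if "of_nat c * z \<in> lat \<tau>" "c > 0" for c z
    proof -
      from that(1) obtain M N where MN: "of_nat c * z = of_int M * \<tau> + of_int N" by (auto simp: lat_def)
      define x where "x = (nat (M mod int c), nat (N mod int c))"
      have x: "x \<in> {0..<c} \<times> {0..<c}"
        using that(2) by (auto simp: x_def nat_less_iff)
      have dm: "(of_int K :: complex) = of_nat c * of_int (K div int c) + of_nat (nat (K mod int c))" for K
      proof -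
        have "(of_int K :: complex) = of_int (int c * (K div int c) + K mod int c)"
          by (simp only: mult_div_mod_eq)
        also have "\<dots> = of_nat c * of_int (K div int c) + of_int (K mod int c)"
          by (simp only: of_int_add of_int_mult of_int_of_nat_eq)
        also have "of_int (K mod int c) = (of_nat (nat (K mod int c)) :: complex)"
          using that(2) by (intro of_nat_nat[symmetric]) simp
        finally show ?thesis .
      qed
      have "of_nat c * pt c x = of_nat (fst x) * \<tau> + of_nat (snd x)"
        using that(2) by (simp add: pt_def)
      then have "of_nat c * z = of_nat c * (pt c x + (of_int (M div int c) * \<tau> + of_int (N div int c)))"
        unfolding MN dm[of M] dm[of N] distrib_left by (simp add: x_def algebra_simps)
      then have "z - pt c x = of_int (M div int c) * \<tau> + of_int (N div int c)"
        using that(2) by simp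
      then show ?thesis using x unfolding lat_def by blast
    qed
    \<comment> \<open>Lattice points enter \<open>D\<close> through the index \<open>(0, 0)\<close>
      of \<open>A\<close>. They must be excluded because \<open>phi k l\<close> and the correction
      \<open>g\<close> have poles there.\<close>
    have lat_D: "z \<in> D" if "z \<in> lat \<tau>" for z
      unfolding D_def using that zero_A by (auto simp: p_def pt_def intro!: bexI[of _ "Inl (0, 0)"])
    have aD: "z \<in> D" if "of_nat a * z \<in> lat \<tau>" for z
      using cover[OF that assms(1)] unfolding D_def A_def p_def by (auto intro!: InlI bexI[of _ "Inl _"])
    have bD: "z \<in> D" if z: "of_nat b * z \<in> lat \<tau>" for z
    proof -
      obtain x where x: "x \<in> {0..<b} \<times> {0..<b}" "z - pt b x \<in> lat \<tau>" using cover[OF z assms(2)] by blast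
      show ?thesis
      proof (cases "x = (0, 0)")
        case True
        then show ?thesis using x by (intro lat_D) (simp add: pt_def)
      next
        case False
        then have "Inr x \<in> A <+> B" using x by (auto simp: B_def)
        then show ?thesis unfolding D_def using x(2) by (force simp: p_def)
      qed
    qed
    have comp: "(\<lambda>z. phi i' j' \<tau> (of_nat c * z)) holomorphic_on - D"
      if "\<And>z. of_nat c * z \<in> lat \<tau> \<Longrightarrow> z \<in> D" for c i' j'
      by (rule holomorphic_on_compose_gen[OF _ phi_holomorphic[OF tau], unfolded o_def])
         (use that in \<open>auto intro!: holomorphic_intros\<close>)
    have hphi: "phi i' j' \<tau> holomorphic_on - D" for i' j'
      by (rule holomorphic_on_subset[OF phi_holomorphic[OF tau]]) (use lat_D in auto)
    show "F holomorphic_on - D"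
      unfolding F_def g_def by (intro holomorphic_intros comp hphi aD bD)
  next
    \<comment> \<open>The multipliers of \<open>f_10\<close>, \<open>f_11\<close> and
      \<open>f_01\<close> have exponents \<open>s\<close>, \<open>s + t\<close> and
      \<open>t\<close>, whose sum is even.\<close>
    have sq: "g (z + w) = g z"
      if "\<And>i j. odd i \<or> odd j \<Longrightarrow> phi i j \<tau> (z + w) = (-1) ^ (i * s + j * t) * phi i j \<tau> z" for z w and s t :: nat
      using that[of 1 0] that[of 1 1] that[of 0 1] by (simp add: g_def power_add flip: power_mult_distrib)
    fix z
    have sh: "phi i' j' \<tau> (of_nat c * z + (of_nat (c * s) * \<tau> + of_nat (c * t))) = (-1) ^ (i' * (c * s) + j' * (c * t)) * phi i' j' \<tau> (of_nat c * z)"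
      if "odd i' \<or> odd j'" for i' j' c s t
      by (rule phi_plus_lat[OF that])
    have per: "F (z + (of_nat s * \<tau> + of_nat t)) = F z" for s t
    proof -
      \<comment> \<open>The exponents of the first two factors add up to
        \<open>k * s + l * t\<close>, the exponent of the third. This is where the choice of
        \<open>k\<close> and \<open>l\<close> enters.\<close>
      have ev: "(-1) ^ (i * (a * s) + j * (a * t)) * (-1) ^ (m * (b * s) + n * (b * t)) * (-1) ^ (k * s + l * t) = (1 :: complex)"
      proof -
        have "(-1) ^ (i * (a * s) + j * (a * t)) * (-1) ^ (m * (b * s) + n * (b * t)) * (-1) ^ (k * s + l * t) = ((-1) ^ (2 * (k * s + l * t)) :: complex)"
          unfolding power_add[symmetric] by (rule arg_cong[of _ _ "\<lambda>n. (-1) ^ n"]) (simp add: kl algebra_simps)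
        then show ?thesis by simp
      qed
      have g1: "g (z + (of_nat s * \<tau> + of_nat t)) = g z"
        by (rule sq) (rule phi_plus_lat)
      have sc: "of_nat c * (z + (of_nat s * \<tau> + of_nat t)) = of_nat c * z + (of_nat (c * s) * \<tau> + of_nat (c * t))" for c
        by (simp add: algebra_simps)
      have "F (z + (of_nat s * \<tau> + of_nat t)) =
         ((-1) ^ (i * (a * s) + j * (a * t)) * phi i j \<tau> (of_nat a * z)) * ((-1) ^ (m * (b * s) + n * (b * t)) * phi m n \<tau> (of_nat b * z)) *
         ((-1) ^ (k * s + l * t) * phi k l \<tau> z) - g z"
        unfolding F_def by (simp only: sc g1 sh[OF assms(4)] sh[OF assms(5)] phi_plus_lat[OF kl(1)])
      also have "\<dots> =
         ((-1) ^ (i * (a * s) + j * (a * t)) * (-1) ^ (m * (b * s) + n * (b * t)) * (-1) ^ (k * s + l * t)) *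
         (phi i j \<tau> (of_nat a * z) * phi m n \<tau> (of_nat b * z) * phi k l \<tau> z) - g z"
        by (simp only: mult_ac)
      finally show ?thesis unfolding ev by (simp add: F_def)
    qed
    show "F (z + 1) = F z" using per[of 0 1] by simp
    show "F (z + \<tau>) = F z" using per[of 1 0] by simp
  next
    fix x assume x: "x \<in> A <+> B"
    have g: "isCont g z" if "z \<notin> lat \<tau>" for z
      unfolding g_def by (intro continuous_intros isCont_phi that)
    show "((\<lambda>z. (z - p x) * F z) \<longlongrightarrow> r x) (at (p x))"
    proof (cases x)
      case (Inl u)
      then have u: "u \<in> A" using x by auto
      show ?thesis
      proof (cases "u = (0, 0)")
        case True
        then show ?thesis
          using product_residue_at_0[OF assms(1,2,4,5) kl(1)] by (simp add: Inl p_def pt_def r_def r0_def F_def g_def)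
      next
        case False
        show ?thesis
          using product_residue_at_division_point[OF assms(1,3), of "fst u" "snd u" i j g m n k l] False u assms(4) g
          by (cases u) (auto simp: Inl p_def pt_def r_def rA_def F_def A_def)
      qed
    next
      case (Inr u)
      then have u: "u \<in> B" using x by auto
      have cop: "coprime b a" using assms(3) by (simp add: coprime_commute)
      show ?thesis
        using product_residue_at_division_point[OF assms(2) cop, of "fst u" "snd u" m n g i j k l] u assms(5) g
        by (cases u) (simp add: Inr p_def pt_def r_def rB_def F_def B_def mult.commute[of "phi i j \<tau> _"])
    qed
  qed
  also have "(\<Sum>x\<in>A <+> B. r x) = (\<Sum>x\<in>A. r (Inl x)) + (\<Sum>x\<in>B. r (Inr x))"
    by (subst sum.Plus) (simp_all add: A_def B_def)
  also have "(\<Sum>x\<in>A. r (Inl x)) = r0 + (\<Sum>x\<in>A - {(0, 0)}. rA x)"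
    by (subst sum.remove[OF _ zero_A]) (auto simp: A_def r_def intro!: sum.cong)
  finally have "(\<Sum>x\<in>A - {(0, 0)}. rA x) + (\<Sum>x\<in>B. rB x) = - r0"
    by (simp add: r_def algebra_simps add_eq_0_iff)
  then show ?thesis
    unfolding rA_def rB_def A_def B_def pt_def r0_def sum_distrib_left by (simp add: case_prod_unfold)
qed

end

theorem corollary5:
  fixes a b i j m n :: nat and \<tau> :: complex
  assumes "a > 0" and "b > 0" and "coprime a b"
    and "i \<in> {0, 1}" and "j \<in> {0, 1}" and "m \<in> {0, 1}" and "n \<in> {0, 1}"
    and "(i, j) \<noteq> (0, 0)" and "(m, n) \<noteq> (0, 0)"
    and "\<tau> \<in> fund_domain"
    and "odd (i * a + m * b) \<or> odd (j * a + n * b)"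
  shows
    "1 / of_nat a *
       (\<Sum>(\<mu>, \<nu>) \<in> {0..<a} \<times> {0..<a} - {(0, 0)}.
          (-1) ^ (i * \<mu> + j * \<nu>)
          * f_fun m n (of_nat b * ((of_nat \<mu> * \<tau> + of_nat \<nu>) / of_nat a)) \<tau>
          * f_fun (i * a + m * b) (j * a + n * b) ((of_nat \<mu> * \<tau> + of_nat \<nu>) / of_nat a) \<tau>)
     + 1 / of_nat b *
       (\<Sum>(\<mu>, \<nu>) \<in> {0..<b} \<times> {0..<b} - {(0, 0)}.
          (-1) ^ (m * \<mu> + n * \<nu>)
          * f_fun i j (of_nat a * ((of_nat \<mu> * \<tau> + of_nat \<nu>) / of_nat b)) \<tau>
          * f_fun (i * a + m * b) (j * a + n * b) ((of_nat \<mu> * \<tau> + of_nat \<nu>) / of_nat b) \<tau>)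
     = - (of_nat b / of_nat a) * C_fun m n \<tau>
       - of_nat a / of_nat b * C_fun i j \<tau>
       - 1 / (of_nat a * of_nat b) * C_fun (i * a + m * b) (j * a + n * b) \<tau>"
proof -
  have tau: "Im \<tau> > 0" using assms(10) by (simp add: fund_domain_def)
  have ij: "odd i \<or> odd j" and mn: "odd m \<or> odd n"
    using assms(4-9) by auto
  \<comment> \<open>All arguments in the sums avoid the lattice, so every \<open>f_fun\<close> may
    be replaced by the corresponding \<open>phi\<close>.\<close>
  have f: "f_fun i' j' (of_nat d * ((of_nat \<mu> * \<tau> + of_nat \<nu>) / of_nat c)) \<tau> = phi i' j' \<tau> (of_nat d * ((of_nat \<mu> * \<tau> + of_nat \<nu>) / of_nat c))"
    if "(\<mu>, \<nu>) \<in> {0..<c} \<times> {0..<c} - {(0, 0)}" "odd i' \<or> odd j'" "coprime c d" for c d i' j' \<mu> \<nu>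
    using that by (intro f_fun_eq_phi[OF tau] division_point_notin_lat[OF tau]) auto
  have f1: "f_fun i' j' ((of_nat \<mu> * \<tau> + of_nat \<nu>) / of_nat c) \<tau> = phi i' j' \<tau> ((of_nat \<mu> * \<tau> + of_nat \<nu>) / of_nat c)"
    if "(\<mu>, \<nu>) \<in> {0..<c} \<times> {0..<c} - {(0, 0)}" "odd i' \<or> odd j'" for c i' j' \<mu> \<nu>
    using f[OF that, of 1] by simp
  have cop: "coprime b a" using assms(3) by (simp add: coprime_commute)
  note eq = phi_reciprocity[OF tau assms(1-3) ij mn assms(11) refl refl]
  show ?thesis
    unfolding eq[symmetric]
  proof (intro arg_cong2[of _ _ _ _ "(+)"] arg_cong2[of _ _ _ _ "(*)"] refl sum.cong, goal_cases)
    case (1 x)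
    then obtain \<mu> \<nu> where x: "x = (\<mu>, \<nu>)" "(\<mu>, \<nu>) \<in> {0..<a} \<times> {0..<a} - {(0, 0)}" by (cases x) blast
    show ?case
      unfolding x(1) prod.case f[OF x(2) mn assms(3)] f1[OF x(2) assms(11)] ..
  next
    case (2 x)
    then obtain \<mu> \<nu> where x: "x = (\<mu>, \<nu>)" "(\<mu>, \<nu>) \<in> {0..<b} \<times> {0..<b} - {(0, 0)}" by (cases x) blast
    show ?case
      unfolding x(1) prod.case f[OF x(2) ij cop] f1[OF x(2) assms(11)] ..
  qed
qed

end
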